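(* Let $\mathbf{\Lambda}=(\Lambda_i)_{i\le m}$ be a primitive substitution Delone multiset in $\mathbb{R}^d$ with expansive map $Q$ such that every $\mathbf{\Lambda}$-cluster is legal and $\mathbf{\Lambda}$ has finite local complexity (FLC). Suppose that the dynamical system $(X_{\mathbf{\Lambda}},\mathbb{R}^d,\mu)$ has pure point dynamical spectrum. Then $\Lambda=\bigcup_{i\le m}\Lambda_i$ is a Meyer set.
   Context: A Delone set in $\mathbb{R}^d$ is a relatively dense and uniformly discrete subset; it is a Meyer set if $\Lambda-\Lambda$ is uniformly discrete. A Delone multiset is a tuple $\mathbf{\Lambda}=(\Lambda_i)_{i\le m}$ of subsets of $\mathbb{R}^d$ such that each $\Lambda_i$ and $\mathrm{supp}(\mathbf{\Lambda})=\bigcup_i\Lambda_i$ are Delone sets. Intersections with a set and translations are taken componentwise. A cluster of $\mathbf{\Lambda}$ is a family $\mathbf{P}=(P_i)_{i\le m}$ with $P_i\subset\Lambda_i$ finite. $\mathbf{\Lambda}$ has FLC if for each $R>0$ there is a finite $Y\subset\mathrm{supp}(\mathbf{\Lambda})$ such that for each $x\in\mathrm{supp}(\mathbf{\Lambda})$ there is $y\in Y$ with $B_R(x)\cap\mathbf{\Lambda}=(B_R(y)\cap\mathbf{\Lambda})+(x-y)$. Substitution. A linear map $Q$ of $\mathbb{R}^d$ is expansive if all its eigenvalues have modulus $>1$. $\mathbf{\Lambda}$ is a substitution Delone multiset with expansive map $Q$ if there are finite sets $\mathcal{D}_{ij}\subset\mathbb{R}^d$ with $\Lambda_i=\bigcup_{j=1}^m(Q\Lambda_j+\mathcal{D}_{ij})$,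 $i\le m$, the unions on the right being disjoint (including over elements of $\mathcal{D}_{ij}$). It is primitive if some power of the matrix $(\sharp\mathcal{D}_{ij})_{i,j}$ has only positive entries. For a family $\mathbf{P}=(P_j)_{j\le m}$ of finite sets put $\Phi(\mathbf{P})=\big(\bigcup_{j}(QP_j+\mathcal{D}_{ij})\big)_{i\le m}$; for $x\in\Lambda_j$, $\Phi^k(x)$ denotes $\Phi^k$ applied to the cluster whose only point is $x$, of color $j$. A cluster is legal if it is a translate of a subcluster of $\Phi^k(x)$ for some $j\le m$, $x\in\Lambda_j$, and $k\in\mathbb{Z}_+$. Dynamics. On Delone multisets use the metric $d(\mathbf{\Lambda}_1,\mathbf{\Lambda}_2)=\min\{\tilde d(\mathbf{\Lambda}_1,\mathbf{\Lambda}_2),2^{-1/2}\}$, where $\tilde d$ is the infimum of $\varepsilon>0$ such that $B_{1/\varepsilon}(0)\cap(-x+\mathbf{\Lambda}_1)=B_{1/\varepsilon}(0)\cap(-y+\mathbf{\Lambda}_2)$ for some $x,y\in B_\varepsilon(0)$. $X_{\mathbf{\Lambda}}$ is the closure of the translation orbit $\{-h+\mathbf{\Lambda}:h\in\mathbb{R}^d\}$, with $\mathbb{R}^d$ acting by translations, and $\mu$ is an ergodic translation-invariant Borel probability measure on $X_{\mathbf{\Lambda}}$ (in this setting it is known to be unique). With $U_gf(\mathcal{S})=f(-g+\mathcal{S})$ on $L^2(X_{\mathbf{\Lambda}},\mu)$, $\alpha\in\mathbb{R}^d$ is an eigenvalue if there is $0\ne f\in L^2$ (an eigenfunction) with $U_gf=e^{2\pi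 i g\cdot\alpha}f$ for all $g\in\mathbb{R}^d$. The system has pure point dynamical spectrum if the linear span of the eigenfunctions is dense in $L^2(X_{\mathbf{\Lambda}},\mu)$. *)

theory Defs
  imports "HOL-Analysis.Analysis" "HOL-Probability.Probability_Measure"
begin

section \<open>Delone sets and Delone multisets\<close>

text \<open>A tuple of subsets of Euclidean space is a function on a finite index type \<open>'m\<close>
  of colors; \<open>R^d\<close> is \<^typ>\<open>real^'d\<close>.\<close>

type_synonym ('d, 'm) colored = "'m \<Rightarrow> (real^'d) set"

definition relatively_dense :: "(real^'d) set \<Rightarrow> bool" where
  "relatively_dense A \<longleftrightarrow> (\<exists>R>0. \<forall>x. A \<inter> ball x R \<noteq> {})"

definition delone :: "(real^'d) set \<Rightarrow> bool" where
  "delone A \<longleftrightarrow> relatively_dense A \<and> uniform_discrete A"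

definition meyer :: "(real^'d) set \<Rightarrow> bool" where
  "meyer A \<longleftrightarrow> delone A \<and> uniform_discrete {x - y |x y. x \<in> A \<and> y \<in> A}"

definition supp :: "('d, 'm) colored \<Rightarrow> (real^'d) set" where
  "supp \<Lambda> = (\<Union>i. \<Lambda> i)"

definition delone_multiset :: "('d::finite, 'm::finite) colored \<Rightarrow> bool" where
  "delone_multiset \<Lambda> \<longleftrightarrow> (\<forall>i. delone (\<Lambda> i)) \<and> delone (supp \<Lambda>)"

definition shift :: "real^'d \<Rightarrow> ('d, 'm) colored \<Rightarrow> ('d, 'm) colored" where
  "shift v \<Lambda> = (\<lambda>i. (\<lambda>x. v + x) ` \<Lambda> i)"

definition patch :: "(real^'d) set \<Rightarrow> ('d, 'm) colored \<Rightarrow> ('d, 'm) colored" where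
  "patch B \<Lambda> = (\<lambda>i. B \<inter> \<Lambda> i)"

definition subcluster :: "('d::finite, 'm) colored \<Rightarrow> ('d, 'm) colored \<Rightarrow> bool" where
  "subcluster P \<Lambda> \<longleftrightarrow> (\<forall>i. finite (P i) \<and> P i \<subseteq> \<Lambda> i)"

definition FLC :: "('d::finite, 'm) colored \<Rightarrow> bool" where
  "FLC \<Lambda> \<longleftrightarrow> (\<forall>R>0. \<exists>Y. finite Y \<and> Y \<subseteq> supp \<Lambda> \<and>
     (\<forall>x\<in>supp \<Lambda>. \<exists>y\<in>Y. patch (ball x R) \<Lambda> = shift (x - y) (patch (ball y R) \<Lambda>)))"


section \<open>Substitutions\<close>

text \<open>The eigenvalues of a real linear map include the complex ones, i.e. those of the
  complexification of its matrix.\<close>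

definition complex_eigenvalue :: "(real^'d \<Rightarrow> real^'d) \<Rightarrow> complex \<Rightarrow> bool" where
  "complex_eigenvalue Q z \<longleftrightarrow>
     (\<exists>v. v \<noteq> 0 \<and> map_matrix complex_of_real (matrix Q) *v v = z *s v)"

definition expansive :: "(real^'d \<Rightarrow> real^'d) \<Rightarrow> bool" where
  "expansive Q \<longleftrightarrow> linear Q \<and> (\<forall>z. complex_eigenvalue Q z \<longrightarrow> cmod z > 1)"

text \<open>\<open>D i j\<close> is the finite set of translations placing the inflated points of color \<open>j\<close>
  among the points of color \<open>i\<close>.\<close>

definition subst_map ::
  "(real^'d \<Rightarrow> real^'d) \<Rightarrow> ('m::finite \<Rightarrow> 'm \<Rightarrow> (real^'d) set) \<Rightarrow> ('d, 'm) colored \<Rightarrow> ('d, 'm) colored"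
  where "subst_map Q D P = (\<lambda>i. \<Union>j. {Q x + a |x a. x \<in> P j \<and> a \<in> D i j})"

definition substitution_delone_multiset ::
  "(real^'d \<Rightarrow> real^'d) \<Rightarrow> ('m::finite \<Rightarrow> 'm \<Rightarrow> (real^'d) set) \<Rightarrow> ('d, 'm) colored \<Rightarrow> bool" where
  "substitution_delone_multiset Q D \<Lambda> \<longleftrightarrow>
     delone_multiset \<Lambda> \<and> expansive Q \<and> (\<forall>i j. finite (D i j)) \<and>
     \<Lambda> = subst_map Q D \<Lambda> \<and>
     (\<forall>i. disjoint_family_on (\<lambda>(j, a). (\<lambda>x. Q x + a) ` \<Lambda> j) (SIGMA j:UNIV. D i j))"

definition subst_matrix :: "('m \<Rightarrow> 'm \<Rightarrow> (real^'d) set) \<Rightarrow> nat^'m^'m::finite" where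
  "subst_matrix D = (\<chi> i j. card (D i j))"

text \<open>Matrix powers are iterated \<open>**\<close>; the product and power operations \<open>*\<close>, \<open>^\<close> on vectors
  are componentwise.\<close>

definition primitive :: "('m::finite \<Rightarrow> 'm \<Rightarrow> (real^'d) set) \<Rightarrow> bool" where
  "primitive D \<longleftrightarrow>
     (\<exists>k>0. \<forall>i j. (((\<lambda>A. subst_matrix D ** A) ^^ k) (mat 1)) $ i $ j > 0)"

definition point_cluster :: "'m \<Rightarrow> real^'d \<Rightarrow> ('d, 'm) colored" where
  "point_cluster j x = (\<lambda>i. if i = j then {x} else {})"

definition legal ::
  "(real^'d \<Rightarrow> real^'d) \<Rightarrow> ('m::finite \<Rightarrow> 'm \<Rightarrow> (real^'d) set) \<Rightarrow> ('d, 'm) colored \<Rightarrow>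
   ('d, 'm) colored \<Rightarrow> bool" where
  "legal Q D \<Lambda> P \<longleftrightarrow> (\<exists>j. \<exists>x\<in>\<Lambda> j. \<exists>k>0. \<exists>P' v.
     subcluster P' ((subst_map Q D ^^ k) (point_cluster j x)) \<and> P = shift v P')"


section \<open>The metric on Delone multisets\<close>

definition matches :: "real \<Rightarrow> ('d::finite, 'm) colored \<Rightarrow> ('d, 'm) colored \<Rightarrow> bool" where
  "matches e \<Lambda>1 \<Lambda>2 \<longleftrightarrow> (\<exists>x\<in>ball 0 e. \<exists>y\<in>ball 0 e.
     patch (ball 0 (1/e)) (shift (- x) \<Lambda>1) = patch (ball 0 (1/e)) (shift (- y) \<Lambda>2))"

text \<open>The infimum is taken in the extended reals, so that it is \<open>\<infinity>\<close> when there is no match.\<close>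

definition pre_dist :: "('d::finite, 'm) colored \<Rightarrow> ('d, 'm) colored \<Rightarrow> ereal" where
  "pre_dist \<Lambda>1 \<Lambda>2 = Inf {ereal e |e. e > 0 \<and> matches e \<Lambda>1 \<Lambda>2}"

definition delone_dist :: "('d::finite, 'm) colored \<Rightarrow> ('d, 'm) colored \<Rightarrow> real" where
  "delone_dist \<Lambda>1 \<Lambda>2 = real_of_ereal (min (pre_dist \<Lambda>1 \<Lambda>2) (ereal (2 powr (- 1/2))))"

lemma pre_dist_nonneg: "pre_dist \<Lambda>1 \<Lambda>2 \<ge> 0"
  unfolding pre_dist_def by (rule Inf_greatest) auto

lemma delone_dist_nonneg: "delone_dist \<Lambda>1 \<Lambda>2 \<ge> 0"
  unfolding delone_dist_def by (intro real_of_ereal_pos) (simp add: pre_dist_nonneg)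

lemma matches_commute: "matches e \<Lambda>1 \<Lambda>2 \<longleftrightarrow> matches e \<Lambda>2 \<Lambda>1"
  unfolding matches_def by metis

lemma delone_dist_commute: "delone_dist \<Lambda>1 \<Lambda>2 = delone_dist \<Lambda>2 \<Lambda>1"
  unfolding delone_dist_def pre_dist_def by (simp add: matches_commute)

lemma delone_dist_less_iff:
  "delone_dist \<Lambda>1 \<Lambda>2 < r \<longleftrightarrow> 2 powr (- 1/2) < r \<or> (\<exists>e>0. e < r \<and> matches e \<Lambda>1 \<Lambda>2)"
proof -
  have "ereal (delone_dist \<Lambda>1 \<Lambda>2) = min (pre_dist \<Lambda>1 \<Lambda>2) (ereal (2 powr (- 1/2)))"
  proof -
    have "min (pre_dist \<Lambda>1 \<Lambda>2) (ereal (2 powr (- 1/2))) \<noteq> \<infinity>"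
      by (auto simp: min_def)
    moreover have "min (pre_dist \<Lambda>1 \<Lambda>2) (ereal (2 powr (- 1/2))) \<ge> 0"
      by (simp add: pre_dist_nonneg)
    ultimately show ?thesis
      unfolding delone_dist_def by (intro ereal_real') auto
  qed
  then have "delone_dist \<Lambda>1 \<Lambda>2 < r \<longleftrightarrow>
      min (pre_dist \<Lambda>1 \<Lambda>2) (ereal (2 powr (- 1/2))) < ereal r"
    by (metis ereal_less(3) less_ereal.simps(1))
  also have "\<dots> \<longleftrightarrow> 2 powr (- 1/2) < r \<or> (\<exists>e>0. e < r \<and> matches e \<Lambda>1 \<Lambda>2)"
    unfolding min_less_iff_disj pre_dist_def Inf_less_iff by auto
  finally show ?thesis .
qed

lemma mem_shift: "p \<in> shift v \<Lambda> i \<longleftrightarrow> p - v \<in> \<Lambda> i"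
  unfolding shift_def by (force simp: image_iff algebra_simps)

lemma matches_iff:
  "matches e \<Lambda>1 \<Lambda>2 \<longleftrightarrow> (\<exists>x y. norm x < e \<and> norm y < e \<and>
     (\<forall>i p. norm p < 1/e \<longrightarrow> (p + x \<in> \<Lambda>1 i \<longleftrightarrow> p + y \<in> \<Lambda>2 i)))"
  unfolding matches_def patch_def fun_eq_iff set_eq_iff Int_iff mem_shift by (auto simp: Bex_def)

lemma delone_dist_triangle:
  fixes \<Lambda>1 \<Lambda>2 \<Lambda>3 :: "('d::finite, 'm) colored"
  shows "delone_dist \<Lambda>1 \<Lambda>3 \<le> delone_dist \<Lambda>1 \<Lambda>2 + delone_dist \<Lambda>2 \<Lambda>3"
proof (rule ccontr)
  let ?c = "2 powr (- 1/2) :: real"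
  have c2: "?c * ?c = 1/2" by (simp add: powr_add [symmetric] powr_minus_divide)
  assume "\<not> ?thesis"
  then obtain a b where ab: "delone_dist \<Lambda>1 \<Lambda>2 < a" "delone_dist \<Lambda>2 \<Lambda>3 < b"
    "a + b < delone_dist \<Lambda>1 \<Lambda>3"
    using that[of "delone_dist \<Lambda>1 \<Lambda>2 + (delone_dist \<Lambda>1 \<Lambda>3 - delone_dist \<Lambda>1 \<Lambda>2 - delone_dist \<Lambda>2 \<Lambda>3)/3"
        "delone_dist \<Lambda>2 \<Lambda>3 + (delone_dist \<Lambda>1 \<Lambda>3 - delone_dist \<Lambda>1 \<Lambda>2 - delone_dist \<Lambda>2 \<Lambda>3)/3"]
    by (simp add: field_simps)
  have pos: "a > 0" "b > 0" using ab delone_dist_nonneg by (meson le_less_trans)+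
  have "delone_dist \<Lambda>1 \<Lambda>3 \<le> ?c"
  proof (rule dense_ge)
    fix r assume "?c < r"
    then have "delone_dist \<Lambda>1 \<Lambda>3 < r" by (subst delone_dist_less_iff) (rule disjI1)
    then show "delone_dist \<Lambda>1 \<Lambda>3 \<le> r" by (rule less_imp_le)
  qed
  then have c: "a + b < ?c" using ab by simp
  obtain a' where a': "a' > 0" "a' < a" "matches a' \<Lambda>1 \<Lambda>2"
    using ab(1) c pos unfolding delone_dist_less_iff by auto
  obtain b' where b': "b' > 0" "b' < b" "matches b' \<Lambda>2 \<Lambda>3"
    using ab(2) c pos unfolding delone_dist_less_iff by auto
  have c': "a' + b' < ?c" using a' b' c by simp
  obtain x y where xy: "norm x < a'" "norm y < a'"
    "\<And>i p. norm p < 1/a' \<Longrightarrow> (p + x \<in> \<Lambda>1 i \<longleftrightarrow> p + y \<in> \<Lambda>2 i)"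
    using a'(3) unfolding matches_iff by blast
  obtain u v where uv: "norm u < b'" "norm v < b'"
    "\<And>i p. norm p < 1/b' \<Longrightarrow> (p + u \<in> \<Lambda>2 i \<longleftrightarrow> p + v \<in> \<Lambda>3 i)"
    using b'(3) unfolding matches_iff by blast
  have "(a' + b') * (a' + b') \<le> ?c * ?c"
    using c' a' b' by (intro mult_mono) auto
  then have sq: "(a' + b') * (a' + b') \<le> 1" using c2 by simp
  have le_a: "1/(a' + b') + b' \<le> 1/a'"
  proof -
    have "1/a' - 1/(a' + b') = b' / (a' * (a' + b'))" using a' b' by (simp add: field_simps)
    moreover have "a' * (a' + b') \<le> 1"
      using mult_right_mono[of a' "a' + b'" "a' + b'"] sq a' b' by linarith
    then have "b' \<le> b' / (a' * (a' + b'))" using a' b' by (simp add: pos_le_divide_eq mult_left_le)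
    ultimately show ?thesis by simp
  qed
  have le_b: "1/(a' + b') + a' \<le> 1/b'"
  proof -
    have "1/b' - 1/(a' + b') = a' / (b' * (a' + b'))" using a' b' by (simp add: field_simps)
    moreover have "b' * (a' + b') \<le> 1"
      using mult_right_mono[of b' "a' + b'" "a' + b'"] sq a' b' by linarith
    then have "a' \<le> a' / (b' * (a' + b'))" using a' b' by (simp add: pos_le_divide_eq mult_left_le)
    ultimately show ?thesis by simp
  qed
  have "matches (a' + b') \<Lambda>1 \<Lambda>3"
    unfolding matches_iff
  proof (intro exI conjI allI impI)
    show "norm (u + x) < a' + b'" using norm_triangle_ineq[of u x] xy uv by linarith
    show "norm (y + v) < a' + b'" using norm_triangle_ineq[of y v] xy uv by linarith
    fix i :: 'm and p :: "real^'d" assume p: "norm p < 1/(a' + b')"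
    have "norm (p + u) < 1/a'" using norm_triangle_ineq[of p u] p uv le_a by linarith
    moreover have "norm (p + y) < 1/b'" using norm_triangle_ineq[of p y] p xy le_b by linarith
    ultimately show "p + (u + x) \<in> \<Lambda>1 i \<longleftrightarrow> p + (y + v) \<in> \<Lambda>3 i"
      using xy(3)[of "p + u" i] uv(3)[of "p + y" i] by (simp add: add_ac)
  qed
  then have "delone_dist \<Lambda>1 \<Lambda>3 < a + b"
    unfolding delone_dist_less_iff using a' b' by (intro disjI2 exI[of _ "a' + b'"]) auto
  then show False using ab by simp
qed

lemma delone_dist_0_subset:
  assumes d: "delone_dist \<Lambda>1 \<Lambda>2 = 0" and cl: "closed (\<Lambda>2 i)"
  shows "\<Lambda>1 i \<subseteq> \<Lambda>2 i"
proof
  fix q assume q: "q \<in> \<Lambda>1 i"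
  have "\<exists>z\<in>\<Lambda>2 i. dist z q < r" if "r > 0" for r
  proof -
    define s where "s = min (r/2) (min (1/2) (1 / (norm q + 1)))"
    have s: "s > 0" "s \<le> r/2" "s < 2 powr (- 1/2)" "s \<le> 1/(norm q + 1)"
    proof -
      have "(1/2::real) < 2 powr (- 1/2)"
        using powr_less_mono[of "-1" "-1/2" "2::real"] by (simp add: powr_minus_divide)
      then show "s < 2 powr (- 1/2)" unfolding s_def by linarith
    qed (use that in \<open>auto simp: s_def add_nonneg_pos\<close>)
    have "delone_dist \<Lambda>1 \<Lambda>2 < s" using d s by simp
    then obtain e where e: "e > 0" "e < s" "matches e \<Lambda>1 \<Lambda>2"
      unfolding delone_dist_less_iff using s by auto
    then obtain x y where xy: "norm x < e" "norm y < e"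
      "\<And>i p. norm p < 1/e \<Longrightarrow> (p + x \<in> \<Lambda>1 i \<longleftrightarrow> p + y \<in> \<Lambda>2 i)"
      unfolding matches_iff by blast
    have "norm q + 1 \<le> 1/s" using s by (simp add: pos_le_divide_eq add_nonneg_pos mult.commute)
    also have "1/s < 1/e" using e by (simp add: frac_less2)
    finally have "norm q + 1 < 1/e" .
    moreover have "norm (q - x) \<le> norm q + norm x" by (rule norm_triangle_ineq4)
    moreover have "e < 1" using e unfolding s_def by linarith
    ultimately have "norm (q - x) < 1/e" using xy(1) by linarith
    then have "q - x + y \<in> \<Lambda>2 i" using xy(3)[of "q - x" i] q by simp
    moreover have "dist (q - x + y) q < r"
      using norm_triangle_ineq4[of y x] xy(1,2) e s(2) by (simp add: dist_norm)
    ultimately show ?thesis by blast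
  qed
  then have "q \<in> closure (\<Lambda>2 i)" unfolding closure_approachable by blast
  then show "q \<in> \<Lambda>2 i" using cl by simp
qed

lemma Metric_space_delone:
  "Metric_space {\<Lambda> :: ('d::finite, 'm::finite) colored. delone_multiset \<Lambda>} delone_dist"
proof
  fix \<Lambda>1 \<Lambda>2 :: "('d, 'm) colored"
  assume D: "\<Lambda>1 \<in> {\<Lambda>. delone_multiset \<Lambda>}" "\<Lambda>2 \<in> {\<Lambda>. delone_multiset \<Lambda>}"
  then have cl: "closed (\<Lambda>1 i)" "closed (\<Lambda>2 i)" for i
    unfolding delone_multiset_def delone_def
    by (auto intro: uniform_discrete_imp_closed)
  show "delone_dist \<Lambda>1 \<Lambda>2 = 0 \<longleftrightarrow> \<Lambda>1 = \<Lambda>2"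
  proof
    assume "delone_dist \<Lambda>1 \<Lambda>2 = 0"
    then show "\<Lambda>1 = \<Lambda>2"
      by (intro ext equalityI delone_dist_0_subset cl) (simp_all add: delone_dist_commute[of \<Lambda>2])
  next
    assume "\<Lambda>1 = \<Lambda>2"
    then have "matches e \<Lambda>1 \<Lambda>2" if "e > 0" for e
      unfolding matches_iff using that by (intro exI[of _ 0]) auto
    then have "delone_dist \<Lambda>1 \<Lambda>2 < r" if "r > 0" for r
      unfolding delone_dist_less_iff using that by (auto intro: exI[of _ "r/2"])
    then show "delone_dist \<Lambda>1 \<Lambda>2 = 0"
      using delone_dist_nonneg[of \<Lambda>1 \<Lambda>2] by (metis less_irrefl order_le_less)
  qed
qed (rule delone_dist_nonneg delone_dist_commute delone_dist_triangle)+

definition delone_topology :: "('d::finite, 'm::finite) colored topology" where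
  "delone_topology = Metric_space.mtopology {\<Lambda>. delone_multiset \<Lambda>} delone_dist"


section \<open>The dynamical system and its spectrum\<close>

definition orbit_closure :: "('d::finite, 'm::finite) colored \<Rightarrow> ('d, 'm) colored set" where
  "orbit_closure \<Lambda> = delone_topology closure_of (range (\<lambda>h. shift (- h) \<Lambda>))"

definition hull_borel :: "('d::finite, 'm::finite) colored \<Rightarrow> ('d, 'm) colored measure" where
  "hull_borel \<Lambda> = sigma (orbit_closure \<Lambda>) {U. openin (subtopology delone_topology (orbit_closure \<Lambda>)) U}"

definition invariant_probability ::
  "('d::finite, 'm::finite) colored \<Rightarrow> ('d, 'm) colored measure \<Rightarrow> bool" where
  "invariant_probability \<Lambda> \<mu> \<longleftrightarrow> prob_space \<mu> \<and> sets \<mu> = sets (hull_borel \<Lambda>) \<and>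
     (\<forall>g. \<forall>A\<in>sets \<mu>. emeasure \<mu> (shift (- g) -` A \<inter> space \<mu>) = emeasure \<mu> A)"

definition ergodic_probability ::
  "('d::finite, 'm::finite) colored \<Rightarrow> ('d, 'm) colored measure \<Rightarrow> bool" where
  "ergodic_probability \<Lambda> \<mu> \<longleftrightarrow> invariant_probability \<Lambda> \<mu> \<and>
     (\<forall>A\<in>sets \<mu>. (\<forall>g. shift (- g) -` A \<inter> space \<mu> = A) \<longrightarrow>
        emeasure \<mu> A = 0 \<or> emeasure \<mu> A = 1)"

definition L2 :: "'a measure \<Rightarrow> ('a \<Rightarrow> complex) set" where
  "L2 \<mu> = {f \<in> borel_measurable \<mu>. integrable \<mu> (\<lambda>x. (cmod (f x))\<^sup>2)}"

text \<open>Elements of \<open>L2\<close> are functions rather than classes; identities between them hold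
  almost everywhere.\<close>

definition eigenfunction ::
  "('d, 'm) colored measure \<Rightarrow> real^'d \<Rightarrow> (('d, 'm) colored \<Rightarrow> complex) \<Rightarrow> bool" where
  "eigenfunction \<mu> \<alpha> f \<longleftrightarrow> f \<in> L2 \<mu> \<and> \<not> (AE S in \<mu>. f S = 0) \<and>
     (\<forall>g. AE S in \<mu>. f (shift (- g) S) = exp (2 * of_real pi * \<i> * of_real (g \<bullet> \<alpha>)) * f S)"

text \<open>Density in \<open>L2\<close> of the complex linear span of the set of all eigenfunctions.\<close>

definition pure_point_spectrum :: "('d::finite, 'm) colored measure \<Rightarrow> bool" where
  "pure_point_spectrum \<mu> \<longleftrightarrow>
     (\<forall>h\<in>L2 \<mu>. \<forall>e>0. \<exists>F c. finite F \<and> (\<forall>f\<in>F. \<exists>\<alpha>. eigenfunction \<mu> \<alpha> f) \<and>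
        sqrt (\<integral>S. (cmod (h S - (\<Sum>f\<in>F. c f * f S)))\<^sup>2 \<partial>\<mu>) < e)"

end

theory Submission
  imports Defs "HOL-Computational_Algebra.Fundamental_Theorem_Algebra"
begin

text \<open>
  Pure point spectrum yields eigenvalues that span Euclidean space. Let \<open>\<alpha>\<close> be an eigenvalue
  and \<open>x\<close> a return vector, i.e. a difference of two points of the same color. By legality there
  is a relatively dense set of places at which \<open>\<Lambda>\<close> and \<open>\<Lambda> - X\<close> agree on a ball of fixed size, where
  \<open>X\<close> is an inflation of \<open>x\<close>. The substitution turns this into agreement of \<open>\<Lambda>\<close> and \<open>\<Lambda> - Q^n X\<close>
  on a set of positive density that does not depend on \<open>n\<close> (the density is preserved by the linear
  map \<open>Q^n\<close>), and approximating an eigenfunction by uniformly continuous functions shows that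
  \<open>Q^n x \<bullet> \<alpha>\<close> tends to 0 modulo 1.

  By FLC the return vectors of a color generate a finitely generated group, on which \<open>Q\<close> acts by an
  integer matrix; hence the convergence is exponentially fast. Expanding arbitrary return vectors
  in digits from a finite set of return vectors makes the convergence uniform over all return
  vectors. A sum of a few return vectors that is short but nonzero would, under iteration of
  \<open>Q\<close>, have to pass through inner products that are neither small nor close to other
  integers. So such sums are isolated from 0, which gives the Meyer property.
\<close>

section \<open>Distances to the nearest integer\<close>

text \<open>The obstacle is uniformity. The dynamics gives convergence modulo 1 for one return
  vector at a time, while the Meyer property concerns all of them at once. The number of digits in
  the expansion of a return vector grows with its length, so mere convergence for each digit does
  not control the whole vector. The errors have to be summable over the levels; this is what
  exponential convergence is for, and the tail sums then bound all return vectors simultaneously.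
  The substitution is replaced by a power throughout, so that all digit sets are nonempty and the
  expansion at least doubles Euclidean lengths: accumulated digits are then bounded by a geometric
  series, and modified differences become shorter from one level of the hierarchy to the
  next.\<close>

definition int_dist :: "real \<Rightarrow> real" where
  "int_dist t = \<bar>t - of_int (round t)\<bar>"

lemma int_dist_le: "int_dist t \<le> \<bar>t - of_int k\<bar>"
  unfolding int_dist_def using round_diff_minimal[of t k] by (simp add: abs_minus_commute)

lemma int_dist_nonneg [simp]: "0 \<le> int_dist t"
  by (simp add: int_dist_def)

lemma int_dist_0 [simp]: "int_dist 0 = 0"
  by (simp add: int_dist_def)

lemma int_dist_eq_abs: "\<bar>t\<bar> \<le> 1/2 \<Longrightarrow> int_dist t = \<bar>t\<bar>"
proof -
  assume t: "\<bar>t\<bar> \<le> 1/2"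
  have "\<bar>t\<bar> \<le> \<bar>t - of_int k\<bar>" for k
  proof (cases "k = 0")
    case False
    then have "\<bar>real_of_int k\<bar> \<ge> 1" by linarith
    then show ?thesis using t by linarith
  qed simp
  then show ?thesis using int_dist_le[of t 0] by (simp add: int_dist_def antisym)
qed

lemma int_dist_add: "int_dist (s + t) \<le> int_dist s + int_dist t"
  using int_dist_le[of "s + t" "round s + round t"] unfolding int_dist_def[of s] int_dist_def[of t]
  by simp

lemma int_dist_minus [simp]: "int_dist (- t) = int_dist t"
proof -
  have "int_dist (- t) \<le> int_dist t" for t
    using int_dist_le[of "- t" "- round t"] unfolding int_dist_def[of t] by simp
  from this[of t] this[of "- t"] show ?thesis by simp
qed

lemma int_dist_diff: "int_dist (s - t) \<le> int_dist s + int_dist t"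
  using int_dist_add[of s "- t"] by simp

lemma int_dist_of_int_mult: "int_dist (of_int c * t) \<le> \<bar>of_int c\<bar> * int_dist t"
proof -
  have "int_dist (of_int c * t) \<le> \<bar>of_int c * t - of_int (c * round t)\<bar>"
    by (rule int_dist_le)
  also have "\<dots> = \<bar>of_int c\<bar> * int_dist t"
    unfolding int_dist_def abs_mult[symmetric] by (simp add: algebra_simps)
  finally show ?thesis .
qed

lemma int_dist_sum: "int_dist (\<Sum>i\<in>A. f i) \<le> (\<Sum>i\<in>A. int_dist (f i))"
proof (induction A rule: infinite_finite_induct)
  case (insert x F)
  then show ?case using int_dist_add[of "f x" "sum f F"] by simp
qed auto

section \<open>Orbits of integer matrices modulo 1\<close>

text \<open>By Gaussian elimination, one coordinate at a time.\<close>

lemma finite_family_spans: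
  fixes E :: "'a \<Rightarrow> 'i \<Rightarrow> real"
  assumes "finite I"
  shows "\<exists>K C. finite K \<and> C \<ge> 0 \<and> (\<forall>n. \<exists>b. (\<forall>i\<in>I. E n i = (\<Sum>k\<in>K. b k * E k i)) \<and>
           (\<forall>k\<in>K. \<bar>b k\<bar> \<le> C * (\<Sum>i\<in>I. \<bar>E n i\<bar>)))"
  using assms
proof (induction I arbitrary: E rule: finite_induct)
  case empty
  show ?case by (rule exI[of _ "{}"]) (auto intro: exI[of _ 0])
next
  case (insert i0 I)
  show ?case
  proof (cases "\<forall>n. E n i0 = 0")
    case True
    then show ?thesis using insert.IH[of E] insert.hyps by simp
  next
    case False
    then obtain m where m: "E m i0 \<noteq> 0" by blast
    define r where "r n = E n i0 / E m i0" for n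
    define E' where "E' n i = E n i - r n * E m i" for n i
    obtain K C where KC: "finite K" "C \<ge> 0"
      "\<And>n. \<exists>b. (\<forall>i\<in>I. E' n i = (\<Sum>k\<in>K. b k * E' k i)) \<and>
           (\<forall>k\<in>K. \<bar>b k\<bar> \<le> C * (\<Sum>i\<in>I. \<bar>E' n i\<bar>))"
      using insert.IH[of E'] by blast
    define S where "S n = (\<Sum>i\<in>insert i0 I. \<bar>E n i\<bar>)" for n
    \<comment> \<open>\<open>C1\<close> bounds the coefficients with respect to the family
      \<open>E'\<close> reduced by the pivot row \<open>m\<close>; \<open>C2\<close> bounds the
      total coefficient of the pivot row, which also has to undo the reductions of the rows in
      \<open>K\<close>.\<close>
    define C1 where "C1 = C * (1 + (\<Sum>i\<in>I. \<bar>E m i\<bar>) / \<bar>E m i0\<bar>)"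
    define C2 where "C2 = 1 / \<bar>E m i0\<bar> + C1 * (\<Sum>k\<in>K. \<bar>r k\<bar>)"
    have C1: "C1 \<ge> 0" unfolding C1_def using KC by (intro mult_nonneg_nonneg add_nonneg_nonneg divide_nonneg_nonneg sum_nonneg) auto
    have rk: "(\<Sum>k\<in>K. \<bar>r k\<bar>) \<ge> 0" by (intro sum_nonneg) auto
    have C2: "C2 \<ge> 0" unfolding C2_def using C1 rk by simp
    have S0: "S n \<ge> 0" for n unfolding S_def by (intro sum_nonneg) auto
    have SI: "S n = \<bar>E n i0\<bar> + (\<Sum>i\<in>I. \<bar>E n i\<bar>)" for n unfolding S_def using insert.hyps by simp
    have "\<exists>b. (\<forall>i\<in>insert i0 I. E n i = (\<Sum>k\<in>insert m K. b k * E k i)) \<and>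
           (\<forall>k\<in>insert m K. \<bar>b k\<bar> \<le> (C1 + C2) * S n)" for n
    proof -
      obtain b where b: "\<And>i. i \<in> I \<Longrightarrow> E' n i = (\<Sum>k\<in>K. b k * E' k i)"
        "\<And>k. k \<in> K \<Longrightarrow> \<bar>b k\<bar> \<le> C * (\<Sum>i\<in>I. \<bar>E' n i\<bar>)" using KC(3)[of n] by blast
      have rn: "\<bar>r n\<bar> \<le> S n / \<bar>E m i0\<bar>"
        unfolding r_def abs_divide using SI[of n] sum_nonneg[of I "\<lambda>i. \<bar>E n i\<bar>"]
        by (intro divide_right_mono) auto
      have "(\<Sum>i\<in>I. \<bar>E' n i\<bar>) \<le> (\<Sum>i\<in>I. \<bar>E n i\<bar> + \<bar>r n\<bar> * \<bar>E m i\<bar>)"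
        unfolding E'_def by (intro sum_mono) (metis abs_mult abs_triangle_ineq4)
      also have "\<dots> = (\<Sum>i\<in>I. \<bar>E n i\<bar>) + \<bar>r n\<bar> * (\<Sum>i\<in>I. \<bar>E m i\<bar>)"
        by (simp add: sum.distrib sum_distrib_left)
      also have "\<dots> \<le> S n + S n / \<bar>E m i0\<bar> * (\<Sum>i\<in>I. \<bar>E m i\<bar>)"
        using rn SI[of n] by (intro add_mono mult_right_mono sum_nonneg) auto
      finally have E'b: "(\<Sum>i\<in>I. \<bar>E' n i\<bar>) \<le> S n * (1 + (\<Sum>i\<in>I. \<bar>E m i\<bar>) / \<bar>E m i0\<bar>)"
        by (simp add: algebra_simps)
      have b1: "\<bar>b k\<bar> \<le> C1 * S n" if "k \<in> K" for k
        using b(2)[OF that] mult_left_mono[OF E'b KC(2)] unfolding C1_def by (simp add: mult_ac)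
      define c where "c = r n - (\<Sum>k\<in>K. b k * r k)"
      have "\<bar>\<Sum>k\<in>K. b k * r k\<bar> \<le> (\<Sum>k\<in>K. (C1 * S n) * \<bar>r k\<bar>)"
        using b1 by (intro order_trans[OF sum_abs] sum_mono) (simp add: abs_mult mult_right_mono)
      then have c: "\<bar>c\<bar> \<le> C2 * S n"
        unfolding c_def C2_def sum_distrib_left[symmetric] using rn by (simp add: algebra_simps)
      have E'0: "E' k i0 = 0" for k unfolding E'_def r_def using m by simp
      have eq: "E n i = (\<Sum>k\<in>K. b k * E k i) + c * E m i" if "i \<in> insert i0 I" for i
      proof -
        have "E' n i = (\<Sum>k\<in>K. b k * E' k i)" using that b(1) E'0 by auto
        then have "E n i - r n * E m i = (\<Sum>k\<in>K. b k * E k i) - (\<Sum>k\<in>K. b k * r k) * E m i"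
          unfolding E'_def by (simp add: sum_subtractf sum_distrib_right right_diff_distrib mult.assoc)
        then show ?thesis unfolding c_def by (simp add: algebra_simps)
      qed
      define b' where "b' k = (if k \<in> K then b k else 0) + (if k = m then c else 0)" for k
      have "(\<Sum>k\<in>insert m K. b' k * E k i) = (\<Sum>k\<in>K. b k * E k i) + c * E m i" for i
      proof -
        have "(\<Sum>k\<in>insert m K. b' k * E k i) =
            (\<Sum>k\<in>insert m K. (if k \<in> K then b k else 0) * E k i) + (\<Sum>k\<in>insert m K. (if k = m then c * E k i else 0))"
          unfolding sum.distrib[symmetric] b'_def by (intro sum.cong) (auto simp: algebra_simps)
        also have "(\<Sum>k\<in>insert m K. (if k = m then c * E k i else 0)) = c * E m i"
          using KC(1) by (simp add: sum.delta)
        also have "(\<Sum>k\<in>insert m K. (if k \<in> K then b k else 0) * E k i) = (\<Sum>k\<in>K. b k * E k i)"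
          using KC(1) by (intro sum.mono_neutral_cong_right) auto
        finally show ?thesis .
      qed
      moreover have "\<bar>b' k\<bar> \<le> (C1 + C2) * S n" if "k \<in> insert m K" for k
        using that b1[of k] c mult_nonneg_nonneg[OF C1 S0[of n]] mult_nonneg_nonneg[OF C2 S0[of n]]
        unfolding b'_def distrib_right by (auto split: if_splits)
      ultimately show ?thesis using eq by (intro exI[of _ b']) auto
    qed
    then show ?thesis using KC C1 C2 unfolding S_def
      by (intro exI[of _ "insert m K"] exI[of _ "C1 + C2"]) auto
  qed
qed

text \<open>Each late term is at most half of the term \<open>N\<close> places earlier, so a partial
  sum is at most the initial block plus half of itself, hence at most twice the initial
  block.\<close>

lemma summable_if_halving:
  fixes a :: "nat \<Rightarrow> real"
  assumes a: "\<And>n. 0 \<le> a n" and N: "N > 0" and half: "\<And>n. n \<ge> n0 \<Longrightarrow> a (n + N) \<le> a n / 2"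
  shows "summable a"
proof -
  define B where "B = (\<Sum>n<n0 + N. a n)"
  have "(\<Sum>n<m. a n) \<le> 2 * B" for m
  proof -
    have "(\<Sum>n<m. a n) \<le> B + (\<Sum>n<m. a n) / 2"
    proof (cases "m \<le> n0 + N")
      case True
      have "(\<Sum>n<m. a n) \<le> B" unfolding B_def using True a by (intro sum_mono2) auto
      then show ?thesis using sum_nonneg[of "{..<m}" a] a by auto
    next
      case False
      then have "(\<Sum>n<m. a n) = B + (\<Sum>n=n0 + N..<m. a n)"
        unfolding B_def by (metis lessThan_atLeast0 nat_le_linear sum.atLeastLessThan_concat zero_le)
      also have "(\<Sum>n=n0 + N..<m. a n) = (\<Sum>n=n0..<m - N. a (n + N))"
        using False by (subst sum.shift_bounds_nat_ivl[symmetric]) simp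
      also have "\<dots> \<le> (\<Sum>n=n0..<m - N. a n / 2)"
        using half by (intro sum_mono) auto
      also have "\<dots> \<le> (\<Sum>n<m. a n / 2)"
        using a by (intro sum_mono2) auto
      finally show ?thesis by (simp add: sum_divide_distrib)
    qed
    then show ?thesis by simp
  qed
  then show ?thesis using a by (intro bounded_imp_summable[of a "2 * B"]) (simp_all only: lessThan_Suc_atMost[symmetric])
qed

text \<open>The errors \<open>\<theta> n i - round (\<theta> n i)\<close> are eventually a genuine orbit of the integer
  matrix \<open>M\<close>, because the nearest integers satisfy the recursion up to an integer tending to
  0. An orbit of a linear map that tends to 0 does so exponentially fast.\<close>

lemma int_dist_recursion_summable:
  fixes \<theta> :: "nat \<Rightarrow> 'i \<Rightarrow> real" and M :: "'i \<Rightarrow> 'i \<Rightarrow> int"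
  assumes I: "finite I"
    and rec: "\<And>n i. i \<in> I \<Longrightarrow> \<theta> (Suc n) i = (\<Sum>l\<in>I. of_int (M i l) * \<theta> n l)"
    and lim: "\<And>i. i \<in> I \<Longrightarrow> (\<lambda>n. int_dist (\<theta> n i)) \<longlonglongrightarrow> 0"
    and i: "i \<in> I"
  shows "summable (\<lambda>n. int_dist (\<theta> n i))"
proof -
  define e where "e n i = \<theta> n i - of_int (round (\<theta> n i))" for n i
  have qe: "int_dist (\<theta> n i) = \<bar>e n i\<bar>" for n i by (simp add: e_def int_dist_def)
  define S where "S n = (\<Sum>i\<in>I. \<bar>e n i\<bar>)" for n
  have S0: "S n \<ge> 0" for n unfolding S_def by (intro sum_nonneg) auto
  have Slim: "S \<longlonglongrightarrow> 0"
    unfolding S_def using lim by (intro tendsto_null_sum) (simp add: qe)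
  \<comment> \<open>\<open>A\<close> bounds all entries of \<open>M\<close>. Once \<open>S\<close>
    is below 1 / (2 * A), both the image of the old errors and the new error have modulus below 1/2,
    so their difference, an integer, is 0.\<close>
  define A where "A = 1 + (\<Sum>i\<in>I. \<Sum>l\<in>I. \<bar>real_of_int (M i l)\<bar>)"
  have A: "A \<ge> 1" unfolding A_def by (simp add: sum_nonneg)
  have Mle: "\<bar>real_of_int (M i l)\<bar> \<le> A" if "i \<in> I" "l \<in> I" for i l
  proof -
    have "\<bar>real_of_int (M i l)\<bar> \<le> (\<Sum>l\<in>I. \<bar>real_of_int (M i l)\<bar>)"
      using that I by (intro member_le_sum) auto
    also have "\<dots> \<le> (\<Sum>i\<in>I. \<Sum>l\<in>I. \<bar>real_of_int (M i l)\<bar>)"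
      using that I by (intro member_le_sum) (auto intro: sum_nonneg)
    finally show ?thesis unfolding A_def by simp
  qed
  obtain n1 where n1: "\<And>n. n \<ge> n1 \<Longrightarrow> S n < 1 / (2 * A)"
    using LIMSEQ_D[OF Slim, of "1 / (2 * A)"] A S0 by fastforce
  have erec: "e (Suc n) i = (\<Sum>l\<in>I. of_int (M i l) * e n l)" if "n \<ge> n1" "i \<in> I" for n i
  proof -
    define k where "k = round (\<theta> (Suc n) i) - (\<Sum>l\<in>I. M i l * round (\<theta> n l))"
    have k: "real_of_int k = (\<Sum>l\<in>I. of_int (M i l) * e n l) - e (Suc n) i"
      unfolding k_def e_def using rec[OF that(2)] by (simp add: sum_subtractf right_diff_distrib)
    have "\<bar>\<Sum>l\<in>I. of_int (M i l) * e n l\<bar> \<le> (\<Sum>l\<in>I. A * \<bar>e n l\<bar>)"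
      using Mle that by (intro order_trans[OF sum_abs] sum_mono) (simp add: abs_mult mult_right_mono)
    also have "\<dots> = A * S n" by (simp add: S_def sum_distrib_left)
    also have "\<dots> < A * (1 / (2 * A))" using n1[OF that(1)] A by (intro mult_strict_left_mono) auto
    also have "\<dots> = 1/2" using A by simp
    finally have 1: "\<bar>\<Sum>l\<in>I. of_int (M i l) * e n l\<bar> < 1/2" .
    have "\<bar>e (Suc n) i\<bar> \<le> S (Suc n)" unfolding S_def using I that by (intro member_le_sum) auto
    also have "\<dots> < 1 / (2 * A)" using that by (intro n1) simp
    also have "\<dots> \<le> 1/2" using A by (simp add: field_simps)
    finally have "\<bar>real_of_int k\<bar> < 1" using 1 k by linarith
    then have "k = 0" by linarith
    then show ?thesis using k by simp
  qed
  define E where "E n = e (n1 + n)" for n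
  have Erec: "E (Suc n) i = (\<Sum>l\<in>I. of_int (M i l) * E n l)" if "i \<in> I" for n i
    using erec[of "n1 + n" i] that by (simp add: E_def)
  \<comment> \<open>Finitely many members of the orbit span all others, with coefficients bounded by
    the size of the vector expressed. A late, hence small, member therefore has small
    coefficients.\<close>
  obtain K C where KC: "finite K" "C \<ge> 0"
    "\<And>n. \<exists>b. (\<forall>i\<in>I. E n i = (\<Sum>k\<in>K. b k * E k i)) \<and> (\<forall>k\<in>K. \<bar>b k\<bar> \<le> C * (\<Sum>i\<in>I. \<bar>E n i\<bar>))"
    using finite_family_spans[OF I, of E] by blast
  define m where "m = Suc (Max (insert 0 K))"
  have Km: "k < m" if "k \<in> K" for k unfolding m_def using that KC(1) by (simp add: less_Suc_eq_le)
  have m0: "m > 0" by (simp add: m_def)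
  \<comment> \<open>The relation expressing \<open>E N\<close> through the \<open>E k\<close> is
    carried along by the common recursion, so it persists after any number \<open>n\<close> of
    further steps.\<close>
  have span: "\<exists>b. (\<forall>n. \<forall>i\<in>I. E (N + n) i = (\<Sum>k\<in>K. b k * E (k + n) i)) \<and> (\<forall>k\<in>K. \<bar>b k\<bar> \<le> C * S (n1 + N))" for N
  proof -
    obtain b where b: "\<And>i. i \<in> I \<Longrightarrow> E N i = (\<Sum>k\<in>K. b k * E k i)"
      "\<And>k. k \<in> K \<Longrightarrow> \<bar>b k\<bar> \<le> C * (\<Sum>i\<in>I. \<bar>E N i\<bar>)" using KC(3) by blast
    have "E (N + n) i = (\<Sum>k\<in>K. b k * E (k + n) i)" if "i \<in> I" for n i
      using that
    proof (induction n arbitrary: i)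
      case (Suc n)
      have "E (N + Suc n) i = (\<Sum>l\<in>I. of_int (M i l) * (\<Sum>k\<in>K. b k * E (k + n) l))"
        using Erec[OF Suc.prems] Suc.IH by simp
      also have "\<dots> = (\<Sum>k\<in>K. b k * (\<Sum>l\<in>I. of_int (M i l) * E (k + n) l))"
        unfolding sum_distrib_left by (subst sum.swap) (simp add: mult_ac)
      finally show ?case using Erec[OF Suc.prems] by simp
    qed (use b in simp)
    then show ?thesis using b(2) by (intro exI[of _ b]) (auto simp: E_def S_def)
  qed
  \<comment> \<open>The window length \<open>m\<close> exceeds every index in \<open>K\<close>, so
    one window sum controls the whole right-hand side; \<eta> is chosen to make m * C * \<eta> at
    most 1/2.\<close>
  define a where "a n = (\<Sum>k<m. S (n1 + (k + n)))" for n
  define \<eta> where "\<eta> = 1 / (2 * real m * (C + 1))"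
  have \<eta>: "\<eta> > 0" unfolding \<eta>_def using m0 KC(2) by simp
  obtain n2 where n2: "\<And>n. n \<ge> n2 \<Longrightarrow> S n < \<eta>"
    using LIMSEQ_D[OF Slim \<eta>] S0 by fastforce
  define N where "N = Suc n2"
  have step: "S (n1 + (N + k + n)) \<le> C * \<eta> * a n" for k n
  proof -
    obtain b where b: "\<And>n i. i \<in> I \<Longrightarrow> E ((N + k) + n) i = (\<Sum>k\<in>K. b k * E (k + n) i)"
      "\<And>l. l \<in> K \<Longrightarrow> \<bar>b l\<bar> \<le> C * S (n1 + (N + k))" using span[of "N + k"] by blast
    have bl: "\<bar>b l\<bar> \<le> C * \<eta>" if "l \<in> K" for l
      using b(2)[OF that] mult_left_mono[OF less_imp_le[OF n2[of "n1 + (N + k)"]] KC(2)] by (simp add: N_def)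
    have "S (n1 + (N + k + n)) = (\<Sum>i\<in>I. \<bar>\<Sum>l\<in>K. b l * E (l + n) i\<bar>)"
      unfolding S_def using b(1)[of _ n] by (intro sum.cong) (auto simp: E_def)
    also have "\<dots> \<le> (\<Sum>i\<in>I. \<Sum>l\<in>K. C * \<eta> * \<bar>E (l + n) i\<bar>)"
      using bl by (intro sum_mono order_trans[OF sum_abs]) (simp add: abs_mult mult_right_mono)
    also have "\<dots> = C * \<eta> * (\<Sum>l\<in>K. S (n1 + (l + n)))"
      unfolding S_def E_def sum_distrib_left by (rule sum.swap)
    also have "\<dots> \<le> C * \<eta> * a n"
      unfolding a_def using Km S0 KC(2) \<eta> by (intro mult_left_mono sum_mono2) auto
    finally show ?thesis .
  qed
  have a0: "a n \<ge> 0" for n unfolding a_def using S0 by (intro sum_nonneg)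
  have "a (n + N) \<le> a n / 2" for n
  proof -
    have "a (n + N) \<le> (\<Sum>k<m. C * \<eta> * a n)"
      unfolding a_def[of "n + N"]
    proof (rule sum_mono)
      fix k
      have "n1 + (k + (n + N)) = n1 + (N + k + n)" by simp
      then show "S (n1 + (k + (n + N))) \<le> C * \<eta> * a n" using step[of k n] by (simp only:)
    qed
    also have "\<dots> = (real m * C * \<eta>) * a n" by simp
    also have "\<dots> \<le> (1/2) * a n"
    proof (rule mult_right_mono[OF _ a0])
      have "real m * C * \<eta> = C / (2 * (C + 1))" using m0 by (simp add: \<eta>_def)
      also have "\<dots> \<le> 1/2" using KC(2) by (simp add: divide_le_eq)
      finally show "real m * C * \<eta> \<le> 1/2" .
    qed
    finally show ?thesis by simp
  qed
  then have "summable a"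
    using a0 by (intro summable_if_halving[of a N 0]) (auto simp: N_def)
  moreover have "norm (int_dist (\<theta> (n + n1) i)) \<le> a n" for n
  proof -
    have "norm (int_dist (\<theta> (n + n1) i)) \<le> S (n1 + (0 + n))"
      unfolding qe S_def using I i by (simp add: add.commute) (rule member_le_sum; simp)
    also have "\<dots> \<le> a n" unfolding a_def using m0 S0 by (intro member_le_sum) auto
    finally show ?thesis .
  qed
  ultimately have "summable (\<lambda>n. int_dist (\<theta> (n + n1) i))"
    by (rule summable_comparison_test')
  then show ?thesis by (subst (asm) summable_iff_shift)
qed

section \<open>Expansive maps\<close>

text \<open>The vector p(A) x. The action on single vectors suffices, because annihilation is only
  asked for along one orbit.\<close>

definition poly_mv :: "complex poly \<Rightarrow> complex^'n^'n \<Rightarrow> complex^'n \<Rightarrow> complex^'n::finite" where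
  "poly_mv p A x = (\<Sum>k\<le>degree p. coeff p k *s (((*v) A) ^^ k) x)"

lemma poly_mv_eq:
  assumes "degree p \<le> n"
  shows "poly_mv p A x = (\<Sum>k\<le>n. coeff p k *s (((*v) A) ^^ k) x)"
  unfolding poly_mv_def using assms by (intro sum.mono_neutral_left) (auto simp: coeff_eq_0)

lemma poly_mv_linear_factor:
  "poly_mv ([:- z, 1:] * r) A x = A *v poly_mv r A x - z *s poly_mv r A x"
proof -
  let ?n = "degree r"
  have d: "degree ([:- z, 1:] * r) \<le> Suc ?n"
    by (intro order_trans[OF degree_mult_le]) simp
  have c0: "coeff ([:- z, 1:] * r) 0 = - z * coeff r 0"
    by simp
  have cS: "coeff ([:- z, 1:] * r) (Suc k) = coeff r k - z * coeff r (Suc k)" for k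
    by (simp add: coeff_pCons)
  have "poly_mv ([:- z, 1:] * r) A x =
      (\<Sum>k\<le>?n. (coeff r k - z * coeff r (Suc k)) *s (((*v) A) ^^ (Suc k)) x) - (z * coeff r 0) *s x"
    unfolding poly_mv_eq[OF d] sum.atMost_Suc_shift c0 cS by simp
  also have "\<dots> = (\<Sum>k\<le>?n. coeff r k *s (((*v) A) ^^ (Suc k)) x)
       - (\<Sum>k\<le>?n. (z * coeff r (Suc k)) *s (((*v) A) ^^ (Suc k)) x) - (z * coeff r 0) *s x"
    by (simp add: vector_sub_rdistrib sum_subtractf)
  also have "(\<Sum>k\<le>?n. coeff r k *s (((*v) A) ^^ (Suc k)) x) = A *v poly_mv r A x"
    unfolding poly_mv_def by (simp add: vec.sum vec.scale)
  also have "(\<Sum>k\<le>?n. (z * coeff r (Suc k)) *s (((*v) A) ^^ (Suc k)) x) + (z * coeff r 0) *s x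
      = z *s (\<Sum>k\<le>Suc ?n. coeff r k *s (((*v) A) ^^ k) x)"
    unfolding sum.atMost_Suc_shift by (simp add: vec.scale_sum_right vec.scale_right_distrib)
  then have "(\<Sum>k\<le>?n. (z * coeff r (Suc k)) *s (((*v) A) ^^ (Suc k)) x) + (z * coeff r 0) *s x
      = z *s poly_mv r A x"
    by (subst poly_mv_eq[of r "Suc ?n"]) simp_all
  ultimately show ?thesis by (simp add: diff_diff_eq)
qed

lemma poly_mv_add: "poly_mv p A (x + y) = poly_mv p A x + poly_mv p A y"
proof -
  have "(((*v) A) ^^ k) (x + y) = (((*v) A) ^^ k) x + (((*v) A) ^^ k) y" for k
    by (induction k) (simp_all add: matrix_vector_right_distrib)
  then show ?thesis
    unfolding poly_mv_def by (simp add: vec.scale_right_distrib sum.distrib)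
qed

lemma poly_mv_scale: "poly_mv p A (c *s x) = c *s poly_mv p A x"
proof -
  have "(((*v) A) ^^ k) (c *s x) = c *s (((*v) A) ^^ k) x" for k
    by (induction k) (simp_all add: vec.scale)
  then show ?thesis
    unfolding poly_mv_def by (simp add: vec.scale_sum_right mult.commute)
qed

lemma poly_mv_mult_mv: "poly_mv p A (A *v x) = A *v poly_mv p A x"
  unfolding poly_mv_def by (simp add: vec.sum vec.scale funpow_swap1)

text \<open>The first CARD('n) + 1 vectors of the orbit are linearly dependent. A repetition among
  them is treated separately, because dependence is a property of the set, in which repeated vectors
  collapse.\<close>

lemma poly_mv_annihilates:
  fixes A :: "complex^'n::finite^'n"
  shows "\<exists>p. p \<noteq> 0 \<and> poly_mv p A x = 0"
proof -
  define v where "v k = (((*v) A) ^^ k) x" for k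
  let ?N = "CARD('n)"
  have "\<exists>c. (\<exists>k\<le>?N. c k \<noteq> 0) \<and> (\<Sum>k\<le>?N. c k *s v k) = 0"
  proof (cases "inj_on v {..?N}")
    case True
    have "vec.dim (v ` {..?N}) \<le> vec.dim (UNIV :: (complex^'n) set)"
      by (rule vec.dim_subset) simp
    also have "\<dots> < card (v ` {..?N})"
      using True by (simp add: card_image card_cart_basis)
    finally have "vec.dependent (v ` {..?N})"
      by (intro vec.dependent_biggerset_general) simp
    then obtain u where u: "\<exists>w\<in>v ` {..?N}. u w \<noteq> 0" "(\<Sum>w\<in>v ` {..?N}. u w *s w) = 0"
      by (auto simp: vec.dependent_finite)
    then show ?thesis
      using True by (intro exI[of _ "u \<circ> v"]) (auto simp: sum.reindex)
  next
    case False
    then obtain i j where ij: "i \<le> ?N" "j \<le> ?N" "i \<noteq> j" "v i = v j"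
      unfolding inj_on_def by auto
    define c where "c k = (if k = i then 1 else 0) - (if k = j then 1 else (0::complex))" for k
    have "(\<Sum>k\<le>?N. c k *s v k) = (\<Sum>k\<le>?N. (if k = i then v i else 0)) - (\<Sum>k\<le>?N. (if k = j then v j else 0))"
      unfolding sum_subtractf[symmetric] c_def by (intro sum.cong) (auto simp: vector_sub_rdistrib)
    also have "\<dots> = 0" using ij by (simp add: sum.delta)
    finally show ?thesis using ij by (intro exI[of _ c]) (auto simp: c_def)
  qed
  then obtain c k0 where c: "k0 \<le> ?N" "c k0 \<noteq> 0" "(\<Sum>k\<le>?N. c k *s v k) = 0" by blast
  define p where "p = (\<Sum>k\<le>?N. monom (c k) k)"
  have cp: "coeff p k = (if k \<le> ?N then c k else 0)" for k
    unfolding p_def coeff_sum by (simp add: coeff_monom sum.delta)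
  have "degree p \<le> ?N" by (rule degree_le) (simp add: cp)
  then have "poly_mv p A x = 0"
    using c(3) by (simp add: poly_mv_eq[of p ?N] cp v_def)
  moreover have "p \<noteq> 0" using c cp[of k0] by auto
  ultimately show ?thesis by blast
qed

lemma contraction_perturbed_tendsto_0:
  fixes a b :: "nat \<Rightarrow> real"
  assumes q: "0 \<le> q" "q < 1" and a: "\<And>n. 0 \<le> a n" "\<And>n. a (Suc n) \<le> q * (a n + b n)"
    and b: "b \<longlonglongrightarrow> 0"
  shows "a \<longlonglongrightarrow> 0"
proof (rule LIMSEQ_I)
  fix e :: real assume e: "e > 0"
  \<comment> \<open>With this choice q * e / 2 + d = e / 2, so the part e / 2 of the bound in
    \<open>*\<close> that does not decay reproduces itself.\<close>
  define d where "d = e * (1 - q) / 2"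
  have d: "d > 0" using e q by (simp add: d_def)
  obtain N where N: "\<And>n. n \<ge> N \<Longrightarrow> \<bar>b n\<bar> < d"
    using LIMSEQ_D[OF b d] by auto
  have *: "a (N + n) \<le> q ^ n * a N + e / 2" for n
  proof (induction n)
    case (Suc n)
    have "a (N + Suc n) \<le> q * (a (N + n) + d)"
      using a(2)[of "N + n"] N[of "N + n"] q by (smt (verit) add_Suc_right le_add1 mult_left_mono)
    also have "\<dots> \<le> q * (q ^ n * a N + e / 2 + d)"
      using Suc q by (intro mult_left_mono) auto
    also have "\<dots> = q ^ Suc n * a N + q * e / 2 + q * d" by (simp add: algebra_simps)
    also have "\<dots> \<le> q ^ Suc n * a N + q * e / 2 + 1 * d" using q d by (intro add_left_mono mult_right_mono) auto
    also have "\<dots> = q ^ Suc n * a N + e / 2" by (simp add: d_def field_simps)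
    finally show ?case .
  qed (use e in simp)
  have "(\<lambda>n. q ^ n * a N) \<longlonglongrightarrow> 0 * a N"
    using q by (intro tendsto_intros LIMSEQ_realpow_zero)
  then obtain M where M: "\<And>n. n \<ge> M \<Longrightarrow> q ^ n * a N < e / 2"
    using LIMSEQ_D[of _ 0 "e/2"] e by fastforce
  have "norm (a n - 0) < e" if "n \<ge> N + M" for n
    proof -
    have "M \<le> n - N" using that by simp
    then show ?thesis using *[of "n - N"] M[of "n - N"] that a(1)[of n] by simp
  qed
  then show "\<exists>no. \<forall>n\<ge>no. norm (a n - 0) < e" by blast
qed

text \<open>Induction on the degree of an annihilating polynomial: a root \<open>z\<close> that is an eigenvalue
  gives \<open>x (n+1) = (x n - y (n+1)) / z\<close> with \<open>y = (A - z) x\<close> annihilated by a smaller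
  polynomial; a root that is not an eigenvalue can be cancelled.\<close>

lemma backward_orbit_tendsto_0:
  fixes A :: "complex^'n::finite^'n"
  assumes ev: "\<And>z v. v \<noteq> 0 \<Longrightarrow> A *v v = z *s v \<Longrightarrow> cmod z > 1"
    and "p \<noteq> 0" "\<And>n. A *v x (Suc n) = x n" "\<And>n. poly_mv p A (x n) = 0"
  shows "(\<lambda>n. x n $ i) \<longlonglongrightarrow> 0"
  using assms(2-)
proof (induction "degree p" arbitrary: p x)
  case 0
  moreover have "coeff p 0 \<noteq> 0" using 0 by (metis leading_coeff_0_iff)
  ultimately have "x n = 0" for n
    by (auto simp: poly_mv_def)
  then show ?case by simp
next
  case (Suc m)
  then obtain z where "poly p z = 0"
    using fundamental_theorem_of_algebra[of p] by (auto simp: constant_degree)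
  then obtain r where r: "p = [:- z, 1:] * r" by (auto simp: poly_eq_0_iff_dvd dvd_def)
  have r0: "r \<noteq> 0" using r Suc.prems by auto
  have dr: "m = degree r" using Suc.hyps(2) r0 unfolding r by (subst (asm) degree_mult_eq) auto
  show ?case
  proof (cases "\<exists>v. v \<noteq> 0 \<and> A *v v = z *s v")
    case True
    then have z: "cmod z > 1" using ev by blast
    define y where "y n = A *v x n - z *s x n" for n
    have Ay: "A *v y (Suc n) = y n" for n
      unfolding y_def using Suc.prems(2) by (simp add: vec.diff vec.scale)
    have ry: "poly_mv r A (y n) = 0" for n
    proof -
      have "y n + z *s x n = A *v x n" by (simp add: y_def)
      then have "poly_mv r A (y n) + z *s poly_mv r A (x n) = A *v poly_mv r A (x n)"
        by (metis poly_mv_add poly_mv_scale poly_mv_mult_mv)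
      then show ?thesis
        using Suc.prems(3)[of n] unfolding r poly_mv_linear_factor by simp
    qed
    have ylim: "(\<lambda>n. y n $ i) \<longlonglongrightarrow> 0" by (rule Suc.hyps(1)[OF dr r0, of y, OF Ay ry])
    have "(\<lambda>n. cmod (x n $ i)) \<longlonglongrightarrow> 0"
    proof (rule contraction_perturbed_tendsto_0[where q = "1 / cmod z" and b = "\<lambda>n. cmod (y (Suc n) $ i)"])
      fix n
      have "y (Suc n) = x n - z *s x (Suc n)" by (simp add: y_def Suc.prems(2))
      then have "z * x (Suc n) $ i = x n $ i - y (Suc n) $ i" by simp
      then have "cmod z * cmod (x (Suc n) $ i) \<le> cmod (x n $ i) + cmod (y (Suc n) $ i)"
        by (metis norm_mult norm_triangle_ineq4)
      then show "cmod (x (Suc n) $ i) \<le> 1 / cmod z * (cmod (x n $ i) + cmod (y (Suc n) $ i))"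
        using z by (simp add: pos_le_divide_eq[OF order_less_trans[OF zero_less_one z]] mult.commute)
      show "(\<lambda>n. cmod (y (Suc n) $ i)) \<longlonglongrightarrow> 0"
        by (rule LIMSEQ_Suc[OF tendsto_norm_zero[OF ylim]])
    next
      show "1 / cmod z < 1" using z divide_less_eq_1_pos[of "cmod z" 1] by linarith
    qed simp_all
    then show ?thesis by (simp add: tendsto_norm_zero_iff)
  next
    case False
    have "poly_mv r A (x n) = 0" for n
      using False Suc.prems(3)[of n] unfolding r poly_mv_linear_factor by auto
    then show ?thesis by (rule Suc.hyps(1)[OF dr r0, of x, OF Suc.prems(2)])
  qed
qed

text \<open>A nonzero kernel vector, read as a complex vector, would be an eigenvector for the
  eigenvalue 0.\<close>

lemma expansive_inj:
  assumes "expansive Q"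
  shows "inj Q"
proof -
  have lin: "linear Q" and ev: "\<And>z. complex_eigenvalue Q z \<Longrightarrow> cmod z > 1"
    using assms by (auto simp: expansive_def)
  have "x = 0" if "Q x = 0" for x
  proof (rule ccontr)
    assume "x \<noteq> 0"
    define v where "v = (\<chi> i. complex_of_real (x $ i))"
    have "v \<noteq> 0" using \<open>x \<noteq> 0\<close> by (auto simp: v_def vec_eq_iff)
    have "matrix Q *v x = 0" using matrix_vector_mul(2)[OF lin] that by metis
    then have "(\<Sum>j\<in>UNIV. matrix Q $ i $ j * x $ j) = 0" for i
      by (simp add: matrix_vector_mult_def vec_eq_iff)
    then have "map_matrix complex_of_real (matrix Q) *v v = 0 *s v"
      by (simp add: vec_eq_iff matrix_vector_mult_def map_matrix_def v_def flip: of_real_mult of_real_sum)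
    then show False using ev[of 0] \<open>v \<noteq> 0\<close> unfolding complex_eigenvalue_def by auto
  qed
  then show ?thesis using lin by (simp add: linear_injective_0)
qed

text \<open>Backward orbits of the basis vectors tend to 0, so the operator norm of the inverse
  power is eventually at most 1/2. The spectral condition is thereby turned into one on the
  Euclidean norm.\<close>

lemma expansive_eventually_doubling:
  assumes "expansive (Q :: real^'d \<Rightarrow> real^'d)"
  shows "\<exists>N. \<forall>n\<ge>N. \<forall>x. norm ((Q ^^ n) x) \<ge> 2 * norm x"
proof -
  have lin: "linear Q" and ev: "\<And>z. complex_eigenvalue Q z \<Longrightarrow> cmod z > 1"
    using assms by (auto simp: expansive_def)
  have inj: "inj Q" by (rule expansive_inj[OF assms])
  define B where "B = inv Q"
  have surj: "surj Q" using lin inj by (simp add: linear_injective_imp_surjective)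
  have QB: "Q (B x) = x" for x using surj by (simp add: B_def surj_f_inv_f)
  have BQ: "B (Q x) = x" for x using inj by (simp add: B_def)
  have linB: "linear B" unfolding B_def by (rule inj_linear_imp_inv_linear[OF lin inj])
  define A where "A = map_matrix complex_of_real (matrix Q)"
  define emb where "emb x = (\<chi> i. complex_of_real (x $ i))" for x :: "real^'d"
  have Aemb: "A *v emb x = emb (Q x)" for x
  proof -
    have "Q x $ i = (\<Sum>j\<in>UNIV. matrix Q $ i $ j * x $ j)" for i
    proof -
      have "Q x = matrix Q *v x" using matrix_vector_mul(2)[OF lin] by metis
      then show ?thesis by (simp add: matrix_vector_mult_def)
    qed
    then show ?thesis
      by (simp add: A_def emb_def vec_eq_iff matrix_vector_mult_def map_matrix_def)
  qed
  have evA: "cmod z > 1" if "v \<noteq> 0" "A *v v = z *s v" for z v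
    using ev[of z] that unfolding complex_eigenvalue_def A_def by blast
  have injA: "v = 0" if "A *v v = 0" for v
    using evA[of v 0] that by auto
  have lim: "(\<lambda>n. (B ^^ n) x $ i) \<longlonglongrightarrow> 0" for x i
  proof -
    obtain p where p: "p \<noteq> 0" "poly_mv p A (emb x) = 0"
      using poly_mv_annihilates by blast
    define s where "s n = emb ((B ^^ n) x)" for n
    have s: "A *v s (Suc n) = s n" for n by (simp add: s_def Aemb QB)
    \<comment> \<open>Annihilation passes from a vector to its preimage, because \<open>A\<close> is
      injective and commutes with p(A).\<close>
    have ann: "poly_mv p A (s n) = 0" for n
    proof (induction n)
      case 0
      then show ?case using p by (simp add: s_def)
    next
      case (Suc n)
      then have "A *v poly_mv p A (s (Suc n)) = 0"
        using s[of n] poly_mv_mult_mv[of p A "s (Suc n)"] by simp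
      then show ?case by (rule injA)
    qed
    have "(\<lambda>n. s n $ i) \<longlonglongrightarrow> 0"
    proof (rule backward_orbit_tendsto_0[where A = A and p = p and x = s])
      show "cmod z > 1" if "v \<noteq> 0" "A *v v = z *s v" for z v
        using that by (rule evA)
    qed (rule p(1) s ann)+
    then have "(\<lambda>n. complex_of_real ((B ^^ n) x $ i)) \<longlonglongrightarrow> complex_of_real 0"
      by (simp add: s_def emb_def)
    then show ?thesis by (simp only: tendsto_of_real_iff)
  qed
  have "(\<lambda>n. (B ^^ n) x) \<longlonglongrightarrow> 0" for x
    by (rule vec_tendstoI) (simp add: lim)
  then have "(\<lambda>n. \<Sum>i\<in>UNIV. norm ((B ^^ n) (axis i 1))) \<longlonglongrightarrow> 0"
    by (intro tendsto_null_sum tendsto_norm_zero)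
  then have "eventually (\<lambda>n. (\<Sum>i\<in>UNIV. norm ((B ^^ n) (axis i 1))) < 1/2) sequentially"
    by (rule order_tendstoD) simp
  then obtain N where N: "\<And>n. n \<ge> N \<Longrightarrow> (\<Sum>i\<in>UNIV. norm ((B ^^ n) (axis i 1))) < 1/2"
    unfolding eventually_sequentially by blast
  have lBn: "linear (B ^^ n)" for n
    by (induction n) (simp_all only: funpow.simps linear_id linear_compose[OF _ linB])
  have half: "norm ((B ^^ n) x) \<le> norm x / 2" if "n \<ge> N" for n x
  proof -
    have "(B ^^ n) x = (B ^^ n) (\<Sum>i\<in>UNIV. x $ i *\<^sub>R axis i 1)"
      using basis_expansion[of x] by (simp add: scalar_mult_eq_scaleR)
    also have "\<dots> = (\<Sum>i\<in>UNIV. x $ i *\<^sub>R (B ^^ n) (axis i 1))"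
      by (simp add: linear_sum[OF lBn] linear_scale[OF lBn])
    also have "norm \<dots> \<le> (\<Sum>i\<in>UNIV. norm x * norm ((B ^^ n) (axis i 1)))"
      by (intro sum_norm_le) (simp add: component_le_norm_cart mult_right_mono)
    also have "\<dots> \<le> norm x * (1/2)"
      unfolding sum_distrib_left[symmetric] using N[OF that] by (intro mult_left_mono) auto
    finally show ?thesis by simp
  qed
  have "(B ^^ n) ((Q ^^ n) x) = x" for n x
  proof (induction n arbitrary: x)
    case (Suc n)
    show ?case unfolding funpow_Suc_right[of n Q] by (simp add: Suc BQ)
  qed simp
  then have "2 * norm x \<le> norm ((Q ^^ n) x)" if "n \<ge> N" for n x
    using half[OF that, of "(Q ^^ n) x"] by simp
  then show ?thesis by blast
qed

section \<open>Powers of a substitution\<close>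

text \<open>The digit sets of the n-fold substitution: sums a0 + Q a1 + ... + (Q ^^ (n - 1)) a(n -
  1) of digits along chains of colors between \<open>i\<close> and \<open>j\<close>.\<close>

fun subst_power ::
  "(real^'d \<Rightarrow> real^'d) \<Rightarrow> ('m::finite \<Rightarrow> 'm \<Rightarrow> (real^'d) set) \<Rightarrow> nat \<Rightarrow> 'm \<Rightarrow> 'm \<Rightarrow> (real^'d) set" where
  "subst_power Q D 0 i j = (if i = j then {0} else {})"
| "subst_power Q D (Suc n) i j = (\<Union>l. {Q b + a |b a. b \<in> subst_power Q D n l j \<and> a \<in> D i l})"

lemma finite_subst_power:
  assumes "\<And>i j. finite (D i j)"
  shows "finite (subst_power Q D n i j)"
proof (induction n arbitrary: i)
  case (Suc n)
  have "{Q b + a |b a. b \<in> subst_power Q D n l j \<and> a \<in> D i l}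
      = (\<lambda>(b, a). Q b + a) ` (subst_power Q D n l j \<times> D i l)" for l by auto
  then show ?case using Suc assms by simp
qed simp

lemma mem_subst_map:
  "y \<in> subst_map Q D P i \<longleftrightarrow> (\<exists>j x a. x \<in> P j \<and> a \<in> D i j \<and> y = Q x + a)"
  unfolding subst_map_def by auto

lemma mem_subst_power_Suc:
  "y \<in> subst_power Q D (Suc n) i j \<longleftrightarrow> (\<exists>l b a. b \<in> subst_power Q D n l j \<and> a \<in> D i l \<and> y = Q b + a)"
  by auto

lemma subst_map_funpow:
  assumes "linear Q"
  shows "(subst_map Q D ^^ n) P = subst_map (Q ^^ n) (subst_power Q D n) P"
proof (induction n)
  case 0
  show ?case by (auto simp: subst_map_def fun_eq_iff split: if_splits)
next
  case (Suc n)
  show ?case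
  proof (rule ext, rule set_eqI, rule iffI)
    fix i y
    assume "y \<in> (subst_map Q D ^^ Suc n) P i"
    then have "y \<in> subst_map Q D (subst_map (Q ^^ n) (subst_power Q D n) P) i" by (simp add: Suc)
    then obtain l a j x b where *: "x \<in> P j" "b \<in> subst_power Q D n l j" "a \<in> D i l"
      "y = Q ((Q ^^ n) x + b) + a" unfolding mem_subst_map by blast
    then have "Q b + a \<in> subst_power Q D (Suc n) i j" unfolding mem_subst_power_Suc by blast
    moreover have "y = (Q ^^ Suc n) x + (Q b + a)" using * by (simp add: linear_add[OF assms])
    ultimately show "y \<in> subst_map (Q ^^ Suc n) (subst_power Q D (Suc n)) P i"
      using *(1) unfolding mem_subst_map by blast
  next
    fix i y
    assume "y \<in> subst_map (Q ^^ Suc n) (subst_power Q D (Suc n)) P i"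
    then obtain l a j x b where *: "x \<in> P j" "b \<in> subst_power Q D n l j" "a \<in> D i l"
      "y = (Q ^^ Suc n) x + (Q b + a)" unfolding mem_subst_map mem_subst_power_Suc by blast
    then have "y = Q ((Q ^^ n) x + b) + a" by (simp add: linear_add[OF assms])
    then have "y \<in> subst_map Q D (subst_map (Q ^^ n) (subst_power Q D n) P) i"
      using *(1-3) unfolding mem_subst_map by blast
    then show "y \<in> (subst_map Q D ^^ Suc n) P i" by (simp add: Suc)
  qed
qed

text \<open>Matrix powers count chains of digits, whereas \<open>subst_power\<close> collects their
  sums, and different chains may have equal sums; hence only positivity is compared.\<close>

lemma subst_power_nonempty_iff:
  assumes "\<And>i j. finite (D i j)"
  shows "subst_power Q D n i j \<noteq> {} \<longleftrightarrow> (((\<lambda>A. subst_matrix D ** A) ^^ n) (mat 1)) $ i $ j > 0"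
proof (induction n arbitrary: i)
  case 0
  show ?case by (simp add: mat_def)
next
  case (Suc n)
  have "subst_power Q D (Suc n) i j \<noteq> {} \<longleftrightarrow> (\<exists>l. D i l \<noteq> {} \<and> subst_power Q D n l j \<noteq> {})"
    unfolding ex_in_conv[symmetric] mem_subst_power_Suc by blast
  also have "\<dots> \<longleftrightarrow> (\<exists>l. card (D i l) > 0 \<and> (((\<lambda>A. subst_matrix D ** A) ^^ n) (mat 1)) $ l $ j > 0)"
    using assms by (simp only: Suc card_gt_0_iff) blast
  also have "\<dots> \<longleftrightarrow> (((\<lambda>A. subst_matrix D ** A) ^^ Suc n) (mat 1)) $ i $ j > 0"
    by (simp add: matrix_matrix_mult_def subst_matrix_def neq0_conv[symmetric] del: neq0_conv)
  finally show ?case .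
qed

text \<open>As every row of \<open>D\<close> has a nonempty entry, one more application keeps all
  entries nonempty. The exponent can thus be raised freely, which lets it be combined with the one
  needed for doubling.\<close>

lemma primitive_subst_power:
  assumes fin: "\<And>i j. finite (D i j)" and prim: "primitive D" and ne: "\<And>i. \<exists>l. D i l \<noteq> {}"
  shows "\<exists>k. \<forall>n\<ge>k. \<forall>i j. subst_power Q D n i j \<noteq> {}"
proof -
  obtain k where k: "\<And>i j. subst_power Q D k i j \<noteq> {}"
    using prim subst_power_nonempty_iff[of D, OF fin] unfolding primitive_def by blast
  have "subst_power Q D n i j \<noteq> {}" if "n \<ge> k" for n i j
    using that
  proof (induction n arbitrary: i rule: dec_induct)
    case (step n)
    obtain l where "D i l \<noteq> {}" using ne by blast
    then show ?case using step.IH[of l] by auto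
  qed (rule k)
  then show ?thesis by blast
qed

text \<open>In an iterated image of a single point, positions relative to the inflated point are
  given by digits only, so putting another point \<open>w\<close> of color \<open>j\<close> in place
  of \<open>x\<close> reproduces \<open>P\<close> up to translation. A larger exponent is reached
  one level at a time: all points of some color \<open>l\<close> have children of color
  \<open>j\<close> by a fixed digit \<open>a\<close>, whose contribution joins the offset.\<close>

lemma legal_copies:
  assumes lin: "linear Q" and \<Lambda>: "\<Lambda> = subst_map Q D \<Lambda>" and ne: "\<And>i. \<Lambda> i \<noteq> {}" and "legal Q D \<Lambda> P"
  shows "\<exists>k0. \<forall>k\<ge>k0. \<exists>j v. \<forall>w\<in>\<Lambda> j. \<forall>i. \<forall>p\<in>P i. p + v + (Q ^^ k) w \<in> \<Lambda> i"
proof -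
  have linn: "linear (Q ^^ n)" for n
    by (induction n) (simp_all only: funpow.simps linear_id linear_compose[OF _ lin])
  have \<Lambda>n: "\<Lambda> = subst_map (Q ^^ n) (subst_power Q D n) \<Lambda>" for n
  proof -
    have "(subst_map Q D ^^ n) \<Lambda> = \<Lambda>"
      by (induction n) (simp_all only: funpow.simps o_apply id_apply \<Lambda>[symmetric])
    then show ?thesis unfolding subst_map_funpow[OF lin] by (rule sym)
  qed
  have mem: "y \<in> \<Lambda> i \<longleftrightarrow> y \<in> subst_map Q D \<Lambda> i" for y i
    by (rule arg_cong[OF \<Lambda>, of "\<lambda>L. y \<in> L i"])
  have memn: "y \<in> \<Lambda> i \<longleftrightarrow> y \<in> subst_map (Q ^^ n) (subst_power Q D n) \<Lambda> i" for y i n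
    by (rule arg_cong[OF \<Lambda>n, of "\<lambda>L. y \<in> L i"])
  obtain j x k0 P' v where P: "x \<in> \<Lambda> j" "subcluster P' ((subst_map Q D ^^ k0) (point_cluster j x))"
    "P = shift v P'" using assms(4) unfolding legal_def by blast
  have "\<exists>j v. \<forall>w\<in>\<Lambda> j. \<forall>i. \<forall>p\<in>P i. p + v + (Q ^^ k) w \<in> \<Lambda> i" if "k \<ge> k0" for k
    using that
  proof (induction k rule: dec_induct)
    case base
    have "p + (- v - (Q ^^ k0) x) + (Q ^^ k0) w \<in> \<Lambda> i" if w: "w \<in> \<Lambda> j" and p: "p \<in> P i" for w i p
    proof -
      have "p - v \<in> (subst_map Q D ^^ k0) (point_cluster j x) i"
        using P p by (auto simp: mem_shift subcluster_def)
      then obtain b where b: "p - v = (Q ^^ k0) x + b" "b \<in> subst_power Q D k0 i j"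
        unfolding subst_map_funpow[OF lin] by (auto simp: mem_subst_map point_cluster_def split: if_splits)
      have "(Q ^^ k0) w + b \<in> subst_map (Q ^^ k0) (subst_power Q D k0) \<Lambda> i"
        using w b(2) unfolding mem_subst_map by blast
      moreover have "p + (- v - (Q ^^ k0) x) + (Q ^^ k0) w = (Q ^^ k0) w + b" using b(1) by (simp add: algebra_simps)
      ultimately show ?thesis using memn[of _ i k0] by presburger
    qed
    then show ?case by blast
  next
    case (step k)
    then obtain j v where jv: "\<And>w i p. w \<in> \<Lambda> j \<Longrightarrow> p \<in> P i \<Longrightarrow> p + v + (Q ^^ k) w \<in> \<Lambda> i" by blast
    obtain u where "u \<in> \<Lambda> j" using ne by blast
    then obtain l a where la: "a \<in> D j l" using mem[of u j] unfolding mem_subst_map by blast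
    have "p + (v + (Q ^^ k) a) + (Q ^^ Suc k) w \<in> \<Lambda> i" if w: "w \<in> \<Lambda> l" and p: "p \<in> P i" for w i p
    proof -
      have "Q w + a \<in> subst_map Q D \<Lambda> j" using w la unfolding mem_subst_map by blast
      then have "Q w + a \<in> \<Lambda> j" by (subst mem)
      from jv[OF this p] show ?thesis
        by (simp add: linear_add[OF linn] funpow_swap1 add_ac)
    qed
    then show ?case by blast
  qed
  then show ?thesis by blast
qed

section \<open>Agreement with inflated translates\<close>

lemma uniform_discrete_finite_Int_ball:
  fixes A :: "(real^'d) set"
  assumes "uniform_discrete A"
  shows "finite (A \<inter> ball c R)"
proof -
  have "uniform_discrete (A \<inter> ball c R)" by (rule uniform_discrete_subset[OF assms]) (rule Int_lower1)
  moreover have "bounded (A \<inter> ball c R)" by (rule bounded_subset[OF bounded_ball[of c R]]) simp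
  ultimately show ?thesis by (intro uniform_discrete_finite_iff[THEN iffD1] conjI)
qed

text \<open>Every short difference already occurs at one of the finitely many centers supplied by
  FLC, and a ball about such a center contains finitely many points.\<close>

lemma FLC_finite_differences:
  fixes \<Lambda> :: "('d::finite, 'm::finite) colored"
  assumes "FLC \<Lambda>" "delone_multiset \<Lambda>"
  shows "finite {u - x |u x. u \<in> supp \<Lambda> \<and> x \<in> supp \<Lambda> \<and> norm (u - x) < R}"
proof (cases "R > 0")
  case True
  obtain Y where Y: "finite Y" "Y \<subseteq> supp \<Lambda>"
    "\<And>x. x \<in> supp \<Lambda> \<Longrightarrow> \<exists>y\<in>Y. patch (ball x R) \<Lambda> = shift (x - y) (patch (ball y R) \<Lambda>)"
    using assms(1)[unfolded FLC_def, rule_format, OF True] by blast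
  have "{u - x |u x. u \<in> supp \<Lambda> \<and> x \<in> supp \<Lambda> \<and> norm (u - x) < R}
      \<subseteq> (\<Union>y\<in>Y. (\<lambda>u. u - y) ` (supp \<Lambda> \<inter> ball y R))"
  proof clarify
    fix u x assume u: "u \<in> supp \<Lambda>" and x: "x \<in> supp \<Lambda>" and "norm (u - x) < R"
    then have d: "u \<in> ball x R" by (simp add: dist_norm norm_minus_commute)
    obtain i where i: "u \<in> \<Lambda> i" using u by (auto simp: supp_def)
    obtain y where y: "y \<in> Y" "patch (ball x R) \<Lambda> = shift (x - y) (patch (ball y R) \<Lambda>)" using Y(3)[OF x] by blast
    have "u \<in> patch (ball x R) \<Lambda> i" unfolding patch_def using d i by (rule IntI)
    then have "u \<in> shift (x - y) (patch (ball y R) \<Lambda>) i" unfolding y(2) .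
    then have "u - (x - y) \<in> ball y R \<inter> \<Lambda> i" unfolding mem_shift patch_def .
    then have v: "u - (x - y) \<in> supp \<Lambda> \<inter> ball y R" unfolding supp_def by blast
    show "u - x \<in> (\<Union>y\<in>Y. (\<lambda>u. u - y) ` (supp \<Lambda> \<inter> ball y R))"
      by (rule UN_I[OF y(1)], rule image_eqI[OF _ v]) simp
  qed
  moreover have "uniform_discrete (supp \<Lambda>)"
    using assms(2) by (simp add: delone_multiset_def delone_def)
  then have "finite (\<Union>y\<in>Y. (\<lambda>u. u - y) ` (supp \<Lambda> \<inter> ball y R))"
    by (intro finite_UN_I Y(1) finite_imageI uniform_discrete_finite_Int_ball)
  ultimately show ?thesis by (rule finite_subset)
next
  case False
  then have "\<not> norm (u - x) < R" for u x :: "real^'d"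
    using norm_ge_zero[of "u - x"] by linarith
  then show ?thesis by simp
qed

lemma cball_finite_unit_cover:
  "\<exists>T. finite T \<and> cball (0 :: real^'d) \<rho> \<subseteq> (\<Union>t\<in>T. ball t 1)"
proof -
  have "cball (0 :: real^'d) \<rho> \<subseteq> (\<Union>t\<in>cball 0 \<rho>. ball t 1)"
    by (meson UN_I centre_in_ball subsetI zero_less_one)
  then obtain T where "finite T" "cball (0 :: real^'d) \<rho> \<subseteq> (\<Union>t\<in>T. ball t 1)"
    by (rule compactE_image[OF compact_cball open_ball])
  then show ?thesis by (intro exI conjI)
qed

text \<open>The form in which the substitution is used after passing to a power. Legality enters as
  \<open>copies\<close>: every cluster reappears, with a common offset, at the inflated positions of
  all points of some color.\<close>

locale doubling_substitution =
  fixes \<Lambda> :: "('d::finite, 'm::finite) colored"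
    and Q :: "real^'d \<Rightarrow> real^'d" and D :: "'m \<Rightarrow> 'm \<Rightarrow> (real^'d) set"
  assumes linear_Q: "linear Q" and doubling: "2 * norm x \<le> norm (Q x)"
    and finite_D: "finite (D i j)" and D_nonempty: "D i j \<noteq> {}"
    and fixed_point: "\<Lambda> = subst_map Q D \<Lambda>"
    and delone: "delone_multiset \<Lambda>" and flc: "FLC \<Lambda>"
    and copies: "subcluster P \<Lambda> \<Longrightarrow>
      \<exists>k j v. \<forall>w\<in>\<Lambda> j. \<forall>i. \<forall>p\<in>P i. p + v + (Q ^^ k) w \<in> \<Lambda> i"
begin

lemma linear_Qn: "linear (Q ^^ n)"
  by (induction n) (simp_all only: funpow.simps linear_id linear_compose[OF _ linear_Q])

lemma doubling_funpow: "2 ^ n * norm x \<le> norm ((Q ^^ n) x)"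
proof (induction n)
  case (Suc n)
  have "2 ^ Suc n * norm x = 2 * (2 ^ n * norm x)" by simp
  also have "\<dots> \<le> 2 * norm ((Q ^^ n) x)" using Suc by linarith
  also have "\<dots> \<le> norm (Q ((Q ^^ n) x))" by (rule doubling)
  finally show ?case by (simp only: funpow.simps o_apply)
qed simp

definition Qinv :: "nat \<Rightarrow> real^'d \<Rightarrow> real^'d" where
  "Qinv n = inv (Q ^^ n)"

lemma bij_Qn: "bij (Q ^^ n)"
proof -
  have "x = 0" if "(Q ^^ n) x = 0" for x
  proof -
    have "2 ^ n * norm x \<le> 2 ^ n * 0" using doubling_funpow[of n x] that by simp
    then have "norm x \<le> 0" by (rule mult_left_le_imp_le) simp
    then show ?thesis by simp
  qed
  then have inj: "inj (Q ^^ n)" unfolding linear_injective_0[OF linear_Qn] by blast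
  show ?thesis
    by (rule bijI[OF inj linear_injective_imp_surjective[OF linear_Qn inj refl]])
qed

lemma Q_Qinv [simp]: "(Q ^^ n) (Qinv n x) = x"
  using bij_Qn unfolding Qinv_def by (simp add: bij_is_surj surj_f_inv_f)

lemma Qinv_Q [simp]: "Qinv n ((Q ^^ n) x) = x"
  using bij_Qn unfolding Qinv_def by (simp add: bij_is_inj)

lemma linear_Qinv: "linear (Qinv n)"
  unfolding Qinv_def by (rule inj_linear_imp_inv_linear[OF linear_Qn bij_is_inj[OF bij_Qn]])

lemma norm_Qinv: "norm (Qinv n x) \<le> norm x / 2 ^ n"
  using doubling_funpow[of n "Qinv n x"] by (simp add: field_simps)

lemma Qinv_Suc: "Qinv (Suc n) x = Qinv 1 (Qinv n x)"
proof -
  have "Q (Qinv 1 y) = y" for y using Q_Qinv[of 1 y] by (simp del: Q_Qinv)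
  then have "(Q ^^ Suc n) (Qinv 1 (Qinv n x)) = x"
    unfolding funpow_Suc_right by simp
  then show ?thesis by (metis Qinv_Q)
qed

section \<open>Ancestors and accumulated digits\<close>

lemma child: "x \<in> \<Lambda> j \<Longrightarrow> a \<in> D i j \<Longrightarrow> Q x + a \<in> \<Lambda> i"
  by (subst fixed_point) (auto simp: subst_map_def)

lemma parent:
  assumes "p \<in> \<Lambda> i"
  obtains j x a where "x \<in> \<Lambda> j" "a \<in> D i j" "p = Q x + a"
proof -
  have "p \<in> subst_map Q D \<Lambda> i" using assms by (subst (asm) fixed_point)
  then obtain j x a where "x \<in> \<Lambda> j" "a \<in> D i j" "p = Q x + a"
    unfolding subst_map_def by blast
  then show ?thesis by (rule that)
qed

lemma colors_relatively_dense: "relatively_dense (\<Lambda> i)"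
  using delone by (simp add: delone_multiset_def delone_def)

lemma colors_nonempty: "\<Lambda> i \<noteq> {}"
  using colors_relatively_dense[of i] by (auto simp: relatively_dense_def)

lemma finite_colors_Int_ball: "finite (\<Lambda> i \<inter> ball c R)"
  using delone by (simp add: delone_multiset_def delone_def uniform_discrete_finite_Int_ball)

definition digit_bound :: real where
  "digit_bound = (\<Sum>i\<in>UNIV. \<Sum>j\<in>UNIV. \<Sum>a\<in>D i j. norm a)"

lemma norm_le_digit_bound: "a \<in> D i j \<Longrightarrow> norm a \<le> digit_bound"
proof -
  assume a: "a \<in> D i j"
  have "norm a \<le> (\<Sum>a\<in>D i j. norm a)"
    using a finite_D by (intro member_le_sum) auto
  also have "\<dots> \<le> (\<Sum>j\<in>UNIV. \<Sum>a\<in>D i j. norm a)"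
    by (rule member_le_sum[of j UNIV "\<lambda>j. \<Sum>a\<in>D i j. norm a"]) (auto intro: sum_nonneg)
  also have "\<dots> \<le> digit_bound" unfolding digit_bound_def
    by (rule member_le_sum[of i UNIV "\<lambda>i. \<Sum>j\<in>UNIV. \<Sum>a\<in>D i j. norm a"]) (auto intro!: sum_nonneg)
  finally show ?thesis .
qed

lemma digit_bound_nonneg: "0 \<le> digit_bound"
  unfolding digit_bound_def by (auto intro!: sum_nonneg)

text \<open>\<open>c\<close> is the digit accumulated over \<open>n\<close> levels. Rescaled by
  \<open>Qinv n\<close> it stays below \<open>digit_bound\<close>, since each level halves the sum
  of the new digit and the previous rescaled one. The last conjunct records that the way down
  depends only on the color of the ancestor, which lets agreement of ancestors pass to
  descendants.\<close>

lemma ancestor: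
  assumes "p \<in> \<Lambda> i"
  shows "\<exists>j q c. q \<in> \<Lambda> j \<and> p = (Q ^^ n) q + c \<and> norm (Qinv n c) \<le> digit_bound \<and>
    (\<forall>q'\<in>\<Lambda> j. (Q ^^ n) q' + c \<in> \<Lambda> i)"
proof (induction n)
  case 0
  have "Qinv 0 0 = 0" by (rule linear_0[OF linear_Qinv])
  then show ?case using assms digit_bound_nonneg by (intro exI[of _ i] exI[of _ p] exI[of _ 0]) auto
next
  case (Suc n)
  then obtain j q c where q: "q \<in> \<Lambda> j" "p = (Q ^^ n) q + c" "norm (Qinv n c) \<le> digit_bound"
    "\<And>q'. q' \<in> \<Lambda> j \<Longrightarrow> (Q ^^ n) q' + c \<in> \<Lambda> i" by blast
  obtain l r a where r: "r \<in> \<Lambda> l" "a \<in> D j l" "q = Q r + a" using parent[OF q(1)] .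
  let ?c = "(Q ^^ n) a + c"
  have step: "(Q ^^ n) (Q r' + a) + c = (Q ^^ Suc n) r' + ?c" for r'
    by (simp add: linear_add[OF linear_Qn] funpow_swap1 add.assoc)
  have "Qinv (Suc n) ?c = Qinv 1 a + Qinv 1 (Qinv n c)"
    unfolding Qinv_Suc by (simp add: linear_add[OF linear_Qinv])
  then have "norm (Qinv (Suc n) ?c) \<le> norm (Qinv 1 a) + norm (Qinv 1 (Qinv n c))"
    by (simp add: norm_triangle_ineq)
  also have "\<dots> \<le> norm a / 2 + norm (Qinv n c) / 2"
    using norm_Qinv[of 1 a] norm_Qinv[of 1 "Qinv n c"] by simp
  also have "\<dots> \<le> digit_bound" using norm_le_digit_bound[OF r(2)] q(3) by simp
  finally have "norm (Qinv (Suc n) ?c) \<le> digit_bound" .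
  moreover have "(Q ^^ Suc n) r' + ?c \<in> \<Lambda> i" if "r' \<in> \<Lambda> l" for r'
    using q(4)[OF child[OF that r(2)]] unfolding step .
  moreover have "p = (Q ^^ Suc n) r + ?c" using q(2) r(3) step[of r] by simp
  ultimately show ?case using r(1) by blast
qed

text \<open>A patch with the maximal number of points cannot acquire further points when it
  reappears inside a larger cluster; hence all its copies provided by legality are full patches.\<close>

lemma full_patch_copies:
  "\<exists>j k v. \<forall>w\<in>\<Lambda> j. \<forall>w'\<in>\<Lambda> j. \<forall>i p. norm p < R \<longrightarrow>
     (p + (v + (Q ^^ k) w) \<in> \<Lambda> i \<longleftrightarrow> p + (v + (Q ^^ k) w') \<in> \<Lambda> i)"
proof (cases "R > 0")
  case False
  then have "\<not> norm p < R" for p :: "real^'d" using norm_ge_zero[of p] by linarith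
  then show ?thesis by simp
next
  case True
  define N where "N p = card (SIGMA i:UNIV. \<Lambda> i \<inter> ball p R)" for p
  have fin: "finite (SIGMA i:UNIV. \<Lambda> i \<inter> ball p R)" for p
    using finite_colors_Int_ball by auto
  obtain Y where Y: "finite Y"
    "\<And>x. x \<in> supp \<Lambda> \<Longrightarrow> \<exists>y\<in>Y. patch (ball x R) \<Lambda> = shift (x - y) (patch (ball y R) \<Lambda>)"
    using flc[unfolded FLC_def, rule_format, OF True] by blast
  \<comment> \<open>FLC leaves only finitely many values of the count \<open>N\<close>, so a center
    with maximal count exists.\<close>
  have "N x \<in> N ` Y" if x: "x \<in> supp \<Lambda>" for x
  proof -
    obtain y where y: "y \<in> Y" "patch (ball x R) \<Lambda> = shift (x - y) (patch (ball y R) \<Lambda>)"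
      using Y(2)[OF x] by blast
    have "\<Lambda> i \<inter> ball x R = (\<lambda>u. (x - y) + u) ` (\<Lambda> i \<inter> ball y R)" for i
      using fun_cong[OF y(2), of i] unfolding patch_def shift_def by (simp only: Int_commute)
    moreover have "map_prod id f ` (SIGMA i:UNIV. A i) = (SIGMA i:UNIV. f ` A i)"
      for f :: "real^'d \<Rightarrow> real^'d" and A :: "'m \<Rightarrow> (real^'d) set" by force
    ultimately have "(SIGMA i:UNIV. \<Lambda> i \<inter> ball x R) = map_prod id (\<lambda>u. (x - y) + u) ` (SIGMA i:UNIV. \<Lambda> i \<inter> ball y R)"
      by (simp only:)
    moreover have "inj_on (map_prod id (\<lambda>u. (x - y) + u)) (SIGMA i:UNIV. \<Lambda> i \<inter> ball y R)"
      by (auto simp: inj_on_def)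
    ultimately have "N x = N y" by (simp add: N_def card_image)
    then show ?thesis using y by blast
  qed
  then have finN: "finite (N ` supp \<Lambda>)" using finite_subset[of "N ` supp \<Lambda>" "N ` Y"] Y(1) by blast
  moreover have "supp \<Lambda> \<noteq> {}" using colors_nonempty by (auto simp: supp_def)
  ultimately have "Max (N ` supp \<Lambda>) \<in> N ` supp \<Lambda>" by (intro Max_in) auto
  then obtain p0 where p0: "p0 \<in> supp \<Lambda>" "N p0 = Max (N ` supp \<Lambda>)" by auto
  have max: "N x \<le> N p0" if "x \<in> supp \<Lambda>" for x
    unfolding p0(2) using that finN by (intro Max_ge) auto
  define P where "P i = \<Lambda> i \<inter> ball p0 R" for i
  have "subcluster P \<Lambda>" unfolding subcluster_def P_def using finite_colors_Int_ball by auto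
  then obtain k j v where kjv: "\<And>w i p. w \<in> \<Lambda> j \<Longrightarrow> p \<in> P i \<Longrightarrow> p + v + (Q ^^ k) w \<in> \<Lambda> i"
    using copies by blast
  have eq: "p + (p0 + v + (Q ^^ k) w) \<in> \<Lambda> i \<longleftrightarrow> p + p0 \<in> \<Lambda> i" if w: "w \<in> \<Lambda> j" and p: "norm p < R" for w p i
  proof -
    let ?u = "v + (Q ^^ k) w"
    have "p0 + ?u \<in> supp \<Lambda>"
      using kjv[OF w, of p0] p0(1) True by (auto simp: P_def supp_def add.assoc)
    then have le: "N (p0 + ?u) \<le> N p0" by (rule max)
    have inj: "inj_on (map_prod id (\<lambda>x. x + ?u)) (SIGMA i:UNIV. \<Lambda> i \<inter> ball p0 R)"
      by (auto simp: inj_on_def)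
    have sub: "map_prod id (\<lambda>x. x + ?u) ` (SIGMA i:UNIV. \<Lambda> i \<inter> ball p0 R) \<subseteq> (SIGMA i:UNIV. \<Lambda> i \<inter> ball (p0 + ?u) R)"
    proof (rule image_subsetI)
      fix z assume "z \<in> (SIGMA i:UNIV. \<Lambda> i \<inter> ball p0 R)"
      then obtain i x where x: "z = (i, x)" "x \<in> \<Lambda> i" "x \<in> ball p0 R" by blast
      have "x + v + (Q ^^ k) w \<in> \<Lambda> i" using kjv[OF w, of x i] x by (simp add: P_def)
      then show "map_prod id (\<lambda>x. x + ?u) z \<in> (SIGMA i:UNIV. \<Lambda> i \<inter> ball (p0 + ?u) R)"
        using x by (simp add: add.assoc dist_norm)
    qed
    have img: "map_prod id (\<lambda>x. x + ?u) ` (SIGMA i:UNIV. \<Lambda> i \<inter> ball p0 R) = (SIGMA i:UNIV. \<Lambda> i \<inter> ball (p0 + ?u) R)"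
      by (rule card_seteq[OF fin sub]) (use le in \<open>simp add: N_def card_image[OF inj]\<close>)
    show ?thesis
    proof
      assume "p + p0 \<in> \<Lambda> i"
      then have "p + p0 \<in> P i" using p by (simp add: P_def dist_norm)
      from kjv[OF w this] show "p + (p0 + v + (Q ^^ k) w) \<in> \<Lambda> i" by (simp add: add_ac)
    next
      assume "p + (p0 + v + (Q ^^ k) w) \<in> \<Lambda> i"
      then have "(i, p + p0 + ?u) \<in> (SIGMA i:UNIV. \<Lambda> i \<inter> ball (p0 + ?u) R)"
        using p by (simp add: dist_norm add_ac)
      then have "(i, p + p0 + ?u) \<in> map_prod id (\<lambda>x. x + ?u) ` (SIGMA i:UNIV. \<Lambda> i \<inter> ball p0 R)"
        unfolding img .
      then show "p + p0 \<in> \<Lambda> i" by auto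
    qed
  qed
  have "p + ((p0 + v) + (Q ^^ k) w) \<in> \<Lambda> i \<longleftrightarrow> p + ((p0 + v) + (Q ^^ k) w') \<in> \<Lambda> i"
    if "w \<in> \<Lambda> j" "w' \<in> \<Lambda> j" "norm p < R" for w w' i p
    using eq[OF that(1,3)] eq[OF that(2,3)] by simp
  then show ?thesis by blast
qed

lemma relatively_dense_copies:
  "\<exists>\<rho>>0. \<forall>b. \<exists>w\<in>\<Lambda> j. norm (v + (Q ^^ k) w - b) < \<rho>"
proof -
  obtain r where r: "r > 0" "\<And>x. \<Lambda> j \<inter> ball x r \<noteq> {}"
    using colors_relatively_dense[of j] unfolding relatively_dense_def by blast
  obtain C where C: "C > 0" "\<And>x. norm ((Q ^^ k) x) \<le> norm x * C"
    using bounded_linear.pos_bounded[OF linear_conv_bounded_linear[THEN iffD1, OF linear_Qn[of k]]] by blast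
  have "\<exists>w\<in>\<Lambda> j. norm (v + (Q ^^ k) w - b) < C * r" for b
  proof -
    obtain w where w: "w \<in> \<Lambda> j" "norm (w - Qinv k (b - v)) < r"
      using r(2)[of "Qinv k (b - v)"] by (auto simp: dist_norm norm_minus_commute)
    have "v + (Q ^^ k) w - b = (Q ^^ k) (w - Qinv k (b - v))"
      by (simp add: linear_diff[OF linear_Qn])
    then have "norm (v + (Q ^^ k) w - b) \<le> norm (w - Qinv k (b - v)) * C" using C(2) by simp
    also have "\<dots> < r * C" using w(2) C(1) by simp
    finally show ?thesis using w(1) by (auto simp: mult.commute)
  qed
  then show ?thesis using C(1) r(1) by (intro exI[of _ "C * r"]) auto
qed

text \<open>If \<open>\<Lambda>\<close> and \<open>\<Lambda> - X\<close> agree on a ball whose radius exceeds the digit bound,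
  then \<open>\<Lambda>\<close> and \<open>\<Lambda> - Q^n X\<close> agree around the inflated ball, since the ancestors of the
  points concerned lie in the original ball.\<close>

lemma agreement_inflate:
  assumes agree: "\<And>i p. norm p < digit_bound + 3 \<Longrightarrow> p + c \<in> \<Lambda> i \<longleftrightarrow> p + c + X \<in> \<Lambda> i"
    and s: "norm (s - c) < 1" and R: "R \<le> 2 ^ n" and p: "norm (p - (Q ^^ n) s) < R"
  shows "p \<in> \<Lambda> i \<longleftrightarrow> p + (Q ^^ n) X \<in> \<Lambda> i"
proof -
  have "Qinv n p - s = Qinv n (p - (Q ^^ n) s)" by (simp add: linear_diff[OF linear_Qinv])
  then have "norm (Qinv n p - s) \<le> norm (p - (Q ^^ n) s) / 2 ^ n" using norm_Qinv by simp
  also have "\<dots> \<le> 1" using p R by simp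
  finally have near: "norm (Qinv n p - c) < 2"
    using s norm_triangle_ineq[of "Qinv n p - s" "s - c"] by simp
  \<comment> \<open>The distance is below 2 + \<open>digit_bound\<close>: 1 for \<open>s\<close>, 1
    for the deflated ball of radius \<open>R\<close>, and the accumulated digit. This is the origin
    of the radius \<open>digit_bound + 3\<close>.\<close>
  have near': "norm (q - c) < digit_bound + 3" if "p = (Q ^^ n) q + e" "norm (Qinv n e) \<le> digit_bound" for q e
  proof -
    have "Qinv n p = q + Qinv n e" using that(1) by (simp add: linear_add[OF linear_Qinv])
    then have q: "q - c = (Qinv n p - c) - Qinv n e" by simp
    show ?thesis unfolding q using near that(2) norm_triangle_ineq4[of "Qinv n p - c" "Qinv n e"] by linarith
  qed
  show ?thesis
  proof
    assume "p \<in> \<Lambda> i"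
    then obtain j q e where q: "q \<in> \<Lambda> j" "p = (Q ^^ n) q + e" "norm (Qinv n e) \<le> digit_bound"
      "\<And>q'. q' \<in> \<Lambda> j \<Longrightarrow> (Q ^^ n) q' + e \<in> \<Lambda> i" using ancestor by blast
    have "q + X \<in> \<Lambda> j" using agree[OF near'[OF q(2,3)], of j] q(1) by simp
    from q(4)[OF this] show "p + (Q ^^ n) X \<in> \<Lambda> i"
      using q(2) by (simp add: linear_add[OF linear_Qn] add_ac)
  next
    assume "p + (Q ^^ n) X \<in> \<Lambda> i"
    then obtain j q e where q: "q \<in> \<Lambda> j" "p + (Q ^^ n) X = (Q ^^ n) q + e" "norm (Qinv n e) \<le> digit_bound"
      "\<And>q'. q' \<in> \<Lambda> j \<Longrightarrow> (Q ^^ n) q' + e \<in> \<Lambda> i" using ancestor by blast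
    have p': "p = (Q ^^ n) (q - X) + e" using q(2) by (simp add: linear_diff[OF linear_Qn] algebra_simps)
    have "q - X \<in> \<Lambda> j" using agree[OF near'[OF p' q(3)], of j] q(1) by simp
    from q(4)[OF this] show "p \<in> \<Lambda> i" using p' by simp
  qed
qed

text \<open>\<open>T\<close> comes from covering a ball by unit balls before inflation, so it
  depends on none of \<open>n\<close>, \<open>b\<close>, \<open>R\<close>; this is the form in which
  positive density is used. The image of a unit ball under \<open>Q ^^ n\<close> contains a ball of
  radius 2 ^ n, so every \<open>R\<close> is reached for large \<open>n\<close>.\<close>

lemma agreement_relatively_dense:
  "\<exists>j0. \<forall>y\<in>\<Lambda> j0. \<forall>z\<in>\<Lambda> j0. \<exists>k T. finite T \<and> (\<forall>R. \<exists>n0. \<forall>n\<ge>n0. \<forall>b. \<exists>t\<in>T. \<forall>i p.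
     norm (p - (b + (Q ^^ n) t)) < R \<longrightarrow> (p \<in> \<Lambda> i \<longleftrightarrow> p + (Q ^^ n) ((Q ^^ k) (y - z)) \<in> \<Lambda> i))"
proof -
  obtain j0 k v where "\<forall>w\<in>\<Lambda> j0. \<forall>w'\<in>\<Lambda> j0. \<forall>i p. norm p < digit_bound + 3 \<longrightarrow>
     (p + (v + (Q ^^ k) w) \<in> \<Lambda> i \<longleftrightarrow> p + (v + (Q ^^ k) w') \<in> \<Lambda> i)"
    using full_patch_copies by blast
  note full = this[rule_format]
  have main: "\<exists>k T. finite T \<and> (\<forall>R. \<exists>n0. \<forall>n\<ge>n0. \<forall>b. \<exists>t\<in>T. \<forall>i p.
     norm (p - (b + (Q ^^ n) t)) < R \<longrightarrow> (p \<in> \<Lambda> i \<longleftrightarrow> p + (Q ^^ n) ((Q ^^ k) (y - z)) \<in> \<Lambda> i))"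
    if y: "y \<in> \<Lambda> j0" and z: "z \<in> \<Lambda> j0" for y z
  proof -
    define P where "P i = (if i = j0 then {y, z} else {})" for i
    have sub: "subcluster P \<Lambda>" using y z by (auto simp: subcluster_def P_def)
    then obtain k' l v' where copy: "\<And>w i p. w \<in> \<Lambda> l \<Longrightarrow> p \<in> P i \<Longrightarrow> p + v' + (Q ^^ k') w \<in> \<Lambda> i"
      using copies[OF sub] by blast
    define X where "X = (Q ^^ k) (y - z)"
    \<comment> \<open>Copies of the pair \<open>y\<close>, \<open>z\<close> sit at offset
      \<open>v' + (Q ^^ k') w\<close>. Feeding both points of a copy into \<open>full\<close> yields
      equal patches at two centers, \<open>c w\<close> and \<open>c w + X\<close>.\<close>
    define u where "u = v + (Q ^^ k) (z + v')"
    define c where "c w = u + (Q ^^ (k + k')) w" for w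
    have agree: "p + c w \<in> \<Lambda> i \<longleftrightarrow> p + c w + X \<in> \<Lambda> i"
      if w: "w \<in> \<Lambda> l" and p: "norm p < digit_bound + 3" for w p i
    proof -
      have "z + v' + (Q ^^ k') w \<in> \<Lambda> j0" "y + v' + (Q ^^ k') w \<in> \<Lambda> j0"
        using copy[OF w, of z j0] copy[OF w, of y j0] by (simp_all add: P_def)
      note agree = full[OF this p, of i]
      have Qk: "(Q ^^ (k + k')) w = (Q ^^ k) ((Q ^^ k') w)" by (simp add: funpow_add)
      have "v + (Q ^^ k) (z + v' + (Q ^^ k') w) = c w" "v + (Q ^^ k) (y + v' + (Q ^^ k') w) = c w + X"
        unfolding c_def u_def X_def Qk by (simp_all add: linear_add[OF linear_Qn] linear_diff[OF linear_Qn])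
      then show ?thesis using agree by (simp only: add.assoc)
    qed
    obtain \<rho> where \<rho>: "\<And>b. \<exists>w\<in>\<Lambda> l. norm (c w - b) < \<rho>"
      using relatively_dense_copies[of l u "k + k'"] unfolding c_def by blast
    obtain T where T: "finite T" "cball (0 :: real^'d) \<rho> \<subseteq> (\<Union>t\<in>T. ball t 1)"
      using cball_finite_unit_cover by blast
    \<comment> \<open>Some center \<open>c w\<close> lies within \<rho> of \<open>Qinv n b\<close>,
      and the cover by unit balls places it within 1 of \<open>Qinv n b + t\<close> for some
      \<open>t\<close> in \<open>T\<close>, as \<open>agreement_inflate\<close> demands.\<close>
    have good: "\<exists>t\<in>T. \<forall>i p. norm (p - (b + (Q ^^ n) t)) < R \<longrightarrow> (p \<in> \<Lambda> i \<longleftrightarrow> p + (Q ^^ n) X \<in> \<Lambda> i)"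
      if R: "R \<le> 2 ^ n" for R n b
    proof -
      obtain w where w: "w \<in> \<Lambda> l" "norm (c w - Qinv n b) < \<rho>" using \<rho> by blast
      then have "c w - Qinv n b \<in> cball 0 \<rho>" by simp
      then obtain t where t: "t \<in> T" "c w - Qinv n b \<in> ball t 1" using T(2) by blast
      have "(Qinv n b + t) - c w = t - (c w - Qinv n b)" by simp
      then have t': "norm ((Qinv n b + t) - c w) < 1" using t(2) by (simp only: mem_ball dist_norm)
      show ?thesis
      proof (rule bexI[OF _ t(1)], intro allI impI)
        fix i p assume "norm (p - (b + (Q ^^ n) t)) < R"
        then have p: "norm (p - (Q ^^ n) (Qinv n b + t)) < R"
          by (simp add: linear_add[OF linear_Qn])
        show "p \<in> \<Lambda> i \<longleftrightarrow> p + (Q ^^ n) X \<in> \<Lambda> i"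
          by (rule agreement_inflate[OF _ t' R p]) (rule agree[OF w(1)])
      qed
    qed
    have large: "\<exists>n0::nat. \<forall>n\<ge>n0. R \<le> 2 ^ n" for R :: real
    proof -
      obtain n0 where "R < 2 ^ n0" using real_arch_pow[of 2 R] by auto
      then have "R \<le> 2 ^ n" if "n \<ge> n0" for n
        using power_increasing[OF that, of "2::real"] by linarith
      then show ?thesis by blast
    qed
    have "\<forall>R. \<exists>n0. \<forall>n\<ge>n0. \<forall>b. \<exists>t\<in>T. \<forall>i p. norm (p - (b + (Q ^^ n) t)) < R \<longrightarrow>
        (p \<in> \<Lambda> i \<longleftrightarrow> p + (Q ^^ n) X \<in> \<Lambda> i)"
    proof
      fix R :: real
      obtain n0 :: nat where n0: "\<forall>n\<ge>n0. R \<le> 2 ^ n" using large by blast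
      show "\<exists>n0. \<forall>n\<ge>n0. \<forall>b. \<exists>t\<in>T. \<forall>i p. norm (p - (b + (Q ^^ n) t)) < R \<longrightarrow>
          (p \<in> \<Lambda> i \<longleftrightarrow> p + (Q ^^ n) X \<in> \<Lambda> i)"
        by (intro exI[of _ n0] allI impI good) (use n0 in blast)
    qed
    then show ?thesis unfolding X_def using T(1) by (intro exI[of _ k] exI[of _ T] conjI)
  qed
  show ?thesis
    by (rule exI[of _ j0], intro ballI) (rule main)
qed

end

section \<open>The hull and its invariant measure\<close>

lemma half_less_delone_cap: "(1/2::real) < 2 powr (- 1/2)"
  using powr_less_mono[of "-1" "-1/2" "2::real"] by (simp add: powr_minus_divide)

lemma shift_shift: "shift a (shift b \<Lambda>) = shift (a + b) \<Lambda>"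
  by (intro ext set_eqI) (simp add: mem_shift diff_diff_eq)

lemma delone_translate:
  assumes "delone A"
  shows "delone ((\<lambda>x. v + x) ` A)"
proof -
  obtain R where R: "R > 0" "\<And>x. A \<inter> ball x R \<noteq> {}"
    using assms by (auto simp: delone_def relatively_dense_def)
  have "(\<lambda>x. v + x) ` A \<inter> ball x R \<noteq> {}" for x
  proof -
    obtain a where "a \<in> A" "dist (x - v) a < R" using R(2)[of "x - v"] by auto
    then have "v + a \<in> (\<lambda>x. v + x) ` A \<inter> ball x R" by (auto simp: dist_norm algebra_simps)
    then show ?thesis by blast
  qed
  moreover have "uniform_discrete ((\<lambda>x. v + x) ` A)"
    using assms uniform_discrete_image_scale[of A 1 "\<lambda>x. v + x"] by (simp add: delone_def)
  ultimately show ?thesis using R(1) unfolding delone_def relatively_dense_def by blast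
qed

lemma delone_multiset_shift: "delone_multiset \<Lambda> \<Longrightarrow> delone_multiset (shift v \<Lambda>)"
proof -
  have "supp (shift v \<Lambda>) = (\<lambda>x. v + x) ` supp \<Lambda>" by (auto simp: supp_def shift_def)
  then show "delone_multiset \<Lambda> \<Longrightarrow> delone_multiset (shift v \<Lambda>)"
    by (simp add: delone_multiset_def delone_translate) (simp add: shift_def delone_translate)
qed

lemma delone_dist_less_if_agree:
  assumes "R > 0" "1 / R < r" "\<And>i p. norm p < R \<Longrightarrow> p \<in> S i \<longleftrightarrow> p \<in> S' i"
  shows "delone_dist S S' < r"
proof -
  have "matches (1 / R) S S'"
    unfolding matches_iff using assms by (intro exI[of _ 0]) auto
  then show ?thesis unfolding delone_dist_less_iff using assms by (intro disjI2 exI[of _ "1 / R"]) auto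
qed

text \<open>Since 1/2 lies below the cap of the metric, an actual match witnesses the distance; its
  scale is strictly below \<open>r\<close>, so the radius 1 / r may be attained.\<close>

lemma delone_dist_less_obtains:
  assumes "delone_dist S S' < r" "r \<le> 1/2"
  obtains x y where "norm x < r" "norm y < r"
    "\<And>i p. norm p \<le> 1 / r \<Longrightarrow> p + x \<in> S i \<longleftrightarrow> p + y \<in> S' i"
proof -
  have "\<not> 2 powr (- 1/2) < r" using half_less_delone_cap assms(2) by linarith
  then obtain e where e: "e > 0" "e < r" "matches e S S'"
    using assms(1) unfolding delone_dist_less_iff by auto
  then obtain x y where xy: "norm x < e" "norm y < e"
    "\<And>i p. norm p < 1/e \<Longrightarrow> (p + x \<in> S i \<longleftrightarrow> p + y \<in> S' i)" unfolding matches_iff by blast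
  have "1/r < 1/e" using e by (simp add: frac_less2)
  then show thesis using that[of x y] xy e by auto
qed

text \<open>The metric looks at balls about the origin, so translations are not isometries. Moving
  by \<open>v\<close> costs \<open>norm v\<close> of the radius, whence the condition 2 / r + norm v
  \<le> 1 / \<delta>.\<close>

lemma delone_dist_shift_uniform:
  assumes "r > 0"
  shows "\<exists>\<delta>>0. \<forall>S S' :: ('d::finite, 'm) colored. delone_dist S S' < \<delta> \<longrightarrow> delone_dist (shift v S) (shift v S') < r"
proof -
  define \<delta> where "\<delta> = min (1/2) (min (r/2) (1 / (2/r + norm v)))"
  have pos: "2/r + norm v > 0" using assms by (simp add: add_pos_nonneg)
  have \<delta>: "\<delta> > 0" "\<delta> \<le> 1/2" "\<delta> \<le> r/2" "\<delta> \<le> 1 / (2/r + norm v)"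
    unfolding \<delta>_def using assms pos by auto
  have inv: "2/r + norm v \<le> 1/\<delta>" using \<delta>(1,4) pos by (simp add: pos_le_divide_eq mult.commute)
  have "delone_dist (shift v S) (shift v S') < r" if dist: "delone_dist S S' < \<delta>" for S S' :: "('d::finite, 'm) colored"
  proof -
    obtain x y where xy: "norm x < \<delta>" "norm y < \<delta>"
      "\<And>i p. norm p \<le> 1 / \<delta> \<Longrightarrow> p + x \<in> S i \<longleftrightarrow> p + y \<in> S' i"
      using delone_dist_less_obtains[OF dist \<delta>(2)] by blast
    have "matches (r/2) (shift v S) (shift v S')"
      unfolding matches_iff
    proof (intro exI conjI allI impI)
      fix i and p :: "real^'d" assume "norm p < 1 / (r/2)"
      then have "norm (p - v) \<le> 1/\<delta>" using inv norm_triangle_ineq4[of p v] by simp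
      from xy(3)[OF this, of i] show "p + x \<in> shift v S i \<longleftrightarrow> p + y \<in> shift v S' i"
        by (simp add: mem_shift algebra_simps)
    qed (use xy \<delta> in auto)
    then show ?thesis unfolding delone_dist_less_iff using assms by (intro disjI2 exI[of _ "r/2"]) auto
  qed
  then show ?thesis using \<delta>(1) by blast
qed

locale hull_system =
  fixes \<Lambda> :: "('d::finite, 'm::finite) colored" and \<mu> :: "('d, 'm) colored measure"
  assumes delone: "delone_multiset \<Lambda>" and invariant: "invariant_probability \<Lambda> \<mu>"
begin

abbreviation \<Omega> :: "('d, 'm) colored set" where
  "\<Omega> \<equiv> orbit_closure \<Lambda>"

lemma mem_hull_iff:
  "S \<in> \<Omega> \<longleftrightarrow> delone_multiset S \<and> (\<forall>r>0. \<exists>h. delone_dist S (shift (- h) \<Lambda>) < r)"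
proof -
  interpret M: Metric_space "{\<Lambda> :: ('d, 'm) colored. delone_multiset \<Lambda>}" delone_dist
    by (rule Metric_space_delone)
  show ?thesis
    unfolding orbit_closure_def delone_topology_def M.metric_closure_of
    using delone_multiset_shift[OF delone] by auto
qed

text \<open>The two small offsets in the metric are absorbed into the single translation
  \<open>v\<close>; the radius \<bar>L\<bar> + 2 leaves room for them. Facts about patches of
  \<Lambda> thereby transfer to the whole hull.\<close>

lemma hull_locally_translate:
  assumes "S \<in> \<Omega>"
  shows "\<exists>v. \<forall>i p. norm p < L \<longrightarrow> (p \<in> S i \<longleftrightarrow> p + v \<in> \<Lambda> i)"
proof -
  define r where "r = 1 / (\<bar>L\<bar> + 2)"
  have r: "r > 0" "r \<le> 1/2" by (auto simp: r_def field_simps)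
  obtain h where "delone_dist S (shift (- h) \<Lambda>) < r"
    using assms r(1) unfolding mem_hull_iff by blast
  then obtain x y where xy: "norm x < r" "norm y < r"
    "\<And>i p. norm p \<le> 1 / r \<Longrightarrow> p + x \<in> S i \<longleftrightarrow> p + y \<in> shift (- h) \<Lambda> i"
    using delone_dist_less_obtains r(2) by blast
  have "p \<in> S i \<longleftrightarrow> p + (y + h - x) \<in> \<Lambda> i" if "norm p < L" for p i
  proof -
    have "norm (p - x) \<le> 1 / r"
    proof -
      have "1 / r = \<bar>L\<bar> + 2" by (simp add: r_def)
      moreover have "norm x < 1" using xy(1) r(2) by linarith
      ultimately show ?thesis using norm_triangle_ineq4[of p x] that by linarith
    qed
    from xy(3)[OF this, of i] show ?thesis by (simp add: mem_shift algebra_simps)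
  qed
  then show ?thesis by blast
qed

lemma hull_shift: "S \<in> \<Omega> \<Longrightarrow> shift v S \<in> \<Omega>"
  unfolding mem_hull_iff
proof (intro conjI allI impI)
  fix r :: real
  assume S: "delone_multiset S \<and> (\<forall>r>0. \<exists>h. delone_dist S (shift (- h) \<Lambda>) < r)" and r: "r > 0"
  then obtain \<delta> where \<delta>: "\<delta> > 0"
    "\<And>S S' :: ('d, 'm) colored. delone_dist S S' < \<delta> \<Longrightarrow> delone_dist (shift v S) (shift v S') < r"
    using delone_dist_shift_uniform[OF r, of v] by blast
  then obtain h where "delone_dist S (shift (- h) \<Lambda>) < \<delta>" using S by blast
  from \<delta>(2)[OF this] have "delone_dist (shift v S) (shift (- (h - v)) \<Lambda>) < r"
    by (simp add: shift_shift)
  then show "\<exists>h. delone_dist (shift v S) (shift (- h) \<Lambda>) < r" by blast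
qed (simp add: delone_multiset_shift)

lemma openin_hull_iff:
  "openin (subtopology delone_topology \<Omega>) U \<longleftrightarrow>
     U \<subseteq> \<Omega> \<and> (\<forall>S\<in>U. \<exists>r>0. \<forall>S'\<in>\<Omega>. delone_dist S S' < r \<longrightarrow> S' \<in> U)"
proof -
  interpret Submetric "{\<Lambda> :: ('d, 'm) colored. delone_multiset \<Lambda>}" delone_dist \<Omega>
    by (intro Submetric.intro Submetric_axioms.intro Metric_space_delone) (auto simp: mem_hull_iff)
  have "openin (subtopology delone_topology \<Omega>) U \<longleftrightarrow> openin sub.mtopology U"
    unfolding delone_topology_def mtopology_submetric ..
  also have "\<dots> \<longleftrightarrow> U \<subseteq> \<Omega> \<and> (\<forall>S\<in>U. \<exists>r>0. \<forall>S'\<in>\<Omega>. delone_dist S S' < r \<longrightarrow> S' \<in> U)"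
  proof -
    have "sub.mball S r \<subseteq> U \<longleftrightarrow> (\<forall>S'\<in>\<Omega>. delone_dist S S' < r \<longrightarrow> S' \<in> U)" if "S \<in> \<Omega>" for S r
      using that unfolding sub.mball_def by blast
    then have "(\<exists>r>0. sub.mball S r \<subseteq> U) \<longleftrightarrow> (\<exists>r>0. \<forall>S'\<in>\<Omega>. delone_dist S S' < r \<longrightarrow> S' \<in> U)"
      if "S \<in> \<Omega>" for S using that by (simp only:)
    note ball_iff = this
    show ?thesis unfolding sub.openin_mtopology
    proof (rule conj_cong[OF refl], rule iffI)
      assume U: "U \<subseteq> \<Omega>" and *: "\<forall>x. x \<in> U \<longrightarrow> (\<exists>r>0. sub.mball x r \<subseteq> U)"
      show "\<forall>S\<in>U. \<exists>r>0. \<forall>S'\<in>\<Omega>. delone_dist S S' < r \<longrightarrow> S' \<in> U"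
        by (rule ballI, rule ball_iff[THEN iffD1]) (use U * in auto)
    next
      assume U: "U \<subseteq> \<Omega>" and *: "\<forall>S\<in>U. \<exists>r>0. \<forall>S'\<in>\<Omega>. delone_dist S S' < r \<longrightarrow> S' \<in> U"
      show "\<forall>x. x \<in> U \<longrightarrow> (\<exists>r>0. sub.mball x r \<subseteq> U)"
        by (rule allI, rule impI, rule ball_iff[THEN iffD2]) (use U * in auto)
    qed
  qed
  finally show ?thesis .
qed

lemma space_hull: "space \<mu> = \<Omega>"
proof -
  have "sets \<mu> = sets (hull_borel \<Lambda>)" using invariant by (simp add: invariant_probability_def)
  then have "space \<mu> = space (hull_borel \<Lambda>)" by (rule sets_eq_imp_space_eq)
  also have "\<dots> = \<Omega>" unfolding hull_borel_def
    by (rule space_measure_of) (auto dest: openin_subset simp: openin_hull_iff)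
  finally show ?thesis .
qed

lemma sets_hull:
  "sets \<mu> = sigma_sets \<Omega> {U. openin (subtopology delone_topology \<Omega>) U}"
proof -
  have "sets \<mu> = sets (hull_borel \<Lambda>)" using invariant by (simp add: invariant_probability_def)
  also have "\<dots> = sigma_sets \<Omega> {U. openin (subtopology delone_topology \<Omega>) U}"
    unfolding hull_borel_def by (rule sets_measure_of) (auto simp: openin_hull_iff)
  finally show ?thesis .
qed

lemma open_in_sets: "openin (subtopology delone_topology \<Omega>) U \<Longrightarrow> U \<in> sets \<mu>"
  unfolding sets_hull by (intro sigma_sets.Basic) simp

sublocale prob_space \<mu>
  using invariant by (simp add: invariant_probability_def)

lemma shift_measurable [measurable]: "shift v \<in> measurable \<mu> \<mu>"
proof -
  have "shift v \<in> measurable \<mu> (hull_borel \<Lambda>)"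
    unfolding hull_borel_def
  proof (rule measurable_measure_of)
    show "{U. openin (subtopology delone_topology \<Omega>) U} \<subseteq> Pow \<Omega>" by (auto simp: openin_hull_iff)
    show "shift v \<in> space \<mu> \<rightarrow> \<Omega>" using hull_shift by (auto simp: space_hull)
    fix U assume "U \<in> {U. openin (subtopology delone_topology \<Omega>) U}"
    then have U: "U \<subseteq> \<Omega>" "\<And>S. S \<in> U \<Longrightarrow> \<exists>r>0. \<forall>S'\<in>\<Omega>. delone_dist S S' < r \<longrightarrow> S' \<in> U"
      unfolding mem_Collect_eq openin_hull_iff by blast+
    have "\<exists>r>0. \<forall>S'\<in>\<Omega>. delone_dist S S' < r \<longrightarrow> shift v S' \<in> U" if "shift v S \<in> U" for S
    proof -
      obtain r where r: "r > 0" "\<And>S'. S' \<in> \<Omega> \<Longrightarrow> delone_dist (shift v S) S' < r \<Longrightarrow> S' \<in> U"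
        using U(2)[OF \<open>shift v S \<in> U\<close>] by blast
      obtain \<delta> where \<delta>: "\<delta> > 0" "\<And>S S' :: ('d, 'm) colored. delone_dist S S' < \<delta> \<Longrightarrow> delone_dist (shift v S) (shift v S') < r"
        using delone_dist_shift_uniform[OF r(1), of v] by blast
      show ?thesis by (rule exI[of _ \<delta>]) (simp add: \<delta> r(2) hull_shift)
    qed
    then have "openin (subtopology delone_topology \<Omega>) (shift v -` U \<inter> space \<mu>)"
      unfolding openin_hull_iff by (auto simp: space_hull)
    then show "shift v -` U \<inter> space \<mu> \<in> sets \<mu>" by (rule open_in_sets)
  qed
  moreover have "sets \<mu> = sets (hull_borel \<Lambda>)" using invariant by (simp add: invariant_probability_def)
  ultimately show ?thesis by (simp cong: measurable_cong_sets)
qed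

lemma distr_shift: "distr \<mu> \<mu> (shift v) = \<mu>"
proof (rule measure_eqI)
  fix A assume "A \<in> sets (distr \<mu> \<mu> (shift v))"
  then have A: "A \<in> sets \<mu>" by simp
  have "emeasure \<mu> (shift (- (- v)) -` A \<inter> space \<mu>) = emeasure \<mu> A"
    using invariant A unfolding invariant_probability_def by blast
  then show "emeasure (distr \<mu> \<mu> (shift v)) A = emeasure \<mu> A" using A by (simp add: emeasure_distr)
qed simp

lemma integral_shift:
  fixes u :: "('d, 'm) colored \<Rightarrow> real"
  assumes "u \<in> borel_measurable \<mu>"
  shows "(\<integral>S. u (shift v S) \<partial>\<mu>) = (\<integral>S. u S \<partial>\<mu>)"
  using integral_distr[OF shift_measurable assms, of v] by (simp add: distr_shift)

lemma integrable_shift: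
  fixes u :: "('d, 'm) colored \<Rightarrow> real"
  assumes "integrable \<mu> u"
  shows "integrable \<mu> (\<lambda>S. u (shift v S))"
  using integrable_distr_eq[OF shift_measurable borel_measurable_integrable[OF assms], of v] assms
  by (simp add: distr_shift)

lemma AE_shift:
  assumes "AE S in \<mu>. P S"
  shows "AE S in \<mu>. P (shift v S)"
  by (rule AE_distrD[OF shift_measurable[of v]], unfold distr_shift, rule assms)

text \<open>Uniform rather than plain continuity, because one \<delta> has to serve the whole hull
  at once; compactness of the hull is then not invoked.\<close>

definition unif_cont :: "(('d, 'm) colored \<Rightarrow> 'a::metric_space) \<Rightarrow> bool" where
  "unif_cont g \<longleftrightarrow> (\<forall>e>0. \<exists>\<delta>>0. \<forall>S\<in>\<Omega>. \<forall>S'\<in>\<Omega>. delone_dist S S' < \<delta> \<longrightarrow> dist (g S) (g S') < e)"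

lemma unif_contD:
  assumes "unif_cont g" "e > 0"
  obtains \<delta> where "\<delta> > 0"
    "\<And>S S'. S \<in> \<Omega> \<Longrightarrow> S' \<in> \<Omega> \<Longrightarrow> delone_dist S S' < \<delta> \<Longrightarrow> dist (g S) (g S') < e"
  using assms unfolding unif_cont_def by blast

lemma unif_cont_measurable:
  fixes g :: "('d, 'm) colored \<Rightarrow> 'a::metric_space"
  assumes "unif_cont g"
  shows "g \<in> borel_measurable \<mu>"
proof (rule borel_measurableI)
  fix A :: "'a set" assume A: "open A"
  have "\<exists>r>0. \<forall>S'\<in>\<Omega>. delone_dist S S' < r \<longrightarrow> g S' \<in> A" if S: "S \<in> \<Omega>" "g S \<in> A" for S
  proof -
    obtain e where e: "e > 0" "\<And>y. dist y (g S) < e \<Longrightarrow> y \<in> A" using A S(2) by (auto simp: open_dist)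
    obtain \<delta> where "\<delta> > 0"
      "\<And>S S'. S \<in> \<Omega> \<Longrightarrow> S' \<in> \<Omega> \<Longrightarrow> delone_dist S S' < \<delta> \<Longrightarrow> dist (g S) (g S') < e"
      using unif_contD[OF assms e(1)] by blast
    then show ?thesis using e(2) S(1) by (metis dist_commute)
  qed
  then have "openin (subtopology delone_topology \<Omega>) (g -` A \<inter> space \<mu>)"
    unfolding openin_hull_iff by (auto simp: space_hull)
  then show "g -` A \<inter> space \<mu> \<in> sets \<mu>" by (rule open_in_sets)
qed

section \<open>Density of uniformly continuous functions in L1\<close>

lemma unif_cont_add:
  fixes f g :: "('d, 'm) colored \<Rightarrow> 'a::real_normed_vector"
  assumes "unif_cont f" "unif_cont g"
  shows "unif_cont (\<lambda>S. f S + g S)"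
  unfolding unif_cont_def
proof (intro allI impI)
  fix e :: real assume "e > 0"
  then have e: "e/2 > 0" by simp
  obtain d1 d2 where "d1 > 0" "d2 > 0"
    "\<And>S S'. S \<in> \<Omega> \<Longrightarrow> S' \<in> \<Omega> \<Longrightarrow> delone_dist S S' < d1 \<Longrightarrow> dist (f S) (f S') < e/2"
    "\<And>S S'. S \<in> \<Omega> \<Longrightarrow> S' \<in> \<Omega> \<Longrightarrow> delone_dist S S' < d2 \<Longrightarrow> dist (g S) (g S') < e/2"
    using unif_contD[OF assms(1) e] unif_contD[OF assms(2) e] by metis
  moreover have "dist (a + b) (a' + b') < e" if "dist a a' < e/2" "dist b b' < e/2" for a b a' b' :: 'a
    using dist_triangle_add[of a b a' b'] that by linarith
  ultimately show "\<exists>\<delta>>0. \<forall>S\<in>\<Omega>. \<forall>S'\<in>\<Omega>. delone_dist S S' < \<delta> \<longrightarrow> dist (f S + g S) (f S' + g S') < e"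
    by (intro exI[of _ "min d1 d2"]) auto
qed

lemma unif_cont_scaleR:
  fixes f :: "('d, 'm) colored \<Rightarrow> real" and c :: "'a::real_normed_vector"
  assumes "unif_cont f"
  shows "unif_cont (\<lambda>S. f S *\<^sub>R c)"
  unfolding unif_cont_def
proof (intro allI impI)
  fix e :: real assume "e > 0"
  then have e: "e / (norm c + 1) > 0" by (simp add: add_nonneg_pos)
  obtain d where "d > 0"
    and d: "\<And>S S'. S \<in> \<Omega> \<Longrightarrow> S' \<in> \<Omega> \<Longrightarrow> delone_dist S S' < d \<Longrightarrow> dist (f S) (f S') < e / (norm c + 1)"
    using unif_contD[OF assms e] by blast
  have "dist (f S *\<^sub>R c) (f S' *\<^sub>R c) < e" if "S \<in> \<Omega>" "S' \<in> \<Omega>" "delone_dist S S' < d" for S S'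
  proof -
    have "dist (f S *\<^sub>R c) (f S' *\<^sub>R c) = dist (f S) (f S') * norm c"
      by (simp add: dist_norm scaleR_left_diff_distrib[symmetric])
    also have "\<dots> \<le> dist (f S) (f S') * (norm c + 1)" by (intro mult_left_mono) auto
    also have "\<dots> < e" using d[OF that] by (simp add: pos_less_divide_eq add_nonneg_pos)
    finally show ?thesis .
  qed
  then show "\<exists>\<delta>>0. \<forall>S\<in>\<Omega>. \<forall>S'\<in>\<Omega>. delone_dist S S' < \<delta> \<longrightarrow> dist (f S *\<^sub>R c) (f S' *\<^sub>R c) < e"
    using \<open>d > 0\<close> by blast
qed

text \<open>\<open>g n\<close> is \<open>n\<close> times the distance to the complement of
  \<open>U\<close>, cut off at 1. If the complement is empty, there is no distance to take and the
  constant 1 serves instead.\<close>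

lemma open_unif_cont_approx:
  assumes U: "openin (subtopology delone_topology \<Omega>) U"
  shows "\<exists>g :: nat \<Rightarrow> ('d, 'm) colored \<Rightarrow> real. (\<forall>n. unif_cont (g n)) \<and> (\<forall>n S. g n S \<in> {0..1}) \<and>
     (\<forall>S\<in>\<Omega>. (\<lambda>n. g n S) \<longlonglongrightarrow> indicator U S)"
proof (cases "\<Omega> \<subseteq> U")
  case True
  then show ?thesis
    by (intro exI[of _ "\<lambda>n S. 1"]) (auto simp: unif_cont_def intro: exI[of _ 1])
next
  case False
  define C where "C = \<Omega> - U"
  have C: "C \<noteq> {}" using False by (auto simp: C_def)
  define \<delta> where "\<delta> S = (INF T\<in>C. delone_dist S T)" for S
  have bdd: "bdd_below (delone_dist S ` C)" for S
    by (rule bdd_belowI[of _ 0]) (auto simp: delone_dist_nonneg)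
  have \<delta>0: "\<delta> S \<ge> 0" for S unfolding \<delta>_def by (intro cINF_greatest C) (simp add: delone_dist_nonneg)
  have lip: "\<delta> S \<le> delone_dist S S' + \<delta> S'" for S S'
  proof -
    have "\<delta> S - delone_dist S S' \<le> delone_dist S' T" if "T \<in> C" for T
    proof -
      have "\<delta> S \<le> delone_dist S T" unfolding \<delta>_def by (rule cINF_lower[OF bdd that])
      then show ?thesis using delone_dist_triangle[of S T S'] by simp
    qed
    then have "\<delta> S - delone_dist S S' \<le> \<delta> S'" unfolding \<delta>_def by (intro cINF_greatest C)
    then show ?thesis by simp
  qed
  define g where "g n S = min 1 (real n * \<delta> S)" for n S
  have "unif_cont (g n)" for n
    unfolding unif_cont_def
  proof (intro allI impI)
    fix e :: real assume e: "e > 0"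
    have "dist (g n S) (g n S') < e" if "delone_dist S S' < e / (real n + 1)" for S S'
    proof -
      have "\<bar>\<delta> S - \<delta> S'\<bar> \<le> delone_dist S S'" using lip[of S S'] lip[of S' S] by (simp add: delone_dist_commute abs_le_iff)
      then have "real n * \<bar>\<delta> S - \<delta> S'\<bar> \<le> (real n + 1) * delone_dist S S'"
        by (intro mult_mono) auto
      also have "\<dots> < e" using that by (simp add: pos_less_divide_eq mult.commute add_nonneg_pos)
      finally have "\<bar>real n * \<delta> S - real n * \<delta> S'\<bar> < e" by (simp add: abs_mult flip: right_diff_distrib)
      then show ?thesis by (auto simp: g_def dist_real_def min_def)
    qed
    then show "\<exists>\<delta>>0. \<forall>S\<in>\<Omega>. \<forall>S'\<in>\<Omega>. delone_dist S S' < \<delta> \<longrightarrow> dist (g n S) (g n S') < e"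
      using e by (intro exI[of _ "e / (real n + 1)"]) (auto simp: add_nonneg_pos)
  qed
  moreover have "g n S \<in> {0..1}" for n S using \<delta>0[of S] by (simp add: g_def)
  moreover have "(\<lambda>n. g n S) \<longlonglongrightarrow> indicator U S" if S: "S \<in> \<Omega>" for S
  proof (cases "S \<in> U")
    case True
    then obtain r where r: "r > 0" "\<And>S'. S' \<in> \<Omega> \<Longrightarrow> delone_dist S S' < r \<Longrightarrow> S' \<in> U"
      using U unfolding openin_hull_iff by blast
    have "r \<le> \<delta> S" unfolding \<delta>_def using r(2) by (intro cINF_greatest C) (force simp: C_def)
    then have pos: "\<delta> S > 0" using r(1) by simp
    obtain N where N: "1 / \<delta> S < real N" using reals_Archimedean2 by blast
    have "g n S = 1" if "n \<ge> N" for n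
    proof -
      have "1 / \<delta> S \<le> real n" using N that by linarith
      then have "1 \<le> real n * \<delta> S" using pos by (simp add: pos_divide_le_eq)
      then show ?thesis by (simp add: g_def)
    qed
    then show ?thesis using True by (intro tendsto_eventually) (auto simp: eventually_sequentially)
  next
    case False
    then have "S \<in> C" using S by (simp add: C_def)
    then have "\<delta> S \<le> delone_dist S S" unfolding \<delta>_def by (rule cINF_lower[OF bdd])
    also have "delone_dist S S = 0"
      using Metric_space.mdist_zero[OF Metric_space_delone, of S] S[unfolded mem_hull_iff] by simp
    finally have "g n S = 0" for n using \<delta>0[of S] by (simp add: g_def)
    then show ?thesis using False by simp
  qed
  ultimately show ?thesis by blast
qed

lemma abs_indicator_diff_le_1:
  fixes g :: "'b \<Rightarrow> real"
  shows "g S \<in> {0..1} \<Longrightarrow> \<bar>indicator A S - g S\<bar> \<le> 1"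
  by (cases "S \<in> A") auto

lemma integrable_abs_indicator_diff:
  fixes g :: "('d, 'm) colored \<Rightarrow> real"
  assumes [measurable]: "A \<in> sets \<mu>" "g \<in> borel_measurable \<mu>" and "\<And>S. g S \<in> {0..1}"
  shows "integrable \<mu> (\<lambda>S. \<bar>indicator A S - g S\<bar>)"
  using assms(3) by (intro integrable_const_bound[of _ 1] AE_I2) (simp_all add: abs_indicator_diff_le_1)

text \<open>Induction along the generation of the sigma-algebra: 1 - g for complements, max for
  finite unions, and a finite union close in measure for a countable one.\<close>

lemma sets_unif_cont_approx:
  assumes "A \<in> sets \<mu>" "e > 0"
  shows "\<exists>g :: ('d, 'm) colored \<Rightarrow> real. unif_cont g \<and> (\<forall>S. g S \<in> {0..1}) \<and>
    (\<integral>S. \<bar>indicator A S - g S\<bar> \<partial>\<mu>) < e"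
  using assms(1)[unfolded sets_hull] assms(2)
proof (induction A arbitrary: e rule: sigma_sets.induct)
  case (Basic U)
  then have oU: "openin (subtopology delone_topology \<Omega>) U" by simp
  obtain g :: "nat \<Rightarrow> ('d, 'm) colored \<Rightarrow> real" where g: "\<And>n. unif_cont (g n)" "\<And>n S. g n S \<in> {0..1}"
    "\<And>S. S \<in> \<Omega> \<Longrightarrow> (\<lambda>n. g n S) \<longlonglongrightarrow> indicator U S"
    using open_unif_cont_approx[OF oU] by blast
  have [measurable]: "U \<in> sets \<mu>" "g n \<in> borel_measurable \<mu>" for n
    using open_in_sets[OF oU] unif_cont_measurable[OF g(1)] by auto
  have "(\<lambda>n. \<integral>S. \<bar>indicator U S - g n S\<bar> \<partial>\<mu>) \<longlonglongrightarrow> (\<integral>S. 0 \<partial>\<mu>)"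
  proof (rule integral_dominated_convergence[where w = "\<lambda>_. 1"])
    show "AE S in \<mu>. (\<lambda>n. \<bar>indicator U S - g n S\<bar>) \<longlonglongrightarrow> 0"
    proof (rule AE_I2)
      fix S assume "S \<in> space \<mu>"
      then have "(\<lambda>n. \<bar>indicator U S - g n S\<bar>) \<longlonglongrightarrow> \<bar>indicator U S - indicator U S\<bar>"
        using g(3) by (intro tendsto_intros) (simp add: space_hull)
      then show "(\<lambda>n. \<bar>indicator U S - g n S\<bar>) \<longlonglongrightarrow> 0" by simp
    qed
    show "AE S in \<mu>. norm \<bar>indicator U S - g n S\<bar> \<le> 1" for n
      using g(2) by (intro AE_I2) (simp add: abs_indicator_diff_le_1)
  qed auto
  then have "eventually (\<lambda>n. (\<integral>S. \<bar>indicator U S - g n S\<bar> \<partial>\<mu>) < e) sequentially"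
    using Basic.prems by (intro order_tendstoD(2)) auto
  then obtain n where "(\<integral>S. \<bar>indicator U S - g n S\<bar> \<partial>\<mu>) < e"
    by (auto simp: eventually_sequentially)
  then show ?case using g by (intro exI[of _ "g n"]) auto
next
  case Empty
  then show ?case by (intro exI[of _ "\<lambda>_. 0"]) (auto simp: unif_cont_def intro: exI[of _ 1])
next
  case (Compl A)
  obtain g :: "('d, 'm) colored \<Rightarrow> real" where g: "unif_cont g" "\<And>S. g S \<in> {0..1}"
    "(\<integral>S. \<bar>indicator A S - g S\<bar> \<partial>\<mu>) < e" using Compl.IH[OF Compl.prems] by blast
  have "(\<integral>S. \<bar>indicator (\<Omega> - A) S - (1 - g S)\<bar> \<partial>\<mu>) = (\<integral>S. \<bar>indicator A S - g S\<bar> \<partial>\<mu>)"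
    by (rule Bochner_Integration.integral_cong) (auto simp: space_hull indicator_def)
  moreover have "unif_cont (\<lambda>S. 1 - g S)"
    using g(1) unfolding unif_cont_def by (simp add: dist_real_def abs_minus_commute)
  ultimately show ?case using g by (intro exI[of _ "\<lambda>S. 1 - g S"]) auto
next
  case (Union A)
  have Am [measurable]: "A n \<in> sets \<mu>" for n using Union.hyps by (simp add: sets_hull)
  have fin: "\<exists>g :: ('d, 'm) colored \<Rightarrow> real. unif_cont g \<and> (\<forall>S. g S \<in> {0..1}) \<and>
    (\<integral>S. \<bar>indicator (\<Union>i<n. A i) S - g S\<bar> \<partial>\<mu>) < e" if "e > 0" for n e
    using that
  proof (induction n arbitrary: e)
    case 0
    then show ?case by (intro exI[of _ "\<lambda>_. 0"]) (auto simp: unif_cont_def intro: exI[of _ 1])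
  next
    case (Suc n)
    then have e2: "e/2 > 0" by simp
    obtain g :: "('d, 'm) colored \<Rightarrow> real" where g: "unif_cont g" "\<And>S. g S \<in> {0..1}"
      "(\<integral>S. \<bar>indicator (\<Union>i<n. A i) S - g S\<bar> \<partial>\<mu>) < e/2" using Suc.IH[OF e2] by blast
    obtain h :: "('d, 'm) colored \<Rightarrow> real" where h: "unif_cont h" "\<And>S. h S \<in> {0..1}"
      "(\<integral>S. \<bar>indicator (A n) S - h S\<bar> \<partial>\<mu>) < e/2" using Union.IH[OF e2] by blast
    have [measurable]: "g \<in> borel_measurable \<mu>" "h \<in> borel_measurable \<mu>"
      using g(1) h(1) by (auto intro: unif_cont_measurable)
    have "unif_cont (\<lambda>S. max (g S) (h S))"
      unfolding unif_cont_def
    proof (intro allI impI)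
      fix e :: real assume e: "e > 0"
      obtain d1 d2 where "d1 > 0" "d2 > 0"
        "\<And>S S'. S \<in> \<Omega> \<Longrightarrow> S' \<in> \<Omega> \<Longrightarrow> delone_dist S S' < d1 \<Longrightarrow> dist (g S) (g S') < e"
        "\<And>S S'. S \<in> \<Omega> \<Longrightarrow> S' \<in> \<Omega> \<Longrightarrow> delone_dist S S' < d2 \<Longrightarrow> dist (h S) (h S') < e"
        using unif_contD[OF g(1) e] unif_contD[OF h(1) e] by metis
      moreover have "dist (max a b) (max a' b') < e" if "dist a a' < e" "dist b b' < e" for a b a' b' :: real
        using that by (auto simp: dist_real_def max_def abs_if split: if_splits)
      ultimately show "\<exists>\<delta>>0. \<forall>S\<in>\<Omega>. \<forall>S'\<in>\<Omega>. delone_dist S S' < \<delta> \<longrightarrow>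
          dist (max (g S) (h S)) (max (g S') (h S')) < e"
        by (intro exI[of _ "min d1 d2"]) auto
    qed
    moreover have "(\<integral>S. \<bar>indicator (\<Union>i<Suc n. A i) S - max (g S) (h S)\<bar> \<partial>\<mu>) < e"
    proof -
      have int1: "integrable \<mu> (\<lambda>S. \<bar>indicator (\<Union>i<n. A i) S - g S\<bar>)"
        and int2: "integrable \<mu> (\<lambda>S. \<bar>indicator (A n) S - h S\<bar>)"
        by (intro integrable_abs_indicator_diff g(2) h(2); measurable)+
      have int3: "integrable \<mu> (\<lambda>S. \<bar>indicator (\<Union>i<Suc n. A i) S - max (g S) (h S)\<bar>)"
        using g(2) h(2) by (intro integrable_abs_indicator_diff) (auto simp: max_def)
      have "(\<integral>S. \<bar>indicator (\<Union>i<Suc n. A i) S - max (g S) (h S)\<bar> \<partial>\<mu>) \<le>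
          (\<integral>S. \<bar>indicator (\<Union>i<n. A i) S - g S\<bar> + \<bar>indicator (A n) S - h S\<bar> \<partial>\<mu>)"
      proof (rule integral_mono[OF int3 Bochner_Integration.integrable_add[OF int1 int2]])
        fix S
        have ind: "indicator (\<Union>i<Suc n. A i) S = max (indicator (\<Union>i<n. A i) S) (indicator (A n) S :: real)"
          by (auto simp: indicator_def lessThan_Suc)
        show "\<bar>indicator (\<Union>i<Suc n. A i) S - max (g S) (h S)\<bar> \<le>
            \<bar>indicator (\<Union>i<n. A i) S - g S\<bar> + \<bar>indicator (A n) S - h S\<bar>"
          unfolding ind by (simp add: max_def abs_if)
      qed
      also have "\<dots> = (\<integral>S. \<bar>indicator (\<Union>i<n. A i) S - g S\<bar> \<partial>\<mu>) + (\<integral>S. \<bar>indicator (A n) S - h S\<bar> \<partial>\<mu>)"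
        by (rule Bochner_Integration.integral_add[OF int1 int2])
      also have "\<dots> < e" using g(3) h(3) by simp
      finally show ?thesis .
    qed
    moreover have "max (g S) (h S) \<in> {0..1}" for S using g(2)[of S] h(2)[of S] by auto
    ultimately show ?case by (intro exI[of _ "\<lambda>S. max (g S) (h S)"]) auto
  qed
  have "(\<lambda>n. \<integral>S. \<bar>indicator (\<Union>i. A i) S - indicator (\<Union>i<n. A i) S :: real\<bar> \<partial>\<mu>) \<longlonglongrightarrow> (\<integral>S. 0 \<partial>\<mu>)"
  proof (rule integral_dominated_convergence[where w = "\<lambda>_. 1"])
    show "AE S in \<mu>. (\<lambda>n. \<bar>indicator (\<Union>i. A i) S - indicator (\<Union>i<n. A i) S :: real\<bar>) \<longlonglongrightarrow> 0"
    proof (rule AE_I2)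
      fix S
      have "(\<lambda>n. indicator (\<Union>i<n. A i) S :: real) \<longlonglongrightarrow> indicator (\<Union>i. A i) S"
        by (rule LIMSEQ_indicator_UN)
      then have "(\<lambda>n. \<bar>indicator (\<Union>i. A i) S - indicator (\<Union>i<n. A i) S :: real\<bar>) \<longlonglongrightarrow>
          \<bar>indicator (\<Union>i. A i) S - indicator (\<Union>i. A i) S\<bar>"
        by (intro tendsto_intros)
      then show "(\<lambda>n. \<bar>indicator (\<Union>i. A i) S - indicator (\<Union>i<n. A i) S :: real\<bar>) \<longlonglongrightarrow> 0" by simp
    qed
  qed (auto simp: indicator_def)
  then have "eventually (\<lambda>n. (\<integral>S. \<bar>indicator (\<Union>i. A i) S - indicator (\<Union>i<n. A i) S :: real\<bar> \<partial>\<mu>) < e/2) sequentially"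
    using Union.prems by (intro order_tendstoD(2)) auto
  then obtain n where n: "(\<integral>S. \<bar>indicator (\<Union>i. A i) S - indicator (\<Union>i<n. A i) S :: real\<bar> \<partial>\<mu>) < e/2"
    by (auto simp: eventually_sequentially)
  obtain g :: "('d, 'm) colored \<Rightarrow> real" where g: "unif_cont g" "\<And>S. g S \<in> {0..1}"
      "(\<integral>S. \<bar>indicator (\<Union>i<n. A i) S - g S\<bar> \<partial>\<mu>) < e/2" using fin[of "e/2" n] Union.prems by auto
  have [measurable]: "g \<in> borel_measurable \<mu>" using g(1) by (rule unif_cont_measurable)
  have int1: "integrable \<mu> (\<lambda>S. \<bar>indicator (\<Union>i<n. A i) S - g S\<bar>)"
    by (intro integrable_abs_indicator_diff g(2)) auto
  have int2: "integrable \<mu> (\<lambda>S. \<bar>indicator (\<Union>i. A i) S - indicator (\<Union>i<n. A i) S :: real\<bar>)"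
    by (intro integrable_abs_indicator_diff) (auto simp: indicator_def)
  have int3: "integrable \<mu> (\<lambda>S. \<bar>indicator (\<Union>i. A i) S - g S\<bar>)"
    by (intro integrable_abs_indicator_diff g(2)) auto
  have "(\<integral>S. \<bar>indicator (\<Union>i. A i) S - g S\<bar> \<partial>\<mu>) \<le>
      (\<integral>S. \<bar>indicator (\<Union>i. A i) S - indicator (\<Union>i<n. A i) S\<bar> + \<bar>indicator (\<Union>i<n. A i) S - g S\<bar> \<partial>\<mu>)"
    by (rule integral_mono[OF int3 Bochner_Integration.integrable_add[OF int2 int1]]) simp
  also have "\<dots> = (\<integral>S. \<bar>indicator (\<Union>i. A i) S - indicator (\<Union>i<n. A i) S\<bar> \<partial>\<mu>) + (\<integral>S. \<bar>indicator (\<Union>i<n. A i) S - g S\<bar> \<partial>\<mu>)"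
    by (rule Bochner_Integration.integral_add[OF int2 int1])
  also have "\<dots> < e" using n g(3) by simp
  finally show ?case using g by blast
qed

text \<open>Indicators come from \<open>sets_unif_cont_approx\<close>, limits from dominated
  convergence. L1 is the right norm, because the phase estimate integrates moduli, and elements of
  \<open>L2\<close> are integrable for a probability measure.\<close>

lemma integrable_unif_cont_approx:
  fixes f :: "('d, 'm) colored \<Rightarrow> complex"
  assumes "integrable \<mu> f" "e > 0"
  shows "\<exists>g. unif_cont g \<and> integrable \<mu> g \<and> (\<integral>S. cmod (f S - g S) \<partial>\<mu>) < e"
  using assms
proof (induction arbitrary: e rule: integrable_induct)
  case (base A c)
  have "e / (cmod c + 1) > 0" using base.prems by (simp add: add_nonneg_pos)
  then obtain g :: "('d, 'm) colored \<Rightarrow> real" where g: "unif_cont g" "\<And>S. g S \<in> {0..1}"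
    "(\<integral>S. \<bar>indicator A S - g S\<bar> \<partial>\<mu>) < e / (cmod c + 1)"
    using sets_unif_cont_approx[OF base.hyps(1)] by blast
  have [measurable]: "A \<in> sets \<mu>" "g \<in> borel_measurable \<mu>"
    using base.hyps unif_cont_measurable[OF g(1)] by auto
  have int: "integrable \<mu> g"
    using g(2) by (intro integrable_const_bound[of _ 1] AE_I2) auto
  have "(\<integral>S. cmod (indicator A S *\<^sub>R c - g S *\<^sub>R c) \<partial>\<mu>) = (\<integral>S. \<bar>indicator A S - g S\<bar> * cmod c \<partial>\<mu>)"
    by (simp flip: scaleR_left_diff_distrib)
  also have "\<dots> = (\<integral>S. \<bar>indicator A S - g S\<bar> \<partial>\<mu>) * cmod c" by simp
  also have "\<dots> \<le> (\<integral>S. \<bar>indicator A S - g S\<bar> \<partial>\<mu>) * (cmod c + 1)"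
    by (intro mult_left_mono) auto
  also have "\<dots> < e" using g(3) by (simp add: pos_less_divide_eq add_nonneg_pos)
  finally show ?case
    using unif_cont_scaleR[OF g(1)] int by (intro exI[of _ "\<lambda>S. g S *\<^sub>R c"]) auto
next
  case (add f f')
  then have e2: "e/2 > 0" by simp
  obtain g g' where g: "unif_cont g" "integrable \<mu> g" "(\<integral>S. cmod (f S - g S) \<partial>\<mu>) < e/2"
    "unif_cont g'" "integrable \<mu> g'" "(\<integral>S. cmod (f' S - g' S) \<partial>\<mu>) < e/2"
    using add.IH(1)[OF e2] add.IH(2)[OF e2] by blast
  have "(\<integral>S. cmod ((f S + f' S) - (g S + g' S)) \<partial>\<mu>) \<le> (\<integral>S. cmod (f S - g S) + cmod (f' S - g' S) \<partial>\<mu>)"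
    using g add.hyps by (intro integral_mono) (auto simp: add_diff_add norm_triangle_ineq)
  also have "\<dots> = (\<integral>S. cmod (f S - g S) \<partial>\<mu>) + (\<integral>S. cmod (f' S - g' S) \<partial>\<mu>)"
    using g add.hyps by (intro Bochner_Integration.integral_add) auto
  also have "\<dots> < e" using g by simp
  finally show ?case using g unif_cont_add by (intro exI[of _ "\<lambda>S. g S + g' S"]) auto
next
  case (lim f s)
  then have e2: "e/2 > 0" by simp
  have [measurable]: "f \<in> borel_measurable \<mu>" "s n \<in> borel_measurable \<mu>" for n
    using lim.hyps by auto
  have "(\<lambda>n. \<integral>S. cmod (f S - s n S) \<partial>\<mu>) \<longlonglongrightarrow> (\<integral>S. 0 \<partial>\<mu>)"
  proof (rule integral_dominated_convergence[where w = "\<lambda>S. 3 * cmod (f S)"])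
    show "AE S in \<mu>. (\<lambda>n. cmod (f S - s n S)) \<longlonglongrightarrow> 0"
    proof (rule AE_I2)
      fix S assume "S \<in> space \<mu>"
      then have "(\<lambda>n. cmod (f S - s n S)) \<longlonglongrightarrow> cmod (f S - f S)"
        using lim.hyps by (intro tendsto_intros) auto
      then show "(\<lambda>n. cmod (f S - s n S)) \<longlonglongrightarrow> 0" by simp
    qed
    show "AE S in \<mu>. norm (cmod (f S - s n S)) \<le> 3 * cmod (f S)" for n
    proof (rule AE_I2)
      fix S assume S: "S \<in> space \<mu>"
      have "cmod (s n S) \<le> 2 * cmod (f S)" using lim.hyps S by auto
      then show "norm (cmod (f S - s n S)) \<le> 3 * cmod (f S)"
        using norm_triangle_ineq4[of "f S" "s n S"] by simp
    qed
  qed (use lim.hyps in auto)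
  then have "eventually (\<lambda>n. (\<integral>S. cmod (f S - s n S) \<partial>\<mu>) < e/2) sequentially"
    using e2 by (intro order_tendstoD(2)) auto
  then obtain n where n: "(\<integral>S. cmod (f S - s n S) \<partial>\<mu>) < e/2" by (auto simp: eventually_sequentially)
  obtain g where g: "unif_cont g" "integrable \<mu> g" "(\<integral>S. cmod (s n S - g S) \<partial>\<mu>) < e/2"
    using lim.IH[OF e2] by blast
  have "(\<integral>S. cmod (f S - g S) \<partial>\<mu>) \<le> (\<integral>S. cmod (f S - s n S) + cmod (s n S - g S) \<partial>\<mu>)"
  proof (rule integral_mono)
    show "cmod (f S - g S) \<le> cmod (f S - s n S) + cmod (s n S - g S)" for S
      using norm_triangle_ineq[of "f S - s n S" "s n S - g S"] by simp
  qed (use g lim.hyps in auto)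
  also have "\<dots> = (\<integral>S. cmod (f S - s n S) \<partial>\<mu>) + (\<integral>S. cmod (s n S - g S) \<partial>\<mu>)"
    using g lim.hyps by (intro Bochner_Integration.integral_add) auto
  also have "\<dots> < e" using g n by simp
  finally show ?case using g by blast
qed

end

section \<open>Eigenfunctions\<close>

lemma L2_add:
  assumes "f \<in> L2 M" "g \<in> L2 M"
  shows "(\<lambda>x. f x + g x) \<in> L2 M"
proof -
  have [measurable]: "f \<in> borel_measurable M" "g \<in> borel_measurable M" using assms by (auto simp: L2_def)
  have "integrable M (\<lambda>x. (cmod (f x + g x))\<^sup>2)"
  proof (rule Bochner_Integration.integrable_bound)
    show "integrable M (\<lambda>x. 2 * (cmod (f x))\<^sup>2 + 2 * (cmod (g x))\<^sup>2)"
      using assms by (simp add: L2_def)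
    show "AE x in M. norm ((cmod (f x + g x))\<^sup>2) \<le> norm (2 * (cmod (f x))\<^sup>2 + 2 * (cmod (g x))\<^sup>2)"
    proof (rule AE_I2)
      fix x
      have "(cmod (f x + g x))\<^sup>2 \<le> (cmod (f x) + cmod (g x))\<^sup>2"
        by (intro power_mono norm_triangle_ineq) simp
      also have "\<dots> \<le> 2 * (cmod (f x))\<^sup>2 + 2 * (cmod (g x))\<^sup>2"
        using sum_squares_ge_zero[of "cmod (f x) - cmod (g x)" 0] by (simp add: power2_eq_square algebra_simps)
      finally show "norm ((cmod (f x + g x))\<^sup>2) \<le> norm (2 * (cmod (f x))\<^sup>2 + 2 * (cmod (g x))\<^sup>2)"
        by simp
    qed
  qed measurable
  then show ?thesis by (simp add: L2_def)
qed

lemma L2_mult_left: "f \<in> L2 M \<Longrightarrow> (\<lambda>x. c * f x) \<in> L2 M"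
  by (auto simp: L2_def norm_mult power_mult_distrib)

lemma L2_sum_mult:
  assumes "finite F" "\<And>f. f \<in> F \<Longrightarrow> f \<in> L2 M"
  shows "(\<lambda>x. \<Sum>f\<in>F. c f * f x) \<in> L2 M"
  using assms
proof (induction F rule: finite_induct)
  case empty
  then show ?case by (simp add: L2_def)
next
  case (insert f F)
  then show ?case by (simp add: L2_add L2_mult_left)
qed

context hull_system
begin

lemma L2_integrable:
  assumes "f \<in> L2 \<mu>"
  shows "integrable \<mu> f"
proof (rule Bochner_Integration.integrable_bound)
  show "integrable \<mu> (\<lambda>S. 1 + (cmod (f S))\<^sup>2)" using assms by (simp add: L2_def)
  show "AE S in \<mu>. norm (f S) \<le> norm (1 + (cmod (f S))\<^sup>2)"
  proof (rule AE_I2)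
    fix S
    have "2 * cmod (f S) \<le> 1 + (cmod (f S))\<^sup>2"
      using zero_le_power2[of "cmod (f S) - 1"] by (simp add: power2_eq_square algebra_simps)
    then have "cmod (f S) \<le> 1 + (cmod (f S))\<^sup>2" using norm_ge_zero[of "f S"] by linarith
    then show "norm (f S) \<le> norm (1 + (cmod (f S))\<^sup>2)" by simp
  qed
qed (use assms in \<open>simp add: L2_def\<close>)

definition phase :: "real^'d \<Rightarrow> real^'d \<Rightarrow> complex" where
  "phase \<alpha> g = exp (2 * of_real pi * \<i> * of_real (g \<bullet> \<alpha>))"

lemma norm_phase [simp]: "cmod (phase \<alpha> g) = 1"
proof -
  have "phase \<alpha> g = exp (\<i> * of_real (2 * pi * (g \<bullet> \<alpha>)))" by (simp add: phase_def mult_ac)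
  then show ?thesis by (simp only: norm_exp_i_times)
qed

lemma phase_add: "phase \<alpha> (g + h) = phase \<alpha> g * phase \<alpha> h"
  by (simp add: phase_def inner_add_left distrib_left exp_add)

text \<open>Wherever \<open>S\<close> and \<open>S - X n\<close> agree on a large ball, a uniformly continuous approximant
  of \<open>f\<close> barely changes under the shift, whereas \<open>f\<close> itself is multiplied by the phase
  of \<open>X n\<close>. As a bounded number of translates of this region covers the hull, the phase must
  be close to 1.\<close>

lemma eigenfunction_phase_limit:
  fixes X :: "nat \<Rightarrow> real^'d" and \<tau> :: "nat \<Rightarrow> 'b \<Rightarrow> real^'d"
  assumes ef: "eigenfunction \<mu> \<alpha> f" and T: "finite T"
    and agree: "\<And>R. \<exists>n0. \<forall>n\<ge>n0. \<forall>b. \<exists>t\<in>T. \<forall>i p.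
      norm (p - (b + \<tau> n t)) < R \<longrightarrow> (p \<in> \<Lambda> i \<longleftrightarrow> p + X n \<in> \<Lambda> i)"
  shows "(\<lambda>n. phase \<alpha> (X n)) \<longlonglongrightarrow> 1"
proof (rule LIMSEQ_I)
  fix \<eta> :: real assume \<eta>: "\<eta> > 0"
  have fL2: "f \<in> L2 \<mu>" and f0: "\<not> (AE S in \<mu>. f S = 0)"
    and eig: "\<And>g. AE S in \<mu>. f (shift (- g) S) = phase \<alpha> g * f S"
    using ef by (auto simp: eigenfunction_def phase_def)
  have fint: "integrable \<mu> f" using fL2 by (rule L2_integrable)
  define I0 where "I0 = (\<integral>S. cmod (f S) \<partial>\<mu>)"
  have "I0 \<noteq> 0"
    using f0 integral_nonneg_eq_0_iff_AE[of \<mu> "\<lambda>S. cmod (f S)"] fint by (simp add: I0_def)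
  moreover have "I0 \<ge> 0" unfolding I0_def by (intro Bochner_Integration.integral_nonneg) simp
  ultimately have I0: "I0 > 0" by simp
  \<comment> \<open>Each \<open>t\<close> in \<open>T\<close> contributes at most 3 * e: twice the
    integral of \<open>cmod (f S - g S)\<close>, by invariance of \<mu>, and once the oscillation of
    \<open>g\<close>. The total stays below \<eta> * I0.\<close>
  define e where "e = \<eta> * I0 / (4 * (real (card T) + 1))"
  have e: "e > 0" using \<eta> I0 by (simp add: e_def)
  obtain g where g: "unif_cont g" "integrable \<mu> g" "(\<integral>S. cmod (f S - g S) \<partial>\<mu>) < e"
    using integrable_unif_cont_approx[OF fint e] by blast
  obtain \<delta> where \<delta>: "\<delta> > 0"
    "\<And>S S'. S \<in> \<Omega> \<Longrightarrow> S' \<in> \<Omega> \<Longrightarrow> delone_dist S S' < \<delta> \<Longrightarrow> dist (g S) (g S') < e"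
    using unif_contD[OF g(1) e] by blast
  define R where "R = 2 / \<delta>"
  have R: "R > 0" "1 / R < \<delta>" using \<delta>(1) by (auto simp: R_def)
  obtain n0 where n0: "\<And>n b. n \<ge> n0 \<Longrightarrow> \<exists>t\<in>T. \<forall>i p.
      norm (p - (b + \<tau> n t)) < R \<longrightarrow> (p \<in> \<Lambda> i \<longleftrightarrow> p + X n \<in> \<Lambda> i)"
    using agree[of R] by blast
  have "norm (phase \<alpha> (X n) - 1) < \<eta>" if n: "n \<ge> n0" for n
  proof -
    define s where "s t S = shift (- \<tau> n t) S" for t and S :: "('d, 'm) colored"
    define s' where "s' t S = shift (- (\<tau> n t + X n)) S" for t and S :: "('d, 'm) colored"
    define w where "w S = cmod (f S - g S)" for S
    have wint: "integrable \<mu> w" unfolding w_def using fint g(2) by simp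
    have close: "\<exists>t\<in>T. dist (g (s t S)) (g (s' t S)) < e" if S: "S \<in> \<Omega>" for S
    proof -
      \<comment> \<open>The suitable \<open>t\<close> is known only after \<open>v\<close>, so
        \<open>L\<close> must accommodate the balls about \<open>\<tau> n t\<close> and about
        \<open>\<tau> n t + X n\<close> for all \<open>t\<close> at once.\<close>
      define L where "L = R + norm (X n) + (\<Sum>t\<in>T. norm (\<tau> n t))"
      obtain v where v: "\<And>i p. norm p < L \<Longrightarrow> p \<in> S i \<longleftrightarrow> p + v \<in> \<Lambda> i"
        using hull_locally_translate[OF S, of L] by blast
      obtain t where t: "t \<in> T"
        "\<And>i p. norm (p - (v + \<tau> n t)) < R \<Longrightarrow> p \<in> \<Lambda> i \<longleftrightarrow> p + X n \<in> \<Lambda> i"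
        using n0[OF n, of v] by blast
      have "norm (\<tau> n t) \<le> (\<Sum>t\<in>T. norm (\<tau> n t))" using t(1) T by (intro member_le_sum) auto
      then have L: "norm q < R \<Longrightarrow> norm (q + \<tau> n t) < L" "norm q < R \<Longrightarrow> norm (q + \<tau> n t + X n) < L" for q
        using norm_triangle_ineq[of q "\<tau> n t"] norm_triangle_ineq[of "q + \<tau> n t" "X n"] norm_ge_zero[of "X n"]
        unfolding L_def by linarith+
      have "delone_dist (s t S) (s' t S) < \<delta>"
      proof (rule delone_dist_less_if_agree[OF R])
        fix i and q :: "real^'d" assume q: "norm q < R"
        have "q \<in> s t S i \<longleftrightarrow> q + \<tau> n t \<in> S i" by (simp add: s_def mem_shift)
        also have "\<dots> \<longleftrightarrow> q + \<tau> n t + v \<in> \<Lambda> i" by (rule v[OF L(1)[OF q]])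
        also have "\<dots> \<longleftrightarrow> q + \<tau> n t + v + X n \<in> \<Lambda> i" by (rule t(2)) (simp add: q)
        also have "\<dots> \<longleftrightarrow> q + \<tau> n t + X n \<in> S i" unfolding v[OF L(2)[OF q]] by (simp add: add_ac)
        also have "\<dots> \<longleftrightarrow> q \<in> s' t S i" by (simp add: s'_def mem_shift algebra_simps)
        finally show "q \<in> s t S i \<longleftrightarrow> q \<in> s' t S i" .
      qed
      then have "dist (g (s t S)) (g (s' t S)) < e"
        unfolding s_def s'_def by (intro \<delta>(2) hull_shift S)
      then show ?thesis using t(1) by blast
    qed
    have "AE S in \<mu>. \<forall>t\<in>T. f (s t S) = phase \<alpha> (\<tau> n t) * f S \<and> f (s' t S) = phase \<alpha> (\<tau> n t + X n) * f S"
      unfolding s_def s'_def by (intro AE_finite_allI[OF T] AE_conjI eig)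
    moreover have "AE S in \<mu>. S \<in> \<Omega>" by (rule AE_I2) (simp add: space_hull)
    \<comment> \<open>The good \<open>t\<close> varies with \<open>S\<close> in an uncontrolled way;
      summing nonnegative terms over all of \<open>T\<close> gives an integrable bound
      regardless.\<close>
    ultimately have AE: "AE S in \<mu>. cmod (phase \<alpha> (X n) - 1) * cmod (f S) \<le> (\<Sum>t\<in>T. w (s t S) + w (s' t S) + e)"
    proof eventually_elim
      fix S
      assume ph: "\<forall>t\<in>T. f (s t S) = phase \<alpha> (\<tau> n t) * f S \<and> f (s' t S) = phase \<alpha> (\<tau> n t + X n) * f S"
        and S: "S \<in> \<Omega>"
      obtain t where t: "t \<in> T" "dist (g (s t S)) (g (s' t S)) < e" using close[OF S] by blast
      have "f (s' t S) - f (s t S) = phase \<alpha> (\<tau> n t) * ((phase \<alpha> (X n) - 1) * f S)"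
        using ph t(1) by (simp add: phase_add algebra_simps)
      then have "cmod (phase \<alpha> (X n) - 1) * cmod (f S) = cmod (f (s' t S) - f (s t S))"
        by (simp add: norm_mult)
      also have "f (s' t S) - f (s t S) =
          (f (s' t S) - g (s' t S)) - (f (s t S) - g (s t S)) - (g (s t S) - g (s' t S))" by simp
      also have "cmod \<dots> \<le> w (s' t S) + w (s t S) + dist (g (s t S)) (g (s' t S))"
        unfolding w_def dist_norm
        using norm_triangle_ineq4[of "(f (s' t S) - g (s' t S)) - (f (s t S) - g (s t S))" "g (s t S) - g (s' t S)"]
          norm_triangle_ineq4[of "f (s' t S) - g (s' t S)" "f (s t S) - g (s t S)"] by linarith
      also have "\<dots> \<le> w (s t S) + w (s' t S) + e" using t(2) by simp
      also have "\<dots> \<le> (\<Sum>t\<in>T. w (s t S) + w (s' t S) + e)"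
        using t(1) T e
        by (intro member_le_sum[of t T "\<lambda>t. w (s t S) + w (s' t S) + e"]) (auto simp: w_def intro!: add_nonneg_nonneg)
      finally show "cmod (phase \<alpha> (X n) - 1) * cmod (f S) \<le> (\<Sum>t\<in>T. w (s t S) + w (s' t S) + e)" .
    qed
    have ints: "integrable \<mu> (\<lambda>S. w (s t S))" "integrable \<mu> (\<lambda>S. w (s' t S))" for t
      unfolding s_def s'_def by (rule integrable_shift[OF wint])+
    have wI: "(\<integral>S. w S \<partial>\<mu>) < e" using g(3) by (simp add: w_def)
    have "cmod (phase \<alpha> (X n) - 1) * I0 = (\<integral>S. cmod (phase \<alpha> (X n) - 1) * cmod (f S) \<partial>\<mu>)"
      by (simp add: I0_def)
    also have "\<dots> \<le> (\<integral>S. (\<Sum>t\<in>T. w (s t S) + w (s' t S) + e) \<partial>\<mu>)"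
      using AE fint ints by (intro integral_mono_AE) auto
    also have "\<dots> = (\<Sum>t\<in>T. (\<integral>S. w (s t S) \<partial>\<mu>) + (\<integral>S. w (s' t S) \<partial>\<mu>) + e)"
      using ints by (simp add: Bochner_Integration.integral_sum prob_space)
    also have "\<dots> = (\<Sum>t\<in>T. (\<integral>S. w S \<partial>\<mu>) + (\<integral>S. w S \<partial>\<mu>) + e)"
      unfolding s_def s'_def using wint by (simp add: integral_shift)
    also have "\<dots> \<le> (\<Sum>t\<in>T. 3 * e)" using wI by (intro sum_mono) simp
    also have "\<dots> = real (card T) * 3 * e" by simp
    also have "\<dots> < (4 * (real (card T) + 1)) * e" using e by (intro mult_strict_right_mono) auto
    also have "\<dots> = \<eta> * I0" by (simp add: e_def)
    finally show "norm (phase \<alpha> (X n) - 1) < \<eta>" using I0 by simp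
  qed
  then show "\<exists>n0. \<forall>n\<ge>n0. norm (phase \<alpha> (X n) - 1) < \<eta>" by blast
qed

text \<open>If a direction \<open>w\<close> is orthogonal to all eigenvalues, then all of \<open>L2\<close> is invariant
  under translations along \<open>w\<close>. But the event that there is a point of color \<open>j\<close> near the
  origin is disjoint from a small translate of itself.\<close>

lemma eigenvalues_span:
  assumes pp: "pure_point_spectrum \<mu>" and w: "w \<noteq> 0"
  shows "\<exists>\<alpha> f. eigenfunction \<mu> \<alpha> f \<and> w \<bullet> \<alpha> \<noteq> 0"
proof (rule ccontr)
  assume "\<not> ?thesis"
  then have orth: "w \<bullet> \<alpha> = 0" if "eigenfunction \<mu> \<alpha> f" for \<alpha> f using that by blast
  fix j :: 'm
  have "uniform_discrete (\<Lambda> j)" using delone by (simp add: delone_multiset_def delone_def)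
  then obtain \<epsilon> where \<epsilon>: "\<epsilon> > 0" "\<And>x y. x \<in> \<Lambda> j \<Longrightarrow> y \<in> \<Lambda> j \<Longrightarrow> dist x y < \<epsilon> \<Longrightarrow> x = y"
    unfolding uniform_discrete_def by blast
  \<comment> \<open>\<open>u\<close> is parallel to \<open>w\<close> with length \<epsilon> / 2.
    Points of one color within r = \<epsilon> / 8 of 0 and of \<open>u\<close> are less than
    \<epsilon> apart, so they coincide, which 2 * r < norm u forbids.\<close>
  define u where "u = (\<epsilon> / (2 * norm w)) *\<^sub>R w"
  have nu: "norm u = \<epsilon> / 2" using w \<epsilon>(1) by (simp add: u_def)
  define r where "r = \<epsilon> / 8"
  have r: "r > 0" using \<epsilon>(1) by (simp add: r_def)
  define A where "A = {S \<in> \<Omega>. \<exists>p\<in>S j. norm p < r}"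
  have "openin (subtopology delone_topology \<Omega>) A"
    unfolding openin_hull_iff
  proof (intro conjI ballI)
    show "A \<subseteq> \<Omega>" by (auto simp: A_def)
    fix S assume "S \<in> A"
    then obtain p where p: "p \<in> S j" "norm p < r" by (auto simp: A_def)
    define \<delta> where "\<delta> = min (1/2) (min ((r - norm p) / 2) (1 / (norm p + 1)))"
    have \<delta>: "\<delta> > 0" "\<delta> \<le> 1/2" "\<delta> \<le> (r - norm p) / 2" "\<delta> \<le> 1 / (norm p + 1)"
      using p(2) by (simp add: \<delta>_def add_nonneg_pos, unfold \<delta>_def, linarith+)
    have inv: "norm p + 1 \<le> 1 / \<delta>" using \<delta>(1,4) by (simp add: pos_le_divide_eq add_nonneg_pos mult.commute)
    have "S' \<in> A" if S': "S' \<in> \<Omega>" and dist: "delone_dist S S' < \<delta>" for S'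
    proof -
      obtain x y where xy: "norm x < \<delta>" "norm y < \<delta>"
        "\<And>i p. norm p \<le> 1 / \<delta> \<Longrightarrow> p + x \<in> S i \<longleftrightarrow> p + y \<in> S' i"
        using delone_dist_less_obtains[OF dist \<delta>(2)] by blast
      have "norm (p - x) \<le> 1 / \<delta>" using inv xy(1) \<delta>(2) norm_triangle_ineq4[of p x] by linarith
      from xy(3)[OF this, of j] have "p - x + y \<in> S' j" using p(1) by simp
      moreover have "norm (p - x + y) < r"
      proof -
        have "2 * \<delta> \<le> r - norm p" using \<delta>(3) by simp
        moreover have "norm (p - x + y) \<le> norm p + norm x + norm y"
          using norm_triangle_ineq[of "p - x" y] norm_triangle_ineq4[of p x] by simp
        ultimately show ?thesis using xy(1,2) by linarith
      qed
      ultimately show ?thesis using S' by (auto simp: A_def)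
    qed
    then show "\<exists>r>0. \<forall>S'\<in>\<Omega>. delone_dist S S' < r \<longrightarrow> S' \<in> A" using \<delta>(1) by blast
  qed
  then have A [measurable]: "A \<in> sets \<mu>" by (rule open_in_sets)
  have Aint: "integrable \<mu> (indicator A :: _ \<Rightarrow> real)"
    by (intro integrable_real_indicator A) (simp add: emeasure_eq_measure)
  have disj: "shift (- u) S \<notin> A" if SA: "S \<in> A" for S
  proof
    assume "shift (- u) S \<in> A"
    then obtain q where q: "q + u \<in> S j" "norm q < r" by (auto simp: A_def mem_shift)
    obtain p where p: "S \<in> \<Omega>" "p \<in> S j" "norm p < r" using SA by (auto simp: A_def)
    obtain v where v: "\<And>i p. norm p < \<epsilon> \<Longrightarrow> p \<in> S i \<longleftrightarrow> p + v \<in> \<Lambda> i"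
      using hull_locally_translate[OF p(1), of \<epsilon>] by blast
    have "norm (q + u) < \<epsilon>" "norm p < \<epsilon>"
      using norm_triangle_ineq[of q u] q(2) p(3) nu \<epsilon>(1) unfolding r_def by linarith+
    then have "q + u + v \<in> \<Lambda> j" "p + v \<in> \<Lambda> j" using v q(1) p(2) by auto
    moreover have "dist (q + u + v) (p + v) < \<epsilon>"
      using norm_triangle_ineq[of q u] norm_triangle_ineq4[of "q + u" p] q(2) p(3) nu \<epsilon>(1)
      unfolding r_def by (simp add: dist_norm)
    ultimately have "q + u = p" using \<epsilon>(2) by fastforce
    then have "u = p - q" by (simp add: algebra_simps)
    then show False using norm_triangle_ineq4[of p q] nu q(2) p(3) \<epsilon>(1) unfolding r_def by simp
  qed
  \<comment> \<open>The indicator of \<open>A\<close> drops from 1 to 0 under the shift, while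
    combinations of eigenfunctions are invariant almost everywhere. So the approximation error
    \<open>k\<close> is at least 1/2 at one of the two points, and \<open>A\<close> is small
    compared with the squared error.\<close>
  have "measure \<mu> A \<le> 4 * e\<^sup>2" if e: "e > 0" for e
  proof -
    define h :: "('d, 'm) colored \<Rightarrow> complex" where "h = indicator A"
    have h: "h \<in> L2 \<mu>"
    proof -
      have "(\<lambda>S. (cmod (h S))\<^sup>2) = indicator A" by (auto simp: h_def indicator_def)
      then show ?thesis unfolding L2_def using Aint by (simp add: h_def)
    qed
    obtain F c where F: "finite F" "\<And>f. f \<in> F \<Longrightarrow> \<exists>\<alpha>. eigenfunction \<mu> \<alpha> f"
      and le: "sqrt (\<integral>S. (cmod (h S - (\<Sum>f\<in>F. c f * f S)))\<^sup>2 \<partial>\<mu>) < e"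
      using pp[unfolded pure_point_spectrum_def, rule_format, OF h e] by blast
    define k where "k S = h S - (\<Sum>f\<in>F. c f * f S)" for S
    have "(\<lambda>S. \<Sum>f\<in>F. c f * f S) \<in> L2 \<mu>"
      by (intro L2_sum_mult F(1)) (use F(2) in \<open>auto simp: eigenfunction_def\<close>)
    then have "k \<in> L2 \<mu>"
      using L2_add[OF h L2_mult_left[of _ \<mu> "-1"]] unfolding k_def by simp
    then have kint: "integrable \<mu> (\<lambda>S. (cmod (k S))\<^sup>2)" by (simp add: L2_def)
    have kle: "(\<integral>S. (cmod (k S))\<^sup>2 \<partial>\<mu>) \<le> e\<^sup>2"
      unfolding k_def by (rule sqrt_le_D[OF less_imp_le[OF le]])
    have "AE S in \<mu>. \<forall>f\<in>F. f (shift (- u) S) = f S"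
    proof (rule AE_finite_allI[OF F(1)])
      fix f assume "f \<in> F"
      then obtain \<alpha> where \<alpha>: "eigenfunction \<mu> \<alpha> f" using F(2) by blast
      then have "u \<bullet> \<alpha> = 0" using orth by (simp add: u_def)
      moreover have "AE S in \<mu>. f (shift (- u) S) = exp (2 * of_real pi * \<i> * of_real (u \<bullet> \<alpha>)) * f S"
        using \<alpha> unfolding eigenfunction_def by blast
      ultimately show "AE S in \<mu>. f (shift (- u) S) = f S" by simp
    qed
    then have AE: "AE S in \<mu>. indicator A S \<le> 2 * (cmod (k (shift (- u) S)))\<^sup>2 + 2 * (cmod (k S))\<^sup>2"
    proof eventually_elim
      fix S assume inv: "\<forall>f\<in>F. f (shift (- u) S) = f S"
      show "indicator A S \<le> 2 * (cmod (k (shift (- u) S)))\<^sup>2 + 2 * (cmod (k S))\<^sup>2"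
      proof (cases "S \<in> A")
        case True
        have "k S - k (shift (- u) S) = h S - h (shift (- u) S)"
        proof -
          have "(\<Sum>f\<in>F. c f * f (shift (- u) S)) = (\<Sum>f\<in>F. c f * f S)"
            by (rule sum.cong) (use inv in auto)
          then show ?thesis unfolding k_def by simp
        qed
        also have "\<dots> = 1" using True disj[OF True] by (simp add: h_def)
        finally have "1 \<le> cmod (k S) + cmod (k (shift (- u) S))"
          by (metis norm_one norm_triangle_ineq4)
        then have "1\<^sup>2 \<le> (cmod (k S) + cmod (k (shift (- u) S)))\<^sup>2" by (intro power_mono) auto
        also have "\<dots> \<le> 2 * (cmod (k (shift (- u) S)))\<^sup>2 + 2 * (cmod (k S))\<^sup>2"
          using zero_le_power2[of "cmod (k S) - cmod (k (shift (- u) S))"] by (simp add: power2_eq_square algebra_simps)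
        finally show ?thesis using True by simp
      qed simp
    qed
    have int2: "integrable \<mu> (\<lambda>S. (cmod (k (shift (- u) S)))\<^sup>2)" by (rule integrable_shift[OF kint])
    have "measure \<mu> A = (\<integral>S. indicator A S \<partial>\<mu>)" by simp
    also have "\<dots> \<le> (\<integral>S. 2 * (cmod (k (shift (- u) S)))\<^sup>2 + 2 * (cmod (k S))\<^sup>2 \<partial>\<mu>)"
      using kint int2 AE Aint by (intro integral_mono_AE) auto
    also have "\<dots> = 2 * (\<integral>S. (cmod (k (shift (- u) S)))\<^sup>2 \<partial>\<mu>) + 2 * (\<integral>S. (cmod (k S))\<^sup>2 \<partial>\<mu>)"
      using kint int2 by simp
    also have "(\<integral>S. (cmod (k (shift (- u) S)))\<^sup>2 \<partial>\<mu>) = (\<integral>S. (cmod (k S))\<^sup>2 \<partial>\<mu>)"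
      by (rule integral_shift) (rule borel_measurable_integrable[OF kint])
    finally show ?thesis using kle by simp
  qed
  note small = this
  have "measure \<mu> A = 0"
  proof (rule ccontr)
    assume "measure \<mu> A \<noteq> 0"
    then have pos: "measure \<mu> A > 0" by (simp add: zero_less_measure_iff)
    define e where "e = sqrt (measure \<mu> A / 8)"
    have "e > 0" "e\<^sup>2 = measure \<mu> A / 8" using pos by (auto simp: e_def)
    then show False using small[of e] pos by simp
  qed
  then have "AE S in \<mu>. S \<notin> A" using A by (intro AE_not_in) (simp add: null_sets_def emeasure_eq_measure)
  then have AEv: "AE S in \<mu>. shift v S \<notin> A" for v by (rule AE_shift)
  \<comment> \<open>Translates of \<open>A\<close> by a countable dense set of vectors cover the
    hull, as every element has a point of color \<open>j\<close>; so \<open>A\<close> cannot be a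
    null set.\<close>
  obtain E :: "(real^'d) set" where E: "countable E" "\<And>X. open X \<Longrightarrow> X \<noteq> {} \<Longrightarrow> \<exists>d\<in>E. d \<in> X"
    using countable_dense_setE by blast
  have "AE S in \<mu>. \<forall>v\<in>E. shift (- v) S \<notin> A"
    using E(1) AEv by (simp add: AE_ball_countable)
  moreover have "AE S in \<mu>. S \<in> \<Omega>" by (rule AE_I2) (simp add: space_hull)
  ultimately have "AE S in \<mu>. False"
  proof eventually_elim
    fix S assume S: "\<forall>v\<in>E. shift (- v) S \<notin> A" "S \<in> \<Omega>"
    have "relatively_dense (S j)" using S(2) unfolding mem_hull_iff by (auto simp: delone_multiset_def delone_def)
    then obtain p where p: "p \<in> S j" by (auto simp: relatively_dense_def)
    obtain v where v: "v \<in> E" "v \<in> ball p r" using E(2)[of "ball p r"] r by auto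
    have "shift (- v) S \<in> A"
      unfolding A_def mem_Collect_eq
    proof (intro conjI bexI)
      show "norm (p - v) < r" using v(2) by (simp add: dist_norm)
      show "p - v \<in> shift (- v) S j" using p by (simp add: mem_shift)
    qed (rule hull_shift[OF S(2)])
    then show False using S(1) v(1) by blast
  qed
  then show False by simp
qed

end

section \<open>Return vectors\<close>

context doubling_substitution
begin

definition returns :: "'m \<Rightarrow> (real^'d) set" where
  "returns i = {y - z |y z. y \<in> \<Lambda> i \<and> z \<in> \<Lambda> i}"

lemma returnsI: "y \<in> \<Lambda> i \<Longrightarrow> z \<in> \<Lambda> i \<Longrightarrow> y - z \<in> returns i"
  by (auto simp: returns_def)

text \<open>No digit set is empty, so the two points can be given children of any color
  \<open>i\<close> by the same digit, which cancels. Thus one color can stand in for all others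
  after one inflation.\<close>

lemma Q_returns:
  assumes "x \<in> returns j"
  shows "Q x \<in> returns i"
proof -
  obtain y z where yz: "x = y - z" "y \<in> \<Lambda> j" "z \<in> \<Lambda> j" using assms by (auto simp: returns_def)
  obtain a where a: "a \<in> D i j" using D_nonempty[of i j] by blast
  have "Q x = (Q y + a) - (Q z + a)" using yz(1) by (simp add: linear_diff[OF linear_Q])
  then show ?thesis using returnsI[OF child[OF yz(2) a] child[OF yz(3) a]] by simp
qed

lemma finite_short_returns: "finite {x \<in> returns i. norm x < R}"
proof (rule finite_subset)
  show "{x \<in> returns i. norm x < R} \<subseteq> {u - x |u x. u \<in> supp \<Lambda> \<and> x \<in> supp \<Lambda> \<and> norm (u - x) < R}"
    unfolding returns_def supp_def by blast
qed (rule FLC_finite_differences[OF flc delone])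

text \<open>Two points of the same color are joined by a chain of points of that color with bounded
  steps.\<close>

lemma returns_finitely_generated:
  "\<exists>V. finite V \<and> V \<subseteq> returns i \<and>
    (\<forall>x\<in>returns i. \<exists>c :: real^'d \<Rightarrow> int. x = (\<Sum>v\<in>V. of_int (c v) *\<^sub>R v))"
proof -
  obtain R where R: "R > 0" "\<And>x. \<Lambda> i \<inter> ball x R \<noteq> {}"
    using colors_relatively_dense[of i] by (auto simp: relatively_dense_def)
  define V where "V = {x \<in> returns i. norm x < 3 * R}"
  have V: "finite V" unfolding V_def by (rule finite_short_returns)
  have gen: "\<exists>c :: real^'d \<Rightarrow> int. x = (\<Sum>v\<in>V. of_int (c v) *\<^sub>R v)" if "x \<in> V" for x
  proof -
    have "(\<Sum>v\<in>V. of_int (if v = x then 1 else 0) *\<^sub>R v) = (\<Sum>v\<in>V. if v = x then x else 0)"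
      by (rule sum.cong) auto
    also have "\<dots> = x" using V that by (simp add: sum.delta)
    finally show ?thesis by (intro exI[of _ "\<lambda>v. if v = x then 1 else 0"]) simp
  qed
  have "\<exists>c :: real^'d \<Rightarrow> int. y - z = (\<Sum>v\<in>V. of_int (c v) *\<^sub>R v)"
    if "y \<in> \<Lambda> i" "z \<in> \<Lambda> i" "norm (y - z) < real N * R" for N y z
    using that
  proof (induction N arbitrary: z)
    case 0
    then show ?case using norm_ge_zero[of "y - z"] by simp
  next
    case (Suc N)
    show ?case
    proof (cases "norm (y - z) < 3 * R")
      case True
      then show ?thesis using Suc.prems by (intro gen) (simp add: V_def returnsI)
    next
      case False
      define l where "l = norm (y - z)"
      have l: "l \<ge> 3 * R" "l > 0" using False R(1) by (auto simp: l_def)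
      \<comment> \<open>\<open>a\<close> lies at distance 2 * R from \<open>z\<close> on the way to
        \<open>y\<close>. A point of \<Lambda> within \<open>R\<close> of it gives a step shorter
        than 3 * R that brings the chain closer to \<open>y\<close> by more than
        \<open>R\<close>.\<close>
      define a where "a = z + (2 * R / l) *\<^sub>R (y - z)"
      obtain x where x: "x \<in> \<Lambda> i" "norm (a - x) < R" using R(2)[of a] by (auto simp: dist_norm)
      have "norm (a - z) = 2 * R" using l R(1) by (simp add: a_def l_def[symmetric])
      then have xz: "norm (x - z) < 3 * R"
        using x(2) norm_triangle_ineq4[of "a - z" "a - x"] by simp
      have "y - a = (1 - 2 * R / l) *\<^sub>R (y - z)" by (simp add: a_def scaleR_diff_left)
      then have "norm (y - a) = \<bar>1 - 2 * R / l\<bar> * l" by (simp add: l_def)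
      also have "\<dots> = l - 2 * R"
      proof -
        have "2 * R / l \<le> 1" using l R(1) by (simp add: pos_divide_le_eq)
        then show ?thesis using l(2) by (simp add: left_diff_distrib)
      qed
      finally have "norm (y - x) < l - R"
        using x(2) norm_triangle_ineq[of "y - a" "a - x"] by simp
      then have "norm (y - x) < real N * R" using Suc.prems(3) by (simp add: l_def algebra_simps)
      then obtain c where c: "y - x = (\<Sum>v\<in>V. of_int (c v) *\<^sub>R v)"
        using Suc.IH[OF Suc.prems(1) x(1)] by blast
      have "x - z \<in> V" using x(1) Suc.prems(2) xz by (simp add: V_def returnsI)
      then obtain c' where c': "x - z = (\<Sum>v\<in>V. of_int (c' v) *\<^sub>R v)" using gen by blast
      have "y - z = (\<Sum>v\<in>V. of_int (c v + c' v) *\<^sub>R v)"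
        using arg_cong2[OF c c', of "(+)"] by (simp add: sum.distrib scaleR_left_distrib)
      then show ?thesis by (intro exI[of _ "\<lambda>v. c v + c' v"])
    qed
  qed
  note chain = this
  have "\<exists>c :: real^'d \<Rightarrow> int. x = (\<Sum>v\<in>V. of_int (c v) *\<^sub>R v)" if x: "x \<in> returns i" for x
  proof -
    obtain y z where yz: "x = y - z" "y \<in> \<Lambda> i" "z \<in> \<Lambda> i" using x by (auto simp: returns_def)
    obtain N where "norm (y - z) / R < real N" using reals_Archimedean2 by blast
    then have "norm (y - z) < real N * R" using R(1) by (simp add: pos_divide_less_eq)
    from chain[OF yz(2,3) this] show ?thesis using yz(1) by simp
  qed
  moreover have "V \<subseteq> returns i" by (auto simp: V_def)
  ultimately show ?thesis using V by (intro exI[of _ V]) simp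
qed

text \<open>The one property of eigenvalues used from here on. It concerns each return vector
  separately; uniformity follows in \<open>tame_uniform\<close>.\<close>

definition tame :: "real^'d \<Rightarrow> bool" where
  "tame \<alpha> \<longleftrightarrow> (\<forall>i. \<forall>x\<in>returns i. (\<lambda>n. int_dist ((Q ^^ n) x \<bullet> \<alpha>)) \<longlonglongrightarrow> 0)"

text \<open>\<open>Q\<close> maps each generator into the integer span of the generators, which
  supplies the integer matrix for \<open>int_dist_recursion_summable\<close>. A general return
  vector is a fixed integer combination of generators.\<close>

lemma tame_summable:
  assumes "tame \<alpha>" "x \<in> returns i"
  shows "summable (\<lambda>n. int_dist ((Q ^^ n) x \<bullet> \<alpha>))"
proof -
  obtain V where "finite V" "V \<subseteq> returns i"
    "\<forall>x\<in>returns i. \<exists>c :: real^'d \<Rightarrow> int. x = (\<Sum>v\<in>V. of_int (c v) *\<^sub>R v)"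
    using returns_finitely_generated[of i] by (elim exE conjE)
  note V = this(1,2) this(3)[THEN bspec]
  have "\<exists>c :: real^'d \<Rightarrow> int. Q v = (\<Sum>l\<in>V. of_int (c l) *\<^sub>R l)" if "v \<in> V" for v
    by (rule V(3)[OF Q_returns[of v i]]) (use V(2) that in blast)
  note ex = this
  define M :: "real^'d \<Rightarrow> real^'d \<Rightarrow> int" where "M v = (SOME c. Q v = (\<Sum>l\<in>V. of_int (c l) *\<^sub>R l))" for v
  have M: "Q v = (\<Sum>l\<in>V. of_int (M v l) *\<^sub>R l)" if "v \<in> V" for v
    unfolding M_def by (rule someI_ex[OF ex[OF that]])
  define \<theta> where "\<theta> n v = (Q ^^ n) v \<bullet> \<alpha>" for n v
  have comb: "(Q ^^ n) (\<Sum>v\<in>V. of_int (c v) *\<^sub>R v) \<bullet> \<alpha> = (\<Sum>v\<in>V. of_int (c v) * \<theta> n v)"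
    for n and c :: "real^'d \<Rightarrow> int"
    unfolding \<theta>_def linear_sum[OF linear_Qn] inner_sum_left by (simp add: linear_scale[OF linear_Qn])
  have summ: "summable (\<lambda>n. int_dist (\<theta> n v))" if "v \<in> V" for v
  proof (rule int_dist_recursion_summable[OF V(1), where \<theta> = \<theta> and M = M])
    fix n v assume "v \<in> V"
    have "\<theta> (Suc n) v = (Q ^^ n) (Q v) \<bullet> \<alpha>" by (simp add: \<theta>_def funpow_swap1)
    then show "\<theta> (Suc n) v = (\<Sum>l\<in>V. of_int (M v l) * \<theta> n l)"
      unfolding M[OF \<open>v \<in> V\<close>] comb .
  next
    fix v assume "v \<in> V"
    then show "(\<lambda>n. int_dist (\<theta> n v)) \<longlonglongrightarrow> 0"
      unfolding \<theta>_def by (intro assms(1)[unfolded tame_def, rule_format, of v i] subsetD[OF V(2)])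
  qed (rule that)
  obtain c :: "real^'d \<Rightarrow> int" where c: "x = (\<Sum>v\<in>V. of_int (c v) *\<^sub>R v)" using V(3)[OF assms(2)] by (rule exE)
  have le: "norm (int_dist ((Q ^^ n) x \<bullet> \<alpha>)) \<le> (\<Sum>v\<in>V. \<bar>of_int (c v)\<bar> * int_dist (\<theta> n v))" for n
  proof -
    have "int_dist (\<Sum>v\<in>V. of_int (c v) * \<theta> n v) \<le> (\<Sum>v\<in>V. \<bar>of_int (c v)\<bar> * int_dist (\<theta> n v))"
      by (rule order_trans[OF int_dist_sum sum_mono]) (rule int_dist_of_int_mult)
    then have "int_dist ((Q ^^ n) x \<bullet> \<alpha>) \<le> (\<Sum>v\<in>V. \<bar>of_int (c v)\<bar> * int_dist (\<theta> n v))"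
      unfolding c comb .
    then show ?thesis by simp
  qed
  have "summable (\<lambda>n. \<Sum>v\<in>V. \<bar>of_int (c v)\<bar> * int_dist (\<theta> n v))"
    by (intro summable_sum summable_mult summ)
  then show ?thesis by (rule summable_comparison_test'[where N = 0]) (rule le)
qed

section \<open>Uniform convergence over all return vectors\<close>

text \<open>Replacing each point \<open>p\<close> of the hierarchy by its child \<open>Q p + e\<close> of a fixed color turns
  the digits into return vectors from a finite set \<open>F\<close>: the modified difference \<open>z\<close> at one level
  is \<open>Q z1 + f - f'\<close> with \<open>z1\<close> the modified difference at the next level. As \<open>z1\<close> is shorter
  than \<open>z\<close> unless \<open>z\<close> is short, this expands every return vector in a way that only involves
  finitely many return vectors.\<close>

lemma tame_uniform:
  assumes "tame \<alpha>"
  shows "\<exists>H. H \<longlonglongrightarrow> 0 \<and> (\<forall>i. \<forall>x\<in>returns i. \<forall>k. int_dist ((Q ^^ Suc k) x \<bullet> \<alpha>) \<le> H k)"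
proof -
  fix i0 :: 'm
  define e where "e j = (SOME a. a \<in> D i0 j)" for j
  have e: "e j \<in> D i0 j" for j using D_nonempty[of i0 j] unfolding e_def by (simp add: some_in_eq)
  \<comment> \<open>If p = Q p1 + a, with colors \<open>c\<close> and \<open>c1\<close>, then Q p +
    e c = Q (Q p1 + e c1) + \<phi> c c1 a + e i0. The term \<open>e i0\<close> cancels in
    differences; subtracting it makes \<phi> c c1 a a difference of two points of color
    \<open>i0\<close>.\<close>
  define \<phi> where "\<phi> c c' a = Q a + e c - Q (e c') - e i0" for c c' a
  define F where "F = (\<Union>c. \<Union>c'. \<phi> c c' ` D c c')"
  have finF: "finite F" unfolding F_def using finite_D by auto
  have FI: "\<phi> c c' a \<in> F" if "a \<in> D c c'" for c c' a using that by (auto simp: F_def)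
  have Fret: "f \<in> returns i0" if f: "f \<in> F" for f
  proof -
    obtain c c' a where a: "a \<in> D c c'" "f = \<phi> c c' a" using f by (auto simp: F_def)
    obtain w where w: "w \<in> \<Lambda> c'" using colors_nonempty by blast
    have "Q (Q w + a) + e c \<in> \<Lambda> i0" "Q (Q w + e c') + e i0 \<in> \<Lambda> i0"
      using child[OF child[OF w a(1)] e] child[OF child[OF w e] e] by auto
    then have "(Q (Q w + a) + e c) - (Q (Q w + e c') + e i0) \<in> returns i0" by (rule returnsI)
    then show ?thesis by (simp add: a(2) \<phi>_def linear_add[OF linear_Q] algebra_simps)
  qed
  define B where "B = (\<Sum>f\<in>F. norm f)"
  have B: "norm f \<le> B" if "f \<in> F" for f unfolding B_def using finF that by (intro member_le_sum) auto
  \<comment> \<open>From length 2 * B + 2 on, doubling gives 2 * norm z1 \<le> norm z + 2 * B \<le>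
    2 * norm z - 2, so each level shortens the difference by at least 1.\<close>
  define Z where "Z = {x \<in> returns i0. norm x < 2 * B + 2}"
  have finZ: "finite Z" unfolding Z_def by (rule finite_short_returns)
  define d where "d n v = int_dist ((Q ^^ n) v \<bullet> \<alpha>)" for n v
  \<comment> \<open>One level costs the errors of \<open>f\<close> and \<open>f'\<close>, hence the
    factor 2; the final level costs that of an element of \<open>Z\<close>. The tail sums
    \<open>H\<close> absorb one \<open>s k\<close> per level, while the power of \<open>Q\<close>
    rises by one.\<close>
  define s where "s n = 2 * (\<Sum>f\<in>F. d n f) + (\<Sum>v\<in>Z. d n v)" for n
  have d0: "d n v \<ge> 0" for n v by (simp add: d_def)
  have s0: "s n \<ge> 0" for n unfolding s_def by (intro add_nonneg_nonneg mult_nonneg_nonneg sum_nonneg d0) simp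
  have "summable s"
    unfolding s_def d_def using assms Fret
    by (intro summable_add summable_mult summable_sum tame_summable) (auto simp: Z_def)
  define H where "H k = (\<Sum>n. s (n + k))" for k
  have H_Suc: "H k = s k + H (Suc k)" for k
    unfolding H_def using suminf_split_head[OF summable_ignore_initial_segment[OF \<open>summable s\<close>, of k]] by simp
  have H0: "H k \<ge> 0" for k
    unfolding H_def by (intro suminf_nonneg summable_ignore_initial_segment[OF \<open>summable s\<close>] s0)
  have Hlim: "H \<longlonglongrightarrow> 0" unfolding H_def by (rule suminf_exist_split2[OF \<open>summable s\<close>])
  have main: "d k ((Q p + e c) - (Q q + e c')) \<le> H k"
    if "p \<in> \<Lambda> c" "q \<in> \<Lambda> c'" "norm ((Q p + e c) - (Q q + e c')) < 2 * B + 2 + real N" for N p q c c' k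
    using that
  proof (induction N arbitrary: p q c c' k rule: less_induct)
    case (less N)
    define z where "z = (Q p + e c) - (Q q + e c')"
    have zret: "z \<in> returns i0"
      unfolding z_def using child[OF less.prems(1) e] child[OF less.prems(2) e] by (rule returnsI)
    show ?case
    proof (cases "norm z < 2 * B + 2")
      case True
      then have "z \<in> Z" using zret by (simp add: Z_def)
      then have "d k z \<le> (\<Sum>v\<in>Z. d k v)" using finZ d0 by (intro member_le_sum) auto
      also have "\<dots> \<le> s k" unfolding s_def by (simp add: sum_nonneg d0)
      also have "\<dots> \<le> H k" using H_Suc[of k] H0[of "Suc k"] by simp
      finally show ?thesis unfolding z_def .
    next
      case False
      obtain c1 p1 a where p1: "p1 \<in> \<Lambda> c1" "a \<in> D c c1" "p = Q p1 + a" using parent[OF less.prems(1)] .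
      obtain c1' q1 b where q1: "q1 \<in> \<Lambda> c1'" "b \<in> D c' c1'" "q = Q q1 + b" using parent[OF less.prems(2)] .
      define z1 where "z1 = (Q p1 + e c1) - (Q q1 + e c1')"
      define f f' where "f = \<phi> c c1 a" and "f' = \<phi> c' c1' b"
      have fF: "f \<in> F" "f' \<in> F" unfolding f_def f'_def by (intro FI p1(2) q1(2))+
      have z: "z = Q z1 + f - f'"
        unfolding z_def z1_def f_def f'_def \<phi>_def p1(3) q1(3)
        by (simp add: linear_add[OF linear_Q] linear_diff[OF linear_Q])
      have "Q z1 = z - f + f'" using z by simp
      then have "2 * norm z1 \<le> norm z + norm f + norm f'"
        using doubling[of z1] norm_triangle_ineq[of "z - f" f'] norm_triangle_ineq4[of z f] by simp
      then have short: "norm z1 \<le> norm z - 1" using B[OF fF(1)] B[OF fF(2)] False by simp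
      have N: "N \<noteq> 0" using less.prems(3) False by (intro notI) (simp add: z_def)
      then have "norm z1 < 2 * B + 2 + real (N - 1)"
        using short less.prems(3) unfolding z_def[symmetric] by (simp add: of_nat_diff)
      then have IH: "d (Suc k) z1 \<le> H (Suc k)"
        using less.IH[OF _ p1(1) q1(1), of "N - 1" "Suc k"] N unfolding z1_def by simp
      have "(Q ^^ k) z = (Q ^^ Suc k) z1 + (Q ^^ k) f - (Q ^^ k) f'"
        unfolding z by (simp add: linear_add[OF linear_Qn] linear_diff[OF linear_Qn] funpow_swap1)
      then have "d k z \<le> d (Suc k) z1 + d k f + d k f'"
        unfolding d_def
        using int_dist_add[of "(Q ^^ Suc k) z1 \<bullet> \<alpha>" "(Q ^^ k) f \<bullet> \<alpha>"]
          int_dist_diff[of "(Q ^^ Suc k) z1 \<bullet> \<alpha> + (Q ^^ k) f \<bullet> \<alpha>" "(Q ^^ k) f' \<bullet> \<alpha>"]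
        by (simp only: inner_add_left inner_diff_left)
      also have "d k f \<le> (\<Sum>f\<in>F. d k f)" using finF fF d0 by (intro member_le_sum) auto
      also have "d k f' \<le> (\<Sum>f\<in>F. d k f)" using finF fF d0 by (intro member_le_sum) auto
      finally have "d k z \<le> d (Suc k) z1 + 2 * (\<Sum>f\<in>F. d k f)" by simp
      also have "\<dots> \<le> H (Suc k) + s k" using IH sum_nonneg[of Z "d k"] d0 by (simp add: s_def)
      finally show ?thesis using H_Suc[of k] unfolding z_def by simp
    qed
  qed
  have "\<forall>i. \<forall>x\<in>returns i. \<forall>k. int_dist ((Q ^^ Suc k) x \<bullet> \<alpha>) \<le> H k"
  proof (intro allI ballI)
    fix i x k assume x: "x \<in> returns i"
    obtain y z where yz: "x = y - z" "y \<in> \<Lambda> i" "z \<in> \<Lambda> i" using x by (auto simp: returns_def)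
    \<comment> \<open>Two points of equal color receive the same digit \<open>e i\<close>, so their
      modified difference is \<open>Q x\<close>; hence the exponent \<open>Suc k\<close>.\<close>
    have Qx: "(Q y + e i) - (Q z + e i) = Q x" by (simp add: yz(1) linear_diff[OF linear_Q])
    obtain N where "norm (Q x) < real N" using reals_Archimedean2 by blast
    moreover have "B \<ge> 0" unfolding B_def by (intro sum_nonneg) simp
    ultimately have "norm ((Q y + e i) - (Q z + e i)) < 2 * B + 2 + real N" unfolding Qx by simp
    from main[OF yz(2,3) this, of k] show "int_dist ((Q ^^ Suc k) x \<bullet> \<alpha>) \<le> H k"
      unfolding Qx d_def by (simp add: funpow_swap1)
  qed
  then show ?thesis using Hlim by (intro exI[of _ H] conjI)
qed

text \<open>The tame vectors span the space, since nothing nonzero is orthogonal to all of them. For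
  a basis chosen among them the sum of moduli vanishes only at 0, and its minimum on the unit sphere
  is \<kappa>.\<close>

lemma tame_separating_finite:
  assumes "\<And>w. w \<noteq> 0 \<Longrightarrow> \<exists>\<alpha>. tame \<alpha> \<and> w \<bullet> \<alpha> \<noteq> 0"
  shows "\<exists>E \<kappa>. finite E \<and> (\<forall>\<alpha>\<in>E. tame \<alpha>) \<and> \<kappa> > 0 \<and> (\<forall>x. \<kappa> * norm x \<le> (\<Sum>\<alpha>\<in>E. \<bar>x \<bullet> \<alpha>\<bar>))"
proof -
  obtain E where E: "E \<subseteq> {\<alpha>. tame \<alpha>}" "independent E" "{\<alpha>. tame \<alpha>} \<subseteq> span E"
    using maximal_independent_subset[of "{\<alpha>. tame \<alpha>}"] by blast
  have finE: "finite E" using E(2) by (rule independent_imp_finite)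
  have sep: "\<exists>\<alpha>\<in>E. w \<bullet> \<alpha> \<noteq> 0" if "w \<noteq> 0" for w
  proof (rule ccontr)
    assume "\<not> ?thesis"
    then have "E \<subseteq> {\<alpha>. w \<bullet> \<alpha> = 0}" by auto
    then have "span E \<subseteq> {\<alpha>. w \<bullet> \<alpha> = 0}" by (rule span_minimal) (rule subspace_hyperplane)
    then show False using assms[OF that] E(3) by auto
  qed
  define N where "N x = (\<Sum>\<alpha>\<in>E. \<bar>x \<bullet> \<alpha>\<bar>)" for x
  have "continuous_on (sphere 0 1) N" unfolding N_def by (intro continuous_intros)
  moreover have "sphere (0 :: real^'d) 1 \<noteq> {}" by simp
  ultimately obtain x0 where x0: "x0 \<in> sphere 0 1" "\<And>x. x \<in> sphere 0 1 \<Longrightarrow> N x0 \<le> N x"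
    using continuous_attains_inf[OF compact_sphere] by blast
  have "x0 \<noteq> 0" using x0(1) by auto
  then obtain \<alpha> where \<alpha>: "\<alpha> \<in> E" "x0 \<bullet> \<alpha> \<noteq> 0" using sep by blast
  have "\<bar>x0 \<bullet> \<alpha>\<bar> \<le> N x0" unfolding N_def using \<alpha>(1) finE by (intro member_le_sum) auto
  then have \<kappa>: "N x0 > 0" using \<alpha>(2) by linarith
  have "N x0 * norm x \<le> N x" for x
  proof (cases "x = 0")
    case False
    have "(1 / norm x) *\<^sub>R x \<in> sphere 0 1" using False by simp
    then have "N x0 \<le> N ((1 / norm x) *\<^sub>R x)" by (rule x0(2))
    also have "\<dots> = N x / norm x" by (simp add: N_def sum_divide_distrib abs_mult)
    finally show ?thesis using False by (simp add: pos_le_divide_eq)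
  qed (simp add: N_def)
  then show ?thesis using finE E(1) \<kappa> unfolding N_def by blast
qed

section \<open>The gap argument and the Meyer property\<close>

text \<open>If \<open>Q^k w\<close> has small inner products modulo 1 with the frequencies for all large \<open>k\<close> and is
  small for one such \<open>k\<close>, then it remains small, because the expansion by \<open>Q\<close> is too weak to
  jump over the gap between 0 and the other integers. So \<open>w = 0\<close>.\<close>

lemma sums_of_returns_isolated:
  assumes "\<And>w. w \<noteq> 0 \<Longrightarrow> \<exists>\<alpha>. tame \<alpha> \<and> w \<bullet> \<alpha> \<noteq> 0"
  shows "\<exists>r>0. \<forall>i j k l. \<forall>a\<in>returns i. \<forall>b\<in>returns j. \<forall>c\<in>returns k. \<forall>d\<in>returns l.
    norm (a - b - (c - d)) < r \<longrightarrow> a - b - (c - d) = 0"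
proof -
  obtain E \<kappa> where E: "finite E" "\<And>\<alpha>. \<alpha> \<in> E \<Longrightarrow> tame \<alpha>" "\<kappa> > 0"
    "\<And>x. \<kappa> * norm x \<le> (\<Sum>\<alpha>\<in>E. \<bar>x \<bullet> \<alpha>\<bar>)"
    using tame_separating_finite[OF assms] by blast
  obtain C where C: "C > 0" "\<And>x. norm (Q x) \<le> norm x * C"
    using bounded_linear.pos_bounded[OF linear_conv_bounded_linear[THEN iffD1, OF linear_Q]] by blast
  define b where "b = 1 + (\<Sum>\<alpha>\<in>E. norm \<alpha>)"
  have b: "b > 0" "\<And>\<alpha>. \<alpha> \<in> E \<Longrightarrow> norm \<alpha> \<le> b"
  proof -
    show "b > 0" unfolding b_def by (intro add_pos_nonneg sum_nonneg) auto
    fix \<alpha> assume "\<alpha> \<in> E"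
    then have "norm \<alpha> \<le> (\<Sum>\<alpha>\<in>E. norm \<alpha>)" using E(1) by (intro member_le_sum) auto
    then show "norm \<alpha> \<le> b" by (simp add: b_def)
  qed
  \<comment> \<open>\<open>Q\<close> maps the ball of radius \<sigma> to vectors whose inner
    products with \<open>E\<close> have modulus at most 1/2, where the distance to the integers is
    the modulus itself.\<close>
  define \<sigma> where "\<sigma> = 1 / (2 * C * b)"
  have \<sigma>: "\<sigma> > 0" "\<sigma> * C * b = 1/2" using C b by (auto simp: \<sigma>_def)
  \<comment> \<open>Inner products of modulus at most \<delta> with all of \<open>E\<close> force
    the norm back to at most \<sigma>, which closes the induction in \<open>bound\<close>.\<close>
  define \<delta> where "\<delta> = \<kappa> * \<sigma> / (real (card E) + 1)"
  have \<delta>: "\<delta> > 0" "real (card E) * \<delta> \<le> \<kappa> * \<sigma>"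
    using E(3) \<sigma>(1) by (auto simp: \<delta>_def field_simps)
  \<comment> \<open>The quarter allows for the four return vectors that make up
    \<open>w\<close>.\<close>
  have "\<exists>k0. \<forall>k\<ge>k0. \<forall>i. \<forall>x\<in>returns i. int_dist ((Q ^^ k) x \<bullet> \<alpha>) \<le> \<delta> / 4" if \<alpha>: "\<alpha> \<in> E" for \<alpha>
  proof -
    obtain H where H: "H \<longlonglongrightarrow> 0" "\<And>i x k. x \<in> returns i \<Longrightarrow> int_dist ((Q ^^ Suc k) x \<bullet> \<alpha>) \<le> H k"
      using tame_uniform[OF E(2)[OF \<alpha>]] by blast
    have "eventually (\<lambda>k. H k < \<delta> / 4) sequentially" by (rule order_tendstoD(2)[OF H(1)]) (use \<delta>(1) in simp)
    then obtain k0 where k0: "\<And>k. k \<ge> k0 \<Longrightarrow> H k < \<delta> / 4" unfolding eventually_sequentially by blast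
    have "int_dist ((Q ^^ k) x \<bullet> \<alpha>) \<le> \<delta> / 4" if ks: "k \<ge> Suc k0" and x: "x \<in> returns i" for k x i
    proof -
      obtain k' where "k = Suc k'" "k' \<ge> k0" using ks by (cases k) auto
      then show ?thesis using H(2)[OF x, of k'] k0[of k'] by simp
    qed
    then show ?thesis by blast
  qed
  then have "\<forall>\<alpha>\<in>E. \<exists>k0. \<forall>k\<ge>k0. \<forall>i. \<forall>x\<in>returns i. int_dist ((Q ^^ k) x \<bullet> \<alpha>) \<le> \<delta> / 4" by (rule ballI)
  from bchoice[OF this] obtain k\<alpha> where
    "\<forall>\<alpha>\<in>E. \<forall>k\<ge>k\<alpha> \<alpha>. \<forall>i. \<forall>x\<in>returns i. int_dist ((Q ^^ k) x \<bullet> \<alpha>) \<le> \<delta> / 4" by blast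
  then have k\<alpha>: "int_dist ((Q ^^ k) x \<bullet> \<alpha>) \<le> \<delta> / 4" if "\<alpha> \<in> E" "k \<ge> k\<alpha> \<alpha>" "x \<in> returns i" for \<alpha> k i x
    using that by blast
  define k0 where "k0 = Max (insert 0 (k\<alpha> ` E))"
  have small: "int_dist ((Q ^^ k) x \<bullet> \<alpha>) \<le> \<delta> / 4" if "\<alpha> \<in> E" "k \<ge> k0" "x \<in> returns i" for \<alpha> k x i
  proof (rule k\<alpha>[OF that(1) _ that(3)])
    have "k\<alpha> \<alpha> \<le> k0" unfolding k0_def using that(1) E(1) by (intro Max_ge) auto
    then show "k\<alpha> \<alpha> \<le> k" using that(2) by simp
  qed
  obtain C0 where C0: "C0 > 0" "\<And>x. norm ((Q ^^ k0) x) \<le> norm x * C0"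
    using bounded_linear.pos_bounded[OF linear_conv_bounded_linear[THEN iffD1, OF linear_Qn[of k0]]] by blast
  \<comment> \<open>A vector shorter than \<open>r\<close> still has length at most \<sigma> at
    level \<open>k0\<close>, where the bounds modulo 1 set in.\<close>
  define r where "r = \<sigma> / C0"
  have r: "r > 0" using \<sigma> C0 by (simp add: r_def)
  have "w = 0" if ret: "x1 \<in> returns i" "x2 \<in> returns j" "x3 \<in> returns k" "x4 \<in> returns l"
    and w: "w = x1 - x2 - (x3 - x4)" "norm w < r" for w x1 x2 x3 x4 i j k l
  proof -
    have wd: "int_dist ((Q ^^ n) w \<bullet> \<alpha>) \<le> \<delta>" if n: "n \<ge> k0" and \<alpha>: "\<alpha> \<in> E" for n \<alpha>
    proof -
      have "(Q ^^ n) w \<bullet> \<alpha> = ((Q ^^ n) x1 \<bullet> \<alpha> - (Q ^^ n) x2 \<bullet> \<alpha>) - ((Q ^^ n) x3 \<bullet> \<alpha> - (Q ^^ n) x4 \<bullet> \<alpha>)"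
        by (simp add: w(1) linear_diff[OF linear_Qn] inner_diff_left)
      then show ?thesis
        using int_dist_diff[of "(Q ^^ n) x1 \<bullet> \<alpha> - (Q ^^ n) x2 \<bullet> \<alpha>" "(Q ^^ n) x3 \<bullet> \<alpha> - (Q ^^ n) x4 \<bullet> \<alpha>"]
          int_dist_diff[of "(Q ^^ n) x1 \<bullet> \<alpha>" "(Q ^^ n) x2 \<bullet> \<alpha>"]
          int_dist_diff[of "(Q ^^ n) x3 \<bullet> \<alpha>" "(Q ^^ n) x4 \<bullet> \<alpha>"]
          small[OF \<alpha> n ret(1)] small[OF \<alpha> n ret(2)] small[OF \<alpha> n ret(3)] small[OF \<alpha> n ret(4)] by simp
    qed
    have bound: "norm ((Q ^^ n) w) \<le> \<sigma>" if "n \<ge> k0" for n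
      using that
    proof (induction n rule: dec_induct)
      case base
      have "norm ((Q ^^ k0) w) \<le> norm w * C0" by (rule C0(2))
      also have "\<dots> \<le> r * C0" using w(2) C0(1) by (intro mult_right_mono) auto
      also have "\<dots> = \<sigma>" using C0(1) by (simp add: r_def)
      finally show ?case .
    next
      case (step n)
      have "\<bar>(Q ^^ Suc n) w \<bullet> \<alpha>\<bar> \<le> \<delta>" if \<alpha>: "\<alpha> \<in> E" for \<alpha>
      proof -
        have "\<bar>(Q ^^ Suc n) w \<bullet> \<alpha>\<bar> \<le> norm (Q ((Q ^^ n) w)) * norm \<alpha>"
          using Cauchy_Schwarz_ineq2[of "(Q ^^ Suc n) w" \<alpha>] by simp
        also have "\<dots> \<le> (\<sigma> * C) * b"
        proof (intro mult_mono b(2) \<alpha>)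
          have "norm (Q ((Q ^^ n) w)) \<le> norm ((Q ^^ n) w) * C" by (rule C(2))
          also have "\<dots> \<le> \<sigma> * C" using step.IH C(1) by (intro mult_right_mono) auto
          finally show "norm (Q ((Q ^^ n) w)) \<le> \<sigma> * C" .
        qed (use \<sigma> C in auto)
        finally have "int_dist ((Q ^^ Suc n) w \<bullet> \<alpha>) = \<bar>(Q ^^ Suc n) w \<bullet> \<alpha>\<bar>"
          using \<sigma>(2) by (intro int_dist_eq_abs) simp
        then show ?thesis using wd[of "Suc n" \<alpha>] step.hyps \<alpha> by simp
      qed
      then have "(\<Sum>\<alpha>\<in>E. \<bar>(Q ^^ Suc n) w \<bullet> \<alpha>\<bar>) \<le> (\<Sum>\<alpha>\<in>E. \<delta>)" by (rule sum_mono)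
      then have "\<kappa> * norm ((Q ^^ Suc n) w) \<le> \<kappa> * \<sigma>"
        using E(4)[of "(Q ^^ Suc n) w"] \<delta>(2) by simp
      then show ?case using E(3) by (simp only: mult_le_cancel_left_pos)
    qed
    show "w = 0"
    proof (rule ccontr)
      assume "w \<noteq> 0"
      then have nw: "norm w > 0" by simp
      obtain n where n: "\<sigma> / norm w < 2 ^ n" using real_arch_pow[of 2 "\<sigma> / norm w"] by auto
      have "\<sigma> < 2 ^ n * norm w" using n nw by (simp add: pos_divide_less_eq)
      also have "\<dots> \<le> 2 ^ (n + k0) * norm w" using nw by (intro mult_right_mono power_increasing) auto
      also have "\<dots> \<le> norm ((Q ^^ (n + k0)) w)" by (rule doubling_funpow)
      also have "\<dots> \<le> \<sigma>" by (rule bound) simp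
      finally show False by simp
    qed
  qed
  then show ?thesis using r by blast
qed

text \<open>Two differences of points may involve four colors, so their difference need not be a
  combination of return vectors. For a fixed pattern of colors, however, two such vectors differ by
  x1 - x2 - (x3 - x4) with four return vectors, so each pattern admits at most one vector shorter
  than r / 2. There are finitely many patterns, so the nonzero vectors among these are bounded away
  from 0.\<close>

lemma meyer_if_tame_separating:
  assumes "\<And>w. w \<noteq> 0 \<Longrightarrow> \<exists>\<alpha>. tame \<alpha> \<and> w \<bullet> \<alpha> \<noteq> 0"
  shows "meyer (supp \<Lambda>)"
proof -
  have "\<exists>r>0. \<forall>i j k l. \<forall>a\<in>returns i. \<forall>b\<in>returns j. \<forall>c\<in>returns k. \<forall>d\<in>returns l.
    norm (a - b - (c - d)) < r \<longrightarrow> a - b - (c - d) = 0"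
    by (rule sums_of_returns_isolated) (rule assms)
  then obtain r where r: "r > 0" and "\<forall>i j k l. \<forall>a\<in>returns i. \<forall>b\<in>returns j. \<forall>c\<in>returns k. \<forall>d\<in>returns l.
    norm (a - b - (c - d)) < r \<longrightarrow> a - b - (c - d) = 0"
    by (elim exE conjE)
  note iso = this(2)[rule_format]
  define W where "W = (\<lambda>(i, j, k, l). {w. \<exists>x\<in>\<Lambda> i. \<exists>y\<in>\<Lambda> j. \<exists>x'\<in>\<Lambda> k. \<exists>y'\<in>\<Lambda> l.
      w = x - y - (x' - y') \<and> norm w < r / 2})"
  have "finite (W t)" for t :: "'m \<times> 'm \<times> 'm \<times> 'm"
  proof -
    obtain i j k l where t: "t = (i, j, k, l)" by (rule prod_cases4)
    have eq: "w = w'" if w: "w \<in> W t" and w': "w' \<in> W t" for w w'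
    proof -
      obtain x y x' y' where 1: "x \<in> \<Lambda> i" "y \<in> \<Lambda> j" "x' \<in> \<Lambda> k" "y' \<in> \<Lambda> l"
        "w = x - y - (x' - y')" "norm w < r / 2" using w unfolding W_def t by auto
      obtain u v u' v' where 2: "u \<in> \<Lambda> i" "v \<in> \<Lambda> j" "u' \<in> \<Lambda> k" "v' \<in> \<Lambda> l"
        "w' = u - v - (u' - v')" "norm w' < r / 2" using w' unfolding W_def t by auto
      have diff: "(x - u) - (y - v) - ((x' - u') - (y' - v')) = w - w'" using 1(5) 2(5) by simp
      have "norm (w - w') < r" using norm_triangle_ineq4[of w w'] 1(6) 2(6) by simp
      then have "w - w' = 0"
        using iso[OF returnsI[OF 1(1) 2(1)] returnsI[OF 1(2) 2(2)] returnsI[OF 1(3) 2(3)] returnsI[OF 1(4) 2(4)]]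
        unfolding diff by simp
      then show ?thesis by simp
    qed
    show ?thesis
    proof (cases "W t = {}")
      case False
      then obtain w where "w \<in> W t" by blast
      then have "W t \<subseteq> {w}" using eq by blast
      then show ?thesis by (rule finite_subset) simp
    qed simp
  qed
  then have "finite (\<Union>t. W t)" by simp
  then obtain d where d: "d > 0" "\<And>w. w \<in> (\<Union>t. W t) \<Longrightarrow> w \<noteq> 0 \<Longrightarrow> d \<le> dist 0 w"
    using finite_set_avoid[of "\<Union>t. W t" 0] by blast
  have "uniform_discrete {x - y |x y. x \<in> supp \<Lambda> \<and> y \<in> supp \<Lambda>}"
    unfolding uniform_discrete_def
  proof (intro exI[of _ "min d (r / 2)"] conjI ballI impI)
    show "0 < min d (r / 2)" using d(1) r by simp
    fix a b assume "a \<in> {x - y |x y. x \<in> supp \<Lambda> \<and> y \<in> supp \<Lambda>}" "b \<in> {x - y |x y. x \<in> supp \<Lambda> \<and> y \<in> supp \<Lambda>}"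
      and ab: "dist a b < min d (r / 2)"
    then obtain x y x' y' i j k l where *: "a = x - y" "b = x' - y'"
      "x \<in> \<Lambda> i" "y \<in> \<Lambda> j" "x' \<in> \<Lambda> k" "y' \<in> \<Lambda> l" unfolding supp_def by blast
    have "norm (a - b) < r / 2" using ab by (simp add: dist_norm)
    then have "a - b \<in> W (i, j, k, l)" unfolding W_def using * by auto
    then have "a - b \<in> (\<Union>t. W t)" by blast
    then show "a = b" using d(2)[of "a - b"] ab by (auto simp: dist_norm norm_minus_commute)
  qed
  then show ?thesis using delone by (simp add: meyer_def delone_multiset_def)
qed

end

section \<open>Eigenvalues and return vectors\<close>

text \<open>Exhibits the distance to the integers as a continuous function of the real part of the
  phase, so that convergence of phases to 1 carries over.\<close>

lemma int_dist_eq_arccos: "int_dist t = arccos (cos (2 * pi * t)) / (2 * pi)"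
proof -
  define d where "d = t - of_int (round t)"
  have d: "\<bar>d\<bar> \<le> 1/2" unfolding d_def using of_int_round_abs_le[of t] by (simp add: abs_minus_commute)
  have "2 * pi * t = 2 * pi * d + 2 * pi * of_int (round t)" by (simp add: d_def algebra_simps)
  then have "cos (2 * pi * t) = cos (2 * pi * d)" by (simp add: cos_add)
  also have "\<dots> = cos (2 * pi * \<bar>d\<bar>)" using cos_abs_real[of "2 * pi * d"] by (simp add: abs_mult)
  finally have "arccos (cos (2 * pi * t)) = 2 * pi * \<bar>d\<bar>" using d by (simp add: arccos_cos)
  then show ?thesis by (simp add: int_dist_def d_def)
qed

lemma int_dist_tendsto_0:
  assumes "(\<lambda>n. exp (2 * of_real pi * \<i> * of_real (t n))) \<longlonglongrightarrow> 1"
  shows "(\<lambda>n. int_dist (t n)) \<longlonglongrightarrow> 0"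
proof -
  have "Re (exp (2 * of_real pi * \<i> * of_real (t n))) = cos (2 * pi * t n)" for n
    by (simp add: Re_exp)
  then have "(\<lambda>n. cos (2 * pi * t n)) \<longlonglongrightarrow> 1"
    using tendsto_Re[OF assms] by simp
  then have "(\<lambda>n. arccos (cos (2 * pi * t n))) \<longlonglongrightarrow> arccos 1"
    by (rule continuous_on_tendsto_compose[OF continuous_on_arccos']) auto
  then have "(\<lambda>n. arccos (cos (2 * pi * t n)) / (2 * pi)) \<longlonglongrightarrow> arccos 1 / (2 * pi)"
    by (rule tendsto_divide[OF _ tendsto_const]) simp
  then show ?thesis unfolding int_dist_eq_arccos by simp
qed

text \<open>\<Lambda> is fixed by every power of the substitution, and one exponent can exceed both
  thresholds: that of primitivity for nonempty digit sets and that of expansiveness for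
  doubling.\<close>

lemma exists_doubling_power:
  assumes sub: "substitution_delone_multiset Q D \<Lambda>" and prim: "primitive D"
    and legal: "\<And>P. subcluster P \<Lambda> \<Longrightarrow> legal Q D \<Lambda> P" and flc: "FLC \<Lambda>"
  shows "\<exists>n. doubling_substitution \<Lambda> (Q ^^ n) (subst_power Q D n)"
proof -
  have dl: "delone_multiset \<Lambda>" and ex: "expansive Q" and fin: "\<And>i j. finite (D i j)"
    and \<Lambda>: "\<Lambda> = subst_map Q D \<Lambda>"
    using sub unfolding substitution_delone_multiset_def by blast+
  have lin: "linear Q" using ex by (simp add: expansive_def)
  have ne: "\<Lambda> i \<noteq> {}" for i
    using dl by (auto simp: delone_multiset_def delone_def relatively_dense_def)
  have row: "\<exists>l. D i l \<noteq> {}" for i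
  proof -
    obtain x where "x \<in> \<Lambda> i" using ne[of i] by blast
    then have "x \<in> subst_map Q D \<Lambda> i" by (subst (asm) \<Lambda>)
    then show ?thesis unfolding mem_subst_map by blast
  qed
  obtain k where k: "\<forall>n\<ge>k. \<forall>i j. subst_power Q D n i j \<noteq> {}"
    using primitive_subst_power[OF fin prim row] by (rule exE)
  obtain N where N: "\<forall>n\<ge>N. \<forall>x. norm ((Q ^^ n) x) \<ge> 2 * norm x"
    using expansive_eventually_doubling[OF ex] by (rule exE)
  define n where "n = Suc (k + N)"
  have n: "n \<ge> 1" "n \<ge> k" "n \<ge> N" by (auto simp: n_def)
  have "doubling_substitution \<Lambda> (Q ^^ n) (subst_power Q D n)"
  proof (rule doubling_substitution.intro)
    show "linear (Q ^^ n)"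
      by (induction n) (simp_all only: funpow.simps linear_id linear_compose[OF _ lin])
    show "2 * norm x \<le> norm ((Q ^^ n) x)" for x using N n(3) by blast
    show "finite (subst_power Q D n i j)" for i j by (rule finite_subst_power[OF fin])
    show "subst_power Q D n i j \<noteq> {}" for i j using k n(2) by blast
    have "(subst_map Q D ^^ n) \<Lambda> = \<Lambda>"
      by (induction n) (simp_all only: funpow.simps o_apply id_apply \<Lambda>[symmetric])
    then show "\<Lambda> = subst_map (Q ^^ n) (subst_power Q D n) \<Lambda>"
      unfolding subst_map_funpow[OF lin] by (rule sym)
    show "delone_multiset \<Lambda>" "FLC \<Lambda>" by (rule dl flc)+
    fix P assume P: "subcluster P \<Lambda>"
    obtain k0 where k0: "\<forall>k\<ge>k0. \<exists>j v. \<forall>w\<in>\<Lambda> j. \<forall>i. \<forall>p\<in>P i. p + v + (Q ^^ k) w \<in> \<Lambda> i"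
      using legal_copies[OF lin \<Lambda> ne legal[OF P]] by (rule exE)
    \<comment> \<open>Only powers of \<open>Q ^^ n\<close> are available now;
      \<open>legal_copies\<close> serves all exponents from \<open>k0\<close> on, so the multiple n
      * k0 will do.\<close>
    have "n * k0 \<ge> k0" using n(1) by simp
    then show "\<exists>k j v. \<forall>w\<in>\<Lambda> j. \<forall>i. \<forall>p\<in>P i. p + v + ((Q ^^ n) ^^ k) w \<in> \<Lambda> i"
      using k0 unfolding funpow_mult by blast
  qed
  then show ?thesis by (rule exI)
qed

text \<open>Agreement is available only for one color \<open>j0\<close> and after an inflation by
  \<open>Q ^^ k\<close> with \<open>k\<close> depending on the return vector. Both are mere shifts
  of the index: \<open>k\<close> is an offset, and \<open>Q\<close> takes return vectors of any
  color to those of \<open>j0\<close>.\<close>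

lemma eigenvalue_tame:
  assumes S: "doubling_substitution \<Lambda> Q D" and H: "hull_system \<Lambda> \<mu>" and ef: "eigenfunction \<mu> \<alpha> f"
  shows "doubling_substitution.tame \<Lambda> Q \<alpha>"
proof -
  interpret S: doubling_substitution \<Lambda> Q D by (rule S)
  interpret H: hull_system \<Lambda> \<mu> by (rule H)
  obtain j0 where j0: "\<forall>y\<in>\<Lambda> j0. \<forall>z\<in>\<Lambda> j0. \<exists>k T. finite T \<and> (\<forall>R. \<exists>n0. \<forall>n\<ge>n0. \<forall>b. \<exists>t\<in>T. \<forall>i p.
     norm (p - (b + (Q ^^ n) t)) < R \<longrightarrow> (p \<in> \<Lambda> i \<longleftrightarrow> p + (Q ^^ n) ((Q ^^ k) (y - z)) \<in> \<Lambda> i))"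
    using S.agreement_relatively_dense by (rule exE)
  have base: "(\<lambda>n. int_dist ((Q ^^ n) x \<bullet> \<alpha>)) \<longlonglongrightarrow> 0" if x: "x \<in> S.returns j0" for x
  proof -
    obtain y z where yz: "x = y - z" "y \<in> \<Lambda> j0" "z \<in> \<Lambda> j0" using x by (auto simp: S.returns_def)
    obtain k T where T: "finite T" and agree: "\<forall>R. \<exists>n0. \<forall>n\<ge>n0. \<forall>b. \<exists>t\<in>T. \<forall>i p.
     norm (p - (b + (Q ^^ n) t)) < R \<longrightarrow> (p \<in> \<Lambda> i \<longleftrightarrow> p + (Q ^^ n) ((Q ^^ k) x) \<in> \<Lambda> i)"
      using j0[rule_format, OF yz(2,3)] unfolding yz(1) by (elim exE conjE)
    have "(\<lambda>n. H.phase \<alpha> ((Q ^^ n) ((Q ^^ k) x))) \<longlonglongrightarrow> 1"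
      by (rule H.eigenfunction_phase_limit[OF ef T, where \<tau> = "\<lambda>n t. (Q ^^ n) t"]) (rule agree[THEN spec])
    then have "(\<lambda>n. int_dist ((Q ^^ n) ((Q ^^ k) x) \<bullet> \<alpha>)) \<longlonglongrightarrow> 0"
      unfolding H.phase_def by (rule int_dist_tendsto_0)
    then have "(\<lambda>n. int_dist ((Q ^^ (n + k)) x \<bullet> \<alpha>)) \<longlonglongrightarrow> 0" by (simp add: funpow_add)
    then show ?thesis by (rule LIMSEQ_offset)
  qed
  have "(\<lambda>n. int_dist ((Q ^^ n) x \<bullet> \<alpha>)) \<longlonglongrightarrow> 0" if x: "x \<in> S.returns i" for x i
  proof -
    have "(\<lambda>n. int_dist ((Q ^^ n) (Q x) \<bullet> \<alpha>)) \<longlonglongrightarrow> 0" by (rule base[OF S.Q_returns[OF x]])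
    then have "(\<lambda>n. int_dist ((Q ^^ Suc n) x \<bullet> \<alpha>)) \<longlonglongrightarrow> 0" by (simp add: funpow_swap1)
    then show ?thesis by (rule LIMSEQ_imp_Suc)
  qed
  then show ?thesis unfolding S.tame_def by blast
qed

theorem theorem4p11:
  fixes \<Lambda> :: "'m::finite \<Rightarrow> (real^'d) set"
    and Q :: "real^'d \<Rightarrow> real^'d"
    and D :: "'m \<Rightarrow> 'm \<Rightarrow> (real^'d) set"
    and \<mu> :: "('m \<Rightarrow> (real^'d) set) measure"
  assumes "substitution_delone_multiset Q D \<Lambda>"
    and "primitive D"
    and "\<And>P. subcluster P \<Lambda> \<Longrightarrow> legal Q D \<Lambda> P"
    and "FLC \<Lambda>"
    and "ergodic_probability \<Lambda> \<mu>"
    and "pure_point_spectrum \<mu>"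
  shows "meyer (\<Union>i. \<Lambda> i)"
proof -
  obtain n where S: "doubling_substitution \<Lambda> (Q ^^ n) (subst_power Q D n)"
    using exists_doubling_power[OF assms(1-4)] by (rule exE)
  have "delone_multiset \<Lambda>" using assms(1) by (simp add: substitution_delone_multiset_def)
  then have H: "hull_system \<Lambda> \<mu>"
    using assms(5) by unfold_locales (auto simp: ergodic_probability_def)
  have "\<exists>\<alpha>. doubling_substitution.tame \<Lambda> (Q ^^ n) \<alpha> \<and> w \<bullet> \<alpha> \<noteq> 0" if "w \<noteq> 0" for w
    using hull_system.eigenvalues_span[OF H assms(6) that] eigenvalue_tame[OF S H] by blast
  from doubling_substitution.meyer_if_tame_separating[OF S this] show ?thesis
    by (simp add: supp_def)
qed

end
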